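(* Let $K$ be a number field of degree $m=[K:\mathbb{Q}]<\infty$, let $S$ be a finite set of places of $K$ containing all the archimedean places, let $s$ be the cardinality of $S$, and let $U_S$ be the group of $S$-units of $K$. Let $\lambda,\mu\in K\setminus\{0\}$. Then the number of solutions $(x,y)\in U_S^2$ of the equation $\lambda x+\mu y=1$ is bounded from above by $$\min\Big\{2.81864\cdot(46.8312)^s+5\,(3.22803)^{m}\cdot 47^s,\ \ 3.06759\cdot(44.9866)^s+5\,(3.36406)^{m}\cdot 45^s\Big\}.$$
   Context: $U_S$ is the set of $x\in K\setminus\{0\}$ with $|x|_v=1$ for every place $v$ of $K$ not in $S$. The cardinality $s$ counts all places in $S$, archimedean ones included. *)

theory Defs
  imports Complex_Main
begin

definition rat_scale :: "rat \<Rightarrow> 'k::field_char_0 \<Rightarrow> 'k" where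
  "rat_scale q x = of_rat q * x"

global_interpretation rat_vs: vector_space "rat_scale :: rat \<Rightarrow> 'k::field_char_0 \<Rightarrow> 'k"
  by unfold_locales (simp_all add: rat_scale_def algebra_simps of_rat_add of_rat_mult)

definition number_field :: "'k::field_char_0 itself \<Rightarrow> bool" where
  "number_field _ \<longleftrightarrow> (\<exists>B :: 'k set. finite B \<and> rat_vs.span B = UNIV)"

definition field_degree :: "'k::field_char_0 itself \<Rightarrow> nat" where
  "field_degree _ = rat_vs.dim (UNIV :: 'k set)"

definition absolute_value :: "('k::field \<Rightarrow> real) \<Rightarrow> bool" where
  "absolute_value a \<longleftrightarrow>
     (\<forall>x. 0 \<le> a x) \<and>
     (\<forall>x. a x = 0 \<longleftrightarrow> x = 0) \<and>
     (\<forall>x y. a (x * y) = a x * a y) \<and>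
     (\<forall>x y. a (x + y) \<le> a x + a y)"

definition nontrivial_absolute_values :: "('k::field \<Rightarrow> real) set" where
  "nontrivial_absolute_values = {a. absolute_value a \<and> (\<exists>x. x \<noteq> 0 \<and> a x \<noteq> 1)}"

definition absolute_value_rel :: "(('k::field \<Rightarrow> real) \<times> ('k \<Rightarrow> real)) set" where
  "absolute_value_rel =
     {(a, b). a \<in> nontrivial_absolute_values \<and> b \<in> nontrivial_absolute_values \<and>
              (\<exists>c>0. \<forall>x. b x = a x powr c)}"

lemma equiv_absolute_value_rel:
  "equiv nontrivial_absolute_values (absolute_value_rel :: (('k::field \<Rightarrow> real) \<times> _) set)"
proof (rule equivI)
  show "absolute_value_rel \<subseteq> nontrivial_absolute_values \<times>
      (nontrivial_absolute_values :: ('k \<Rightarrow> real) set)"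
    by (auto simp: absolute_value_rel_def)
  show "refl_on nontrivial_absolute_values (absolute_value_rel :: (('k \<Rightarrow> real) \<times> _) set)"
    by (auto simp: refl_on_def absolute_value_rel_def nontrivial_absolute_values_def
        absolute_value_def intro!: exI[of _ "1::real"])
  show "sym (absolute_value_rel :: (('k \<Rightarrow> real) \<times> _) set)"
  proof (rule symI)
    fix a b :: "'k \<Rightarrow> real"
    assume ab: "(a, b) \<in> absolute_value_rel"
    then obtain c where c: "c > 0" "\<And>x. b x = a x powr c"
      by (auto simp: absolute_value_rel_def)
    have "a x \<ge> 0" for x
      using ab by (auto simp: absolute_value_rel_def nontrivial_absolute_values_def
          absolute_value_def)
    then have "\<forall>x. a x = b x powr (1 / c)"
      using c by (simp add: powr_powr)
    with ab c(1) show "(b, a) \<in> absolute_value_rel"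
      by (auto simp: absolute_value_rel_def intro!: exI[of _ "1 / c"])
  qed
  show "trans (absolute_value_rel :: (('k \<Rightarrow> real) \<times> _) set)"
  proof (rule transI)
    fix a b d :: "'k \<Rightarrow> real"
    assume ab: "(a, b) \<in> absolute_value_rel" and bd: "(b, d) \<in> absolute_value_rel"
    obtain c where c: "c > 0" "\<And>x. b x = a x powr c"
      using ab by (auto simp: absolute_value_rel_def)
    obtain e where e: "e > 0" "\<And>x. d x = b x powr e"
      using bd by (auto simp: absolute_value_rel_def)
    have "\<exists>f>0. \<forall>x. d x = a x powr f"
      using c e by (intro exI[of _ "c * e"]) (simp add: powr_powr)
    with ab bd show "(a, d) \<in> absolute_value_rel"
      by (simp add: absolute_value_rel_def)
  qed
qed

definition places :: "('k::field \<Rightarrow> real) set set" where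
  "places = nontrivial_absolute_values // absolute_value_rel"

definition archimedean_places :: "('k::field \<Rightarrow> real) set set" where
  "archimedean_places =
     {v \<in> places. \<exists>a\<in>v. \<not> (\<forall>x y. a (x + y) \<le> max (a x) (a y))}"

text \<open>
  Whether a place gives \<open>x\<close> absolute value 1 does not depend on the representative
  (lemma \<open>place_eq_one_iff\<close>), so no normalisation of the absolute values is fixed.
\<close>

definition S_units :: "('k::field \<Rightarrow> real) set set \<Rightarrow> 'k set" where
  "S_units S = {x. x \<noteq> 0 \<and> (\<forall>v \<in> places - S. \<forall>a\<in>v. a x = 1)}"

lemma place_eq_one_iff:
  fixes a b :: "'k::field \<Rightarrow> real"
  assumes "v \<in> places" "a \<in> v" "b \<in> v"
  shows "a x = 1 \<longleftrightarrow> b x = 1"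
proof -
  have "(a, b) \<in> absolute_value_rel"
    using assms unfolding places_def
    by (meson equiv_absolute_value_rel quotient_eq_iff)
  then obtain c where c: "c > 0" "b x = a x powr c" and "a x \<ge> 0"
    by (auto simp: absolute_value_rel_def nontrivial_absolute_values_def absolute_value_def)
  show ?thesis
  proof
    assume "b x = 1"
    then have "(a x powr c) powr (1 / c) = 1"
      using c by simp
    then show "a x = 1"
      using c(1) \<open>a x \<ge> 0\<close> by (simp add: powr_powr)
  qed (simp add: c)
qed

end

theory Submission
  imports Defs "HOL-Library.FuncSet" "HOL-Algebra.Algebraic_Closure_Type" "Jordan_Normal_Form.Char_Poly"
begin

text \<open>
  A solution gives a point \<open>P = (lam * x, mu * y, -1)\<close> with coordinate sum 0. At each place the two
  larger coordinates are of comparable size; let \<open>dd v P\<close> measure how much smaller the third one is.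
  If two points have the same small coordinate at \<open>v\<close>, their minor \<open>Q 0 * P 1 - Q 1 * P 0\<close> is small
  at \<open>v\<close>, while the product formula prevents a nonzero number from being small at all places. For
  points of one class (same smallest coordinates, same octants, similar distribution of \<open>dd\<close> over
  the places) this forces the heights to grow geometrically. Replacing \<open>P\<close> in the minor by the
  vector \<open>V\<close> of diagonal Pade forms with \<open>V i = P i ^ (2 * r + 1) * pade_form r (P (i + 1)) (P (i + 2))\<close>,
  which again has sum 0, excludes a large ratio between two large heights. So a class contains at
  most 45 large points; the small points are separated by a grid. Counting classes gives at most
  \<open>5 * 3.2 ^ m * 45 ^ s\<close> solutions, which is below both terms of the minimum.

  The product formula comes from the norm, the product of the complex embeddings. Its \<open>p\<close>-adic
  logarithm is a nonnegative combination of the logarithms of the absolute values above \<open>p\<close>: an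
  element with values at most 1 at all of them is integral over the \<open>p\<close>-local integers (by
  Chevalley's construction of valuation rings), hence has \<open>p\<close>-integral norm, and weak approximation
  separates them. Ostrowski's theorem is not needed, because nonarchimedean places that do not lie
  above a prime can only make \<open>S\<close> larger.
\<close>

section \<open>Pade forms\<close>

text \<open>The constants balance around the proportion 5/6. If two points of a class share at least
  the proportion \<open>c\<close> of \<open>g\<close>, place by place, the minor gives growth by the
  factor 3 * c - 1, which is 3/2 at c = 5/6. The Pade minors with g Q / g P near 2 * r compare 2 * c
  * r with 5/3 * r and so break even at the same c = 5/6. Hence any fixed excess over 5/6 excludes
  large ratios, and 251/301 is such an excess. On n + 1 places about (6 * n choose n) integer
  profiles keep the proportion 5/6; this number grows like (6^6 / 5^5)^n, and the base 14.93 leaves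
  room below 15 for the excess. Three choices of the smallest coordinate per place then give 45 = 3
  * 15. The base 3.2 pays for the archimedean data: 2 octants at a real place, 8 at a complex one,
  where the weight is at least 2, and for small points 144 grid cells, with 3 * 144 below 45 *
  3.2^2. One profile entry is determined by the others, so large points cost 45 * (6/5) / 15 = 3.6
  and small ones 1 times 3.2^m * 45^s, together below 5.\<close>

lemma pderiv_sum: "pderiv (\<Sum>i\<in>A. f i) = (\<Sum>i\<in>A. pderiv (f i))"
  by (induction A rule: infinite_finite_induct) (auto simp: pderiv_add)

lemma antiderivative_exists:
  fixes p :: "'a::field_char_0 poly"
  shows "\<exists>F. pderiv F = p"
proof -
  have "pderiv (\<Sum>i\<le>degree p. monom (coeff p i / of_nat (Suc i)) (Suc i)) =
      (\<Sum>i\<le>degree p. monom (coeff p i) i)"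
    by (simp add: pderiv_sum pderiv_monom del: of_nat_Suc)
  also have "\<dots> = p"
    by (rule poly_as_sum_of_monoms)
  finally show ?thesis
    by blast
qed

text \<open>
  The formal integral over \<open>[0, 1]\<close>, which makes sense over any field of characteristic 0; it avoids
  the combinatorial identity behind \<open>pade_vec_sum_zero\<close>.
\<close>

definition unit_integral :: "'a::field_char_0 poly \<Rightarrow> 'a" where
  "unit_integral p = (let F = (SOME F. pderiv F = p) in poly F 1 - poly F 0)"

lemma unit_integral_pderiv: "unit_integral (pderiv F) = poly F 1 - poly F (0::'a::field_char_0)"
proof -
  define G where "G = (SOME G. pderiv G = pderiv F)"
  have "pderiv G = pderiv F"
    unfolding G_def by (rule someI[of _ F]) simp
  then have "pderiv (G - F) = 0"
    by (simp add: pderiv_diff)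
  then obtain c where "G - F = [:c:]"
    using pderiv_eq_0_iff degree_eq_zeroE by blast
  then have "G = F + [:c:]"
    by (simp add: algebra_simps)
  then show ?thesis
    unfolding unit_integral_def Let_def G_def[symmetric] by simp
qed

lemma unit_integral_add: "unit_integral (p + q) = unit_integral p + unit_integral q"
  by (metis (no_types, lifting) add_diff_add antiderivative_exists pderiv_add poly_add unit_integral_pderiv)

lemma unit_integral_smult: "unit_integral (smult c p) = c * unit_integral p"
  by (metis (no_types, lifting) antiderivative_exists pderiv_smult poly_smult right_diff_distrib unit_integral_pderiv)

lemma unit_integral_sum: "unit_integral (\<Sum>i\<in>A. f i) = (\<Sum>i\<in>A. unit_integral (f i))"
proof (induction A rule: infinite_finite_induct)
  case empty
  show ?case using unit_integral_smult[of 0 0] by simp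
next
  case (infinite A)
  then show ?case using unit_integral_smult[of 0 0] by simp
qed (simp add: unit_integral_add)

text \<open>Euler's beta integral. The step integrates the derivative of
  \<open>t ^ (a + 1) * (1 - t) ^ (b + 1)\<close>, whose boundary values vanish, and so trades a
  factor \<open>1 - t\<close> for a factor \<open>t\<close>.\<close>

lemma unit_integral_beta:
  "unit_integral ([:0, 1:] ^ a * [:1, -1:] ^ b :: 'a::field_char_0 poly) =
     fact a * fact b / fact (Suc (a + b))"
proof (induction b arbitrary: a)
  case 0
  have "pderiv (smult (1 / of_nat (Suc a)) ([:0, 1:] ^ Suc a)) = ([:0, 1:] ^ a :: 'a poly)"
    by (simp add: pderiv_smult pderiv_power_Suc pderiv_pCons del: of_nat_Suc power_Suc)
  then have "unit_integral ([:0, 1:] ^ a :: 'a poly) = 1 / of_nat (Suc a)"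
    by (metis (no_types, lifting) unit_integral_pderiv poly_smult poly_power poly_pCons poly_0
        mult_1 mult.right_neutral power_one add_0 mult_zero_left power_0_Suc diff_zero mult_zero_right add.right_neutral)
  then show ?case by (simp add: field_simps del: of_nat_Suc)
next
  case (Suc b)
  have "pderiv ([:0, 1:] ^ Suc a * [:1, -1:] ^ Suc b) =
      smult (of_nat (Suc a)) ([:0, 1:] ^ a * [:1, -1:] ^ Suc b) +
      smult (- of_nat (Suc b)) ([:0, 1:] ^ Suc a * [:1, -1:] ^ b :: 'a poly)"
    by (simp add: pderiv_mult pderiv_power_Suc pderiv_pCons algebra_simps del: of_nat_Suc power_Suc)
  then have "unit_integral (smult (of_nat (Suc a)) ([:0, 1:] ^ a * [:1, -1:] ^ Suc b) +
      smult (- of_nat (Suc b)) ([:0, 1:] ^ Suc a * [:1, -1:] ^ b :: 'a poly)) = 0"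
    using unit_integral_pderiv[of "[:0, 1:] ^ Suc a * [:1, -1:] ^ Suc b :: 'a poly"] by simp
  then have "of_nat (Suc a) * unit_integral ([:0, 1:] ^ a * [:1, -1:] ^ Suc b :: 'a poly) =
      of_nat (Suc b) * (fact (Suc a) * fact b / fact (Suc (Suc a + b)))"
    unfolding unit_integral_add unit_integral_smult Suc.IH
    by (metis add_eq_0_iff2 minus_minus mult_minus_left)
  also have "\<dots> = of_nat (Suc a) * (fact a * fact (Suc b) / fact (Suc (a + Suc b)))"
    by (simp only: fact_Suc add_Suc add_Suc_right) (simp add: mult_ac del: of_nat_Suc)
  finally show ?case
    using mult_left_cancel[OF of_nat_neq_0[of a, where 'a='a]] by blast
qed

text \<open>A homogeneous Jacobi polynomial: up to the constant in
  \<open>power_binomial_integral\<close> it is the integral of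
  \<open>t ^ r * (1 - t) ^ r * (x * t - y * (1 - t)) ^ r\<close> over [0, 1]. Its integer
  coefficients keep it inside every subring and cost nothing in ultrametric estimates.\<close>

definition pade_form :: "nat \<Rightarrow> 'a::comm_ring_1 \<Rightarrow> 'a \<Rightarrow> 'a" where
  "pade_form r x y =
     (\<Sum>k\<le>r. of_nat ((r + k choose k) * (2 * r - k choose r)) * x ^ k * (- y) ^ (r - k))"

lemma power_binomial_integral:
  fixes x y :: "'a::field_char_0"
  shows "unit_integral ([:0, 1:] ^ r * [:1, -1:] ^ r * (smult x [:0, 1:] - smult y [:1, -1:]) ^ r) =
    fact r ^ 3 / fact (3 * r + 1) * pade_form r x y"
proof -
  have "(smult x [:0, 1:] + smult (- y) [:1, -1:]) ^ r =
     (\<Sum>k\<le>r. of_nat (r choose k) * (smult x [:0, 1:]) ^ k * (smult (- y) [:1, -1:]) ^ (r - k))"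
    by (rule binomial_ring)
  also have "\<dots> = (\<Sum>k\<le>r. smult (of_nat (r choose k) * x ^ k * (- y) ^ (r - k)) ([:0, 1:] ^ k * [:1, -1:] ^ (r - k)))"
    by (intro sum.cong refl) (simp only: smult_power of_nat_poly mult_smult_left mult_smult_right smult_smult mult_1 flip: smult_one, simp add: mult_ac)
  finally have "[:0, 1:] ^ r * [:1, -1:] ^ r * (smult x [:0, 1:] - smult y [:1, -1:]) ^ r =
    (\<Sum>k\<le>r. [:0, 1:] ^ r * [:1, -1:] ^ r * smult (of_nat (r choose k) * x ^ k * (- y) ^ (r - k)) ([:0, 1:] ^ k * [:1, -1:] ^ (r - k)))"
    by (simp add: sum_distrib_left)
  also have "\<dots> = (\<Sum>k\<le>r. smult (of_nat (r choose k) * x ^ k * (- y) ^ (r - k)) ([:0, 1:] ^ (r + k) * [:1, -1:] ^ (2 * r - k)))"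
  proof (intro sum.cong refl)
    fix k assume "k \<in> {..r}"
    then have "2 * r - k = r + (r - k)" by simp
    then show "[:0, 1:] ^ r * [:1, -1:] ^ r * smult (of_nat (r choose k) * x ^ k * (- y) ^ (r - k)) ([:0, 1:] ^ k * [:1, -1:] ^ (r - k)) =
      smult (of_nat (r choose k) * x ^ k * (- y) ^ (r - k)) ([:0, 1:] ^ (r + k) * [:1, -1:] ^ (2 * r - k))"
      by (simp add: power_add mult_ac)
  qed
  finally have "[:0, 1:] ^ r * [:1, -1:] ^ r * (smult x [:0, 1:] - smult y [:1, -1:]) ^ r =
    (\<Sum>k\<le>r. smult (of_nat (r choose k) * x ^ k * (- y) ^ (r - k)) ([:0, 1:] ^ (r + k) * [:1, -1:] ^ (2 * r - k)))" .
  then have "unit_integral ([:0, 1:] ^ r * [:1, -1:] ^ r * (smult x [:0, 1:] - smult y [:1, -1:]) ^ r) =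
    (\<Sum>k\<le>r. of_nat (r choose k) * x ^ k * (- y) ^ (r - k) * (fact (r + k) * fact (2 * r - k) / fact (Suc (r + k + (2 * r - k)))))"
    by (simp only: unit_integral_sum unit_integral_smult unit_integral_beta)
  also have "\<dots> = (\<Sum>k\<le>r. fact r ^ 3 / fact (3 * r + 1) * (of_nat ((r + k choose k) * (2 * r - k choose r)) * x ^ k * (- y) ^ (r - k)))"
  proof (intro sum.cong refl)
    fix k assume "k \<in> {..r}"
    then have k: "k \<le> r" by simp
    have "Suc (r + k + (2 * r - k)) = 3 * r + 1" using k by simp
    moreover have "(of_nat (r choose k) :: 'a) = fact r / (fact k * fact (r - k))"
      using k by (rule binomial_fact)
    moreover have "(of_nat (r + k choose k) :: 'a) = fact (r + k) / (fact k * fact r)"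
      using binomial_fact[of k "r + k"] by simp
    moreover have "2 * r - k - r = r - k" using k by simp
    then have "(of_nat (2 * r - k choose r) :: 'a) = fact (2 * r - k) / (fact r * fact (r - k))"
      using binomial_fact[of r "2 * r - k", where 'a='a] k by simp
    ultimately show "of_nat (r choose k) * x ^ k * (- y) ^ (r - k) * (fact (r + k) * fact (2 * r - k) / fact (Suc (r + k + (2 * r - k)))) =
      fact r ^ 3 / fact (3 * r + 1) * (of_nat ((r + k choose k) * (2 * r - k choose r)) * x ^ k * (- y) ^ (r - k))"
      by (simp add: power3_eq_cube mult_ac)
  qed
  finally show ?thesis
    by (simp add: pade_form_def sum_distrib_left)
qed

text \<open>The substitution \<open>l\<close> carries 0 and 1 to the roots \<open>a\<close> and
  \<open>b\<close>; the factor of the third root becomes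
  \<open>(b - c) * t - (c - a) * (1 - t)\<close>.\<close>

lemma pade_form_integral:
  fixes a b c :: "'a::field_char_0"
  assumes F: "pderiv F = ([:-a, 1:] * [:-b, 1:] * [:-c, 1:]) ^ r"
  shows "poly F b - poly F a =
    (-1) ^ r * fact r ^ 3 / fact (3 * r + 1) * ((b - a) ^ (2 * r + 1) * pade_form r (b - c) (c - a))"
proof -
  define l where "l = [:a, b - a:]"
  have "poly F b - poly F a = unit_integral (pderiv (F \<circ>\<^sub>p l))"
    by (simp add: unit_integral_pderiv poly_pcompose l_def)
  also have "pderiv (F \<circ>\<^sub>p l) = smult ((b - a) * (- ((b - a) ^ 2)) ^ r)
     ([:0, 1:] ^ r * [:1, -1:] ^ r * (smult (b - c) [:0, 1:] - smult (c - a) [:1, -1:]) ^ r)"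
  proof -
    have 1: "[:-a, 1:] \<circ>\<^sub>p l = smult (b - a) [:0, 1:]" by (simp add: l_def pcompose_pCons)
    have 2: "[:-b, 1:] \<circ>\<^sub>p l = smult (-(b - a)) [:1, -1:]" by (simp add: l_def pcompose_pCons)
    have 3: "[:-c, 1:] \<circ>\<^sub>p l = (smult (b - c) [:0, 1:] - smult (c - a) [:1, -1:])"
      by (simp add: l_def pcompose_pCons)
    have pw: "(p ^ r) \<circ>\<^sub>p l = (p \<circ>\<^sub>p l) ^ r" for p :: "'a poly"
      by (induction r) (simp_all add: pcompose_mult pcompose_1)
    have "pderiv (F \<circ>\<^sub>p l) = (smult (b - a) [:0, 1:] * smult (-(b - a)) [:1, -1:] *
       (smult (b - c) [:0, 1:] - smult (c - a) [:1, -1:])) ^ r * [:b - a:]"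
      unfolding pderiv_pcompose F pw pcompose_mult 1 2 3 by (simp add: l_def pderiv_pCons)
    also have "\<dots> = (smult (- ((b - a) ^ 2)) ([:0, 1:] * [:1, -1:] *
       (smult (b - c) [:0, 1:] - smult (c - a) [:1, -1:]))) ^ r * [:b - a:]"
    proof -
      have "(b - a) * - (b - a) = - ((b - a) ^ 2)" by (simp only: power2_eq_square mult_minus_right)
      then show ?thesis by (simp only: mult_smult_left mult_smult_right smult_smult mult.commute[of "- (b - a)" "b - a"])
    qed
    also have "\<dots> = smult ((b - a) * (- ((b - a) ^ 2)) ^ r) (([:0, 1:] * [:1, -1:] *
       (smult (b - c) [:0, 1:] - smult (c - a) [:1, -1:])) ^ r)"
      by (simp only: smult_power) (simp add: mult.commute)
    finally show ?thesis by (simp only: power_mult_distrib)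
  qed
  finally have "poly F b - poly F a = ((b - a) * (- ((b - a) ^ 2)) ^ r) * (fact r ^ 3 / fact (3 * r + 1) * pade_form r (b - c) (c - a))"
    by (simp only: unit_integral_smult power_binomial_integral)
  also have "(- ((b - a) ^ 2)) ^ r = (-1) ^ r * (b - a) ^ (2 * r)"
    by (simp add: power_minus[of "(b-a)^2"] power_mult)
  finally show ?thesis by (simp add: mult_ac)
qed

definition pade_vec :: "nat \<Rightarrow> 'a::comm_ring_1 \<Rightarrow> 'a \<Rightarrow> 'a \<Rightarrow> 'a" where
  "pade_vec r x y z = x ^ (2 * r + 1) * pade_form r y z"

text \<open>
  Each entry is the integral of \<open>L ^ r\<close>, for one cubic \<open>L\<close>, between two of the roots of \<open>L\<close>. The
  three integrals run around a closed cycle, whence their sum is 0.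
\<close>

lemma pade_vec_integral:
  fixes x y z :: "'a::field_char_0"
  assumes "x + y + z = 0" and F: "pderiv F = ([:0, 1:] * [:z, 1:] * [:-y, 1:]) ^ r"
  defines "\<kappa> \<equiv> (-1) ^ (r + 1) * fact r ^ 3 / fact (3 * r + 1)"
  shows "poly F y - poly F (-z) = \<kappa> * pade_vec r x y z"
    and "poly F 0 - poly F y = \<kappa> * pade_vec r y z x"
    and "poly F (-z) - poly F 0 = \<kappa> * pade_vec r z x y"
proof -
  \<comment> \<open>The roots \<open>0\<close>, \<open>y\<close>, \<open>-z\<close> of the cubic
    have the differences \<open>-z - y = x\<close>, \<open>y - 0 = y\<close> and
    \<open>0 - (-z) = z\<close>, so the three entries are one formula read around the cycle of
    roots.\<close>
  have key: "poly F b - poly F a = \<kappa> * pade_vec r (a - b) (b - c) (c - a)"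
    if "[:0, 1:] * [:z, 1:] * [:-y, 1:] = [:-a, 1:] * [:-b, 1:] * [:-c, 1:]" for a b c
  proof -
    have "poly F b - poly F a =
        (-1) ^ r * fact r ^ 3 / fact (3 * r + 1) * ((b - a) ^ (2 * r + 1) * pade_form r (b - c) (c - a))"
      using F unfolding that by (rule pade_form_integral)
    moreover have "(b - a) ^ (2 * r + 1) = - ((a - b) ^ (2 * r + 1))"
      using power_minus_odd[of "2 * r + 1" "a - b"] by simp
    ultimately show ?thesis
      by (simp only: \<kappa>_def pade_vec_def) simp
  qed
  have "x = (x + y + z) - y - z" by simp
  then have x: "x = - y - z" using assms(1) by simp
  show "poly F y - poly F (-z) = \<kappa> * pade_vec r x y z"
    using key[of "-z" y 0] by (simp add: x minus_diff_commute)
  show "poly F 0 - poly F y = \<kappa> * pade_vec r y z x"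
    using key[of y 0 "-z"] by (simp add: x minus_diff_commute)
  show "poly F (-z) - poly F 0 = \<kappa> * pade_vec r z x y"
    using key[of 0 "-z" y] by (simp add: x minus_diff_commute)
qed

lemma pade_constant_nonzero:
  "(-1) ^ (r + 1) * fact r ^ 3 / fact (3 * r + 1) \<noteq> (0::'a::field_char_0)"
  by (simp del: fact_Suc)

lemma pade_vec_sum_zero:
  fixes x y z :: "'a::field_char_0"
  assumes "x + y + z = 0"
  shows "pade_vec r x y z + pade_vec r y z x + pade_vec r z x y = 0"
proof -
  obtain F where F: "pderiv F = ([:0, 1:] * [:z, 1:] * [:-y, 1:]) ^ r"
    using antiderivative_exists by blast
  have "(-1) ^ (r + 1) * fact r ^ 3 / fact (3 * r + 1) * (pade_vec r x y z + pade_vec r y z x + pade_vec r z x y) = 0"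
    unfolding distrib_left pade_vec_integral[OF assms F, symmetric] by simp
  then show ?thesis
    using pade_constant_nonzero[of r, where 'a='a] by (metis mult_eq_0_iff)
qed

text \<open>In characteristic 0 differentiation lowers the order of a root by exactly 1.\<close>

lemma power_dvd_of_pderiv:
  fixes F :: "'a::field_char_0 poly"
  assumes "poly F a = 0" "[:-a, 1:] ^ r dvd pderiv F"
  shows "[:-a, 1:] ^ Suc r dvd F"
proof (cases "F = 0")
  case False
  show ?thesis
  proof (cases "pderiv F = 0")
    case True
    then obtain c where "F = [:c:]"
      using pderiv_eq_0_iff degree_eq_zeroE by blast
    with assms(1) show ?thesis by simp
  next
    case nz: False
    have "order a F \<noteq> 0" using assms(1) False by (simp add: order_root)
    then have "order a F = Suc (order a (pderiv F))"
      using order_pderiv[OF False assms(1)] by simp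
    moreover have "r \<le> order a (pderiv F)" using assms(2) nz by (simp add: order_divides)
    ultimately show ?thesis
      using order_1[of a F] by (metis Suc_le_mono dvd_trans le_imp_power_dvd)
  qed
qed simp

lemma linear_power_dvd_cancel:
  fixes G :: "'a::field poly"
  assumes "a \<noteq> b" "[:-a, 1:] ^ n dvd [:-b, 1:] ^ k * G"
  shows "[:-a, 1:] ^ n dvd G"
proof (cases "G = 0")
  case False
  then have nz: "[:-b, 1:] ^ k * G \<noteq> 0" by simp
  have "order a ([:-b, 1:] ^ k) = 0"
    using assms(1) by (intro order_0I) simp
  then have "order a ([:-b, 1:] ^ k * G) = order a G"
    using order_mult[OF nz] by simp
  then show ?thesis
    using assms(2) nz False by (simp add: order_divides)
qed simp

text \<open>The two relations between \<open>u\<close> and \<open>v\<close> come from comparing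
  coefficients at the end of \<open>pade_independent\<close>. Eliminating \<open>u\<close> leaves
  \<open>(z - y)\<^sup>2 + 3 * (y * z)\<close>, half of the sum of squares.\<close>

lemma sum_squares_zero_criterion:
  fixes x y z u v :: "'a::field_char_0"
  assumes x: "x = - y - z" and u: "3 * u = (z - y) * v" and su: "(z - y) * u = - (y * z * v)"
    and v: "v \<noteq> 0"
  shows "x\<^sup>2 + y\<^sup>2 + z\<^sup>2 = 0"
proof -
  have "v * ((z - y)\<^sup>2 + 3 * (y * z)) = (z - y) * ((z - y) * v) + 3 * (y * z * v)"
    by (simp add: algebra_simps power2_eq_square)
  also have "\<dots> = (z - y) * (3 * u) + 3 * (y * z * v)" by (simp only: u)
  also have "\<dots> = 3 * ((z - y) * u) + 3 * (y * z * v)" by (simp only: mult.left_commute)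
  also have "\<dots> = 0" by (simp only: su) simp
  finally have "(z - y)\<^sup>2 + 3 * (y * z) = 0" using v by (simp only: mult_eq_0_iff) simp
  moreover have "x\<^sup>2 + y\<^sup>2 + z\<^sup>2 = 2 * ((z - y)\<^sup>2 + 3 * (y * z))"
    unfolding x by (simp add: algebra_simps power2_eq_square)
  ultimately show ?thesis by simp
qed

text \<open>
  A dependency gives an antiderivative \<open>F\<close> that vanishes to order \<open>r + 1\<close> at all three roots of \<open>L\<close>.
  By degrees \<open>F = L ^ (r + 1)\<close> times a linear factor, and comparing \<open>F'\<close> with its known form
  shows that the roots of \<open>L\<close> form an equilateral triangle.
\<close>

lemma pade_independent:
  fixes x y z :: "'a::field_char_0"
  assumes sum: "x + y + z = 0" and nz: "x \<noteq> 0" "y \<noteq> 0" "z \<noteq> 0"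
    and \<alpha>\<beta>: "(\<alpha>, \<beta>) \<noteq> (0, 0)"
    and rel: "\<alpha> * pade_vec r x y z + \<beta> * pade_vec (Suc r) x y z = 0"
      "\<alpha> * pade_vec r y z x + \<beta> * pade_vec (Suc r) y z x = 0"
  shows "x\<^sup>2 + y\<^sup>2 + z\<^sup>2 = 0"
proof -
  define L where "L = [:0, 1:] * [:z, 1:] * [:-y, 1:]"
  define k where "k r = ((-1) ^ (r + 1) * fact r ^ 3 / fact (3 * r + 1) :: 'a)" for r
  have k0: "k r \<noteq> 0" for r unfolding k_def by (rule pade_constant_nonzero)
  obtain F0 where F0: "pderiv F0 = L ^ r" using antiderivative_exists by blast
  obtain F1 where F1: "pderiv F1 = L ^ Suc r" using antiderivative_exists by blast
  \<comment> \<open>The weights undo the constants of the integrals, so that \<open>rel\<close> says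
    that \<open>G\<close> takes the same value at all three roots.\<close>
  define a b where "a = \<alpha> / k r" and "b = \<beta> / k (Suc r)"
  have ab: "a \<noteq> 0 \<or> b \<noteq> 0" using \<alpha>\<beta> k0 by (auto simp: a_def b_def)
  define G where "G = smult a F0 + smult b F1"
  define F where "F = G - [:poly G 0:]"
  have dF: "pderiv F = L ^ r * (smult b L + [:a:])"
    by (simp add: F_def G_def pderiv_diff pderiv_add pderiv_smult F0 F1 algebra_simps pderiv_pCons)
  note i0 = pade_vec_integral[OF sum F0[unfolded L_def], folded k_def]
  note i1 = pade_vec_integral[OF sum F1[unfolded L_def], folded k_def]
  have e1: "poly G y - poly G (-z) = \<alpha> * pade_vec r x y z + \<beta> * pade_vec (Suc r) x y z"
  proof -
    have "poly G y - poly G (-z) = a * (poly F0 y - poly F0 (-z)) + b * (poly F1 y - poly F1 (-z))"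
      by (simp add: G_def algebra_simps)
    then show ?thesis unfolding i0 i1 using k0 by (simp add: a_def b_def)
  qed
  have e2: "poly G 0 - poly G y = \<alpha> * pade_vec r y z x + \<beta> * pade_vec (Suc r) y z x"
  proof -
    have "poly G 0 - poly G y = a * (poly F0 0 - poly F0 y) + b * (poly F1 0 - poly F1 y)"
      by (simp add: G_def algebra_simps)
    then show ?thesis unfolding i0 i1 using k0 by (simp add: a_def b_def)
  qed
  have roots: "poly F 0 = 0" "poly F (-z) = 0" "poly F y = 0"
    using e1 e2 rel by (auto simp: F_def)
  have Lr: "L ^ r dvd pderiv F" by (simp add: dF)
  have d: "[:0, 1:] ^ Suc r dvd F" "[:z, 1:] ^ Suc r dvd F" "[:-y, 1:] ^ Suc r dvd F"
  proof -
    have "[:0, 1:] ^ r dvd L ^ r" "[:z, 1:] ^ r dvd L ^ r" "[:-y, 1:] ^ r dvd L ^ r"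
      by (intro dvd_power_same; simp add: L_def del: mult_pCons_left mult_pCons_right)+
    then show "[:0, 1:] ^ Suc r dvd F" "[:z, 1:] ^ Suc r dvd F" "[:-y, 1:] ^ Suc r dvd F"
      using power_dvd_of_pderiv[of F 0 r] power_dvd_of_pderiv[of F "-z" r] power_dvd_of_pderiv[of F y r]
        roots Lr by (auto intro: dvd_trans simp del: power_Suc)
  qed
  have "x = (x + y + z) - y - z" by simp
  then have x: "x = - y - z" using sum by simp
  obtain F2 where F2: "F = [:0, 1:] ^ Suc r * F2" using d(1) by (elim dvdE)
  have "[:z, 1:] ^ Suc r dvd F2"
    using linear_power_dvd_cancel[of "-z" 0 "Suc r" "Suc r" F2] d(2) nz F2 by simp
  then obtain F3 where F3: "F2 = [:z, 1:] ^ Suc r * F3" by (elim dvdE)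
  have "[:-y, 1:] ^ Suc r dvd [:z, 1:] ^ Suc r * F3"
    using linear_power_dvd_cancel[of y 0 "Suc r" "Suc r" F2] d(3) nz F2 F3 by simp
  then have "[:-y, 1:] ^ Suc r dvd F3"
    using linear_power_dvd_cancel[of y "-z" "Suc r" "Suc r" F3] nz x by (simp add: eq_neg_iff_add_eq_0 neg_eq_iff_add_eq_0 del: power_Suc)
  then obtain H where "F3 = [:-y, 1:] ^ Suc r * H" by (elim dvdE)
  then have H: "F = L ^ Suc r * H"
    by (simp only: F2 F3 L_def power_mult_distrib mult.assoc)
  have L: "L = [:0, - (y * z), z - y, 1:]" by (simp add: L_def)
  then have L0: "L \<noteq> 0" by simp
  have dL: "pderiv L = [:- (y * z), 2 * (z - y), 3:]"
    by (simp add: L pderiv_pCons algebra_simps)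
  define n where "n = (of_nat (Suc r) :: 'a)"
  have n0: "n \<noteq> 0" by (simp add: n_def del: of_nat_Suc)
  have "L ^ r * (smult n (pderiv L * H) + L * pderiv H) = L ^ r * (smult b L + [:a:])"
    unfolding dF[symmetric] H pderiv_mult pderiv_power_Suc
    by (simp add: n_def algebra_simps del: of_nat_Suc)
  then have eq: "smult n (pderiv L * H) + L * pderiv H = smult b L + [:a:]"
    using L0 by simp
  \<comment> \<open>Otherwise the left side of \<open>eq\<close> has, in degree
    \<open>degree H + 2\<close>, the coefficient \<open>3 * n + degree H\<close> times the leading
    coefficient of \<open>H\<close>, while the right side has degree at most 3.\<close>
  have "degree H \<le> 1"
  proof (rule ccontr)
    assume h: "\<not> degree H \<le> 1"
    have nd: "degree (pderiv H) = degree H - 1" by (rule degree_pderiv)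
    have "coeff (pderiv L * H) (degree H + 2) = 3 * lead_coeff H"
      using coeff_mult_degree_sum[of "pderiv L" H] by (simp add: dL add.commute)
    moreover have "coeff (L * pderiv H) (degree H + 2) = of_nat (degree H) * lead_coeff H"
    proof -
      have "degree L + degree (pderiv H) = degree H + 2" using h nd by (simp add: L)
      then show ?thesis
        using coeff_mult_degree_sum[of L "pderiv H"] h by (simp add: nd coeff_pderiv L)
    qed
    moreover have "coeff (smult n (pderiv L * H) + L * pderiv H) (degree H + 2) = 0"
      unfolding eq
      using h by (intro coeff_eq_0) (auto simp: L intro!: le_less_trans[OF degree_add_le_max])
    ultimately have "(n * 3 + of_nat (degree H)) * lead_coeff H = 0"
      by (simp add: distrib_right mult.assoc del: add_2_eq_Suc')
    moreover have "n * 3 + of_nat (degree H) = of_nat (3 * Suc r + degree H)"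
      by (simp add: n_def)
    ultimately show False using h by (metis degree_0 leading_coeff_0_iff mult_eq_0_iff of_nat_eq_0_iff add_is_0 not_less_eq_eq zero_le le0)
  qed
  moreover obtain u H' where u: "H = pCons u H'" by (cases H)
  ultimately have "degree H' = 0" by (simp split: if_splits)
  then obtain v where "H' = [:v:]" by (rule degree_eq_zeroE)
  with u have Huv: "H = [:u, v:]" by simp
  have c: "coeff (smult n (pderiv L * H) + L * pderiv H) i = coeff (smult b L + [:a:]) i" for i
    using eq by simp
  note ev = Huv L dL pderiv_pCons numeral_eq_Suc algebra_simps
  \<comment> \<open>Coefficients are compared for \<open>H = u + v * t\<close>: the top one gives
    \<open>b\<close>, and inserting it into the next two leaves relations free of \<open>n\<close>.
    If \<open>v\<close> vanished, so would \<open>u\<close>, \<open>b\<close> and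
    \<open>a\<close>.\<close>
  have c3: "n * 3 * v + v = b" using c[of 3] by (simp add: ev)
  have c2: "n * (3 * u + 2 * (z - y) * v) + (z - y) * v = b * (z - y)"
    using c[of 2] by (simp add: ev)
  have c1: "n * (2 * (z - y) * u - y * z * v) - y * z * v = - b * (y * z)"
    using c[of 1] by (simp add: ev)
  have c0: "- n * (y * z) * u = a" using c[of 0] by (simp add: ev)
  have "n * (3 * u) = n * ((z - y) * v)" using c2 c3[symmetric] by (simp add: algebra_simps)
  then have u: "3 * u = (z - y) * v" using n0 by simp
  have "n * (2 * ((z - y) * u)) = n * (2 * (- (y * z * v)))" using c1 c3[symmetric] by (simp add: algebra_simps)
  then have "2 * ((z - y) * u) = 2 * (- (y * z * v))" by (simp only: mult_left_cancel[OF n0])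
  then have su: "(z - y) * u = - (y * z * v)" by (rule iffD1[OF mult_left_cancel, rotated]) simp
  have "v \<noteq> 0"
  proof
    assume v: "v = 0"
    then have "u = 0" using u by simp
    then show False using ab v c3 c0 by simp
  qed
  then show ?thesis
    using sum_squares_zero_criterion[OF x u su] by blast
qed

text \<open>16 is 2 times 8: each coefficient is at most \<open>2 ^ (3 * r)\<close>, and there are
  \<open>r + 1\<close>, at most \<open>2 ^ r\<close>, terms.\<close>

lemma pade_form_norm_le:
  fixes x y :: complex
  assumes "cmod x \<le> b" "cmod y \<le> b"
  shows "cmod (pade_form r x y) \<le> (16 * b) ^ r"
proof -
  have b0: "b \<ge> 0" using assms(1) norm_ge_zero[of x] by linarith
  have "cmod (pade_form r x y) \<le> (\<Sum>k\<le>r. (8 * b) ^ r)"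
    unfolding pade_form_def
  proof (rule sum_norm_le)
    fix k assume "k \<in> {..r}"
    then have k: "k \<le> r" by simp
    have "(r + k choose k) * (2 * r - k choose r) \<le> 2 ^ (r + k) * 2 ^ (2 * r - k)"
      by (intro mult_mono binomial_le_pow2) auto
    also have "\<dots> = 2 ^ (3 * r)" using k by (simp flip: power_add)
    also have "\<dots> = 8 ^ r" by (simp add: power_mult)
    finally have "real ((r + k choose k) * (2 * r - k choose r)) \<le> real (8 ^ r)"
      by (simp only: of_nat_le_iff)
    then have "real ((r + k choose k) * (2 * r - k choose r)) \<le> 8 ^ r"
      by (simp only: of_nat_power of_nat_numeral)
    moreover have "cmod x ^ k * cmod y ^ (r - k) \<le> b ^ r"
    proof -
      have "cmod x ^ k * cmod y ^ (r - k) \<le> b ^ k * b ^ (r - k)"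
        using assms b0 by (intro mult_mono power_mono) auto
      then show ?thesis using k by (simp flip: power_add)
    qed
    ultimately have "real ((r + k choose k) * (2 * r - k choose r)) * (cmod x ^ k * cmod y ^ (r - k)) \<le> 8 ^ r * b ^ r"
      by (rule mult_mono) simp_all
    then show "cmod (of_nat ((r + k choose k) * (2 * r - k choose r)) * x ^ k * (- y) ^ (r - k)) \<le> (8 * b) ^ r"
      by (simp only: norm_mult norm_power norm_of_nat norm_minus_cancel power_mult_distrib mult.assoc)
  qed
  also have "\<dots> = (real r + 1) * (8 * b) ^ r" by simp
  also have "\<dots> \<le> 2 ^ r * (8 * b) ^ r"
  proof (intro mult_right_mono)
    have "Suc r \<le> 2 ^ r" by (induction r) auto
    then have "real (Suc r) \<le> real (2 ^ r)" by (simp only: of_nat_le_iff)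
    then show "real r + 1 \<le> 2 ^ r" by (simp only: of_nat_power of_nat_numeral of_nat_Suc add.commute)
  qed (use b0 in simp)
  also have "\<dots> = (16 * b) ^ r" by (simp only: power_mult_distrib[symmetric]) simp
  finally show ?thesis .
qed

text \<open>A 2 by 2 minor of \<open>y\<close> against the Pade vector of \<open>x\<close>. When
  both vectors have coordinate sum 0, all cyclic choices of two coordinates give the same minor
  (\<open>minor_rotate\<close>).\<close>

definition minor :: "nat \<Rightarrow> 'a::comm_ring_1 \<Rightarrow> 'a \<Rightarrow> 'a \<Rightarrow> 'a \<Rightarrow> 'a \<Rightarrow> 'a" where
  "minor r x0 x1 x2 y0 y1 = y0 * pade_vec r x1 x2 x0 - y1 * pade_vec r x0 x1 x2"

text \<open>Each product in the minor contains a small factor: \<open>y0\<close> in the first, the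
  power \<open>2 * r + 1\<close> of \<open>x0\<close> in the second. The weaker of the two savings
  survives, whence the minimum; the absolute constants are collected in
  \<open>2 ^ (9 * r)\<close>.\<close>

lemma complex_minor_bound:
  fixes x0 x1 x2 y0 y1 y2 :: complex
  assumes x: "x0 + x1 + x2 = 0" "x0 \<noteq> 0" "cmod x0 \<le> cmod x1" "cmod x0 \<le> cmod x2"
    and y: "y0 + y1 + y2 = 0" "y0 \<noteq> 0" "cmod y0 \<le> cmod y1" "cmod y0 \<le> cmod y2"
    and r: "r \<ge> 1" and w: "minor r x0 x1 x2 y0 y1 \<noteq> 0"
  defines "p \<equiv> (ln (cmod x1) + ln (cmod x2)) / 2" and "q \<equiv> (ln (cmod y1) + ln (cmod y2)) / 2"
  shows "ln (cmod (minor r x0 x1 x2 y0 y1)) \<le> (3 * real r + 1) * p + q + real r * (9 * ln 2)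
    - min (q - ln (cmod y0)) ((2 * real r + 1) * (p - ln (cmod x0)))"
proof -
  have pos: "cmod x0 > 0" "cmod x1 > 0" "cmod x2 > 0" "cmod y0 > 0" "cmod y1 > 0" "cmod y2 > 0"
    using x y by auto
  \<comment> \<open>If \<open>a\<close> is not larger than \<open>c\<close>, then \<open>b\<close>
    is at most twice \<open>c\<close> and so exceeds the geometric mean of \<open>b\<close> and
    \<open>c\<close> by a bounded factor only.\<close>
  have le2: "cmod b \<le> 2 * exp ((ln (cmod b) + ln (cmod c)) / 2)"
    if "a + b + c = 0" "cmod a \<le> cmod c" "cmod b > 0" "cmod c > 0" for a b c :: complex
  proof -
    have "b = - (a + c)" using that(1) by (simp add: eq_neg_iff_add_eq_0 algebra_simps)
    then have "cmod b = cmod (a + c)" by (simp only: norm_minus_cancel)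
    then have "cmod b \<le> 2 * cmod c" using that(2) norm_triangle_ineq[of a c] by simp
    then have "ln (cmod b) \<le> ln (2 * cmod c)" using that by simp
    then have "ln (cmod b) \<le> ln 2 + ln (cmod c)" using that by (simp add: ln_mult)
    moreover have "ln 2 > (0::real)" by simp
    ultimately have "ln (cmod b) \<le> ln 2 + (ln (cmod b) + ln (cmod c)) / 2" by argo
    then have "exp (ln (cmod b)) \<le> exp (ln 2 + (ln (cmod b) + ln (cmod c)) / 2)" by simp
    then show ?thesis using that by (simp add: exp_add)
  qed
  \<comment> \<open>\<open>P\<close> and \<open>Q\<close> are the geometric means of the two larger
    coordinates, \<open>E\<close> is the common saving factor.\<close>
  define P where "P = exp p"
  define Q where "Q = exp q"
  define E where "E = exp (- min (q - ln (cmod y0)) ((2 * real r + 1) * (p - ln (cmod x0))))"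
  have P0: "P > 0" "Q > 0" "E > 0" by (simp_all add: P_def Q_def E_def)
  have x1: "cmod x1 \<le> 2 * P" using le2[of x0 x1 x2] x pos by (simp add: P_def p_def)
  have x2: "cmod x2 \<le> 2 * P" using le2[of x0 x2 x1] x pos by (simp add: P_def p_def add_ac)
  have y1: "cmod y1 \<le> 2 * Q" using le2[of y0 y1 y2] y pos by (simp add: Q_def q_def)
  have x0: "cmod x0 \<le> 2 * P" using x x1 by simp
  have y0: "cmod y0 \<le> Q * E"
  proof -
    have "exp (ln (cmod y0)) \<le> exp (q + - min (q - ln (cmod y0)) ((2 * real r + 1) * (p - ln (cmod x0))))"
      unfolding exp_le_cancel_iff by linarith
    then show ?thesis using pos by (simp only: exp_add Q_def E_def exp_ln)
  qed
  have x0r: "cmod x0 ^ (2 * r + 1) \<le> P ^ (2 * r + 1) * E"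
  proof -
    have "exp (real (2 * r + 1) * ln (cmod x0)) \<le> exp (real (2 * r + 1) * p + - min (q - ln (cmod y0)) ((2 * real r + 1) * (p - ln (cmod x0))))"
      unfolding exp_le_cancel_iff by (simp add: algebra_simps)
    then show ?thesis using pos by (simp only: exp_add P_def E_def exp_ln exp_of_nat_mult)
  qed
  have v0: "cmod (pade_vec r x0 x1 x2) \<le> P ^ (2 * r + 1) * E * (16 * (2 * P)) ^ r"
    unfolding pade_vec_def norm_mult norm_power
    using x0r pade_form_norm_le[OF x1 x2, of r] by (intro mult_mono) (use P0 in auto)
  have v1: "cmod (pade_vec r x1 x2 x0) \<le> (2 * P) ^ (2 * r + 1) * (16 * (2 * P)) ^ r"
    unfolding pade_vec_def norm_mult norm_power
    using x1 pade_form_norm_le[OF x2 x0, of r] P0 by (intro mult_mono power_mono) auto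
  have "cmod (minor r x0 x1 x2 y0 y1) \<le> cmod y0 * cmod (pade_vec r x1 x2 x0) + cmod y1 * cmod (pade_vec r x0 x1 x2)"
    unfolding minor_def by (metis norm_mult norm_triangle_ineq4)
  also have "\<dots> \<le> (Q * E) * ((2 * P) ^ (2 * r + 1) * (16 * (2 * P)) ^ r) + (2 * Q) * (P ^ (2 * r + 1) * E * (16 * (2 * P)) ^ r)"
    using y0 y1 v0 v1 P0 by (intro add_mono mult_mono) auto
  also have "\<dots> = Q * E * P ^ (3 * r + 1) * ((2 * 4 ^ r + 2) * 32 ^ r)"
  proof -
    define A where "A = P ^ (2 * r + 1)"
    define B where "B = P ^ r"
    have "P ^ (3 * r + 1) = A * B" by (simp add: A_def B_def flip: power_add)
    moreover have "(16 * (2 * P)) ^ r = 32 ^ r * B"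
      using power_mult_distrib[of 32 P r] by (simp add: B_def)
    moreover have "(2 * P) ^ (2 * r + 1) = 2 * 4 ^ r * A"
      by (simp add: power_mult_distrib power_mult A_def)
    ultimately show ?thesis
      unfolding A_def[symmetric] by (simp only:) (simp add: distrib_left distrib_right mult_ac)
  qed
  \<comment> \<open>The estimate \<open>2 * 4 ^ r + 2 \<le> 16 ^ r\<close> needs
    \<open>r \<ge> 1\<close>; the case \<open>r = 0\<close> is treated by
    \<open>complex_octant_minor_bound\<close>, without any constant.\<close>
  also have "\<dots> \<le> Q * E * P ^ (3 * r + 1) * (16 ^ r * 32 ^ r)"
  proof -
    have "(4::real) ^ r \<ge> 4" using power_increasing[of 1 r "4::real"] r by simp
    moreover have "(16::real) ^ r = 4 ^ r * 4 ^ r" using power_mult_distrib[of "4::real" 4 r] by simp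
    ultimately have "2 * 4 ^ r + 2 \<le> (16::real) ^ r"
      using mult_mono[of "4::real" "4 ^ r" "4 ^ r" "4 ^ r"] by linarith
    then show ?thesis using P0 by (intro mult_left_mono mult_right_mono) auto
  qed
  also have "16 ^ r * 32 ^ r = (2::real) ^ (9 * r)"
    using power_mult_distrib[of "16::real" 32 r] power_mult[of "2::real" 9 r] by simp
  finally have bd: "cmod (minor r x0 x1 x2 y0 y1) \<le> Q * E * P ^ (3 * r + 1) * 2 ^ (9 * r)" .
  have "ln (cmod (minor r x0 x1 x2 y0 y1)) \<le> ln (Q * E * P ^ (3 * r + 1) * 2 ^ (9 * r))"
    using bd w P0 by simp
  also have "\<dots> = q + - min (q - ln (cmod y0)) ((2 * real r + 1) * (p - ln (cmod x0))) + (3 * real r + 1) * p + 9 * real r * ln 2"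
    using P0 by (simp add: ln_mult ln_realpow P_def Q_def E_def del: power_Suc)
  finally show ?thesis by simp
qed

section \<open>Local estimates\<close>

text \<open>There is no triangle inequality here, so that the square of a complex absolute value,
  the normalised value at a complex place, qualifies.\<close>

definition mult_norm :: "('a::field \<Rightarrow> real) \<Rightarrow> bool" where
  "mult_norm N \<longleftrightarrow> (\<forall>x. 0 \<le> N x) \<and> (\<forall>x. N x = 0 \<longleftrightarrow> x = 0) \<and> (\<forall>x y. N (x * y) = N x * N y)"

definition ultrametric :: "('a::field \<Rightarrow> real) \<Rightarrow> bool" where
  "ultrametric N \<longleftrightarrow> (\<forall>x y. N (x + y) \<le> max (N x) (N y))"

context
  fixes N :: "'a::field \<Rightarrow> real"
  assumes N: "mult_norm N"
begin

lemma mult_norm_nonneg [simp]: "0 \<le> N x" and mult_norm_eq_0 [simp]: "N x = 0 \<longleftrightarrow> x = 0"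
  and mult_norm_mult: "N (x * y) = N x * N y"
  using N by (auto simp: mult_norm_def)

lemma mult_norm_0 [simp]: "N 0 = 0"
  by simp

lemma mult_norm_pos: "x \<noteq> 0 \<Longrightarrow> N x > 0"
  using mult_norm_nonneg[of x] mult_norm_eq_0[of x] by linarith

lemma mult_norm_1 [simp]: "N 1 = 1"
  using mult_norm_mult[of 1 1] mult_norm_pos[of 1] by simp

lemma mult_norm_power: "N (x ^ n) = N x ^ n"
  by (induction n) (auto simp: mult_norm_mult)

lemma mult_norm_minus [simp]: "N (- x) = N x"
proof -
  have "N (-1) ^ 2 = 1" using mult_norm_mult[of "-1" "-1"] by (simp add: power2_eq_square)
  then have "N (-1) = 1" using mult_norm_nonneg[of "-1"] by (simp add: power2_eq_1_iff)
  then show ?thesis using mult_norm_mult[of "-1" x] by simp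
qed

lemma mult_norm_inverse: "N (inverse x) = inverse (N x)"
proof (cases "x = 0")
  case False
  then have "N (inverse x) * N x = 1" using mult_norm_mult[of "inverse x" x] by simp
  then show ?thesis using False by (simp add: field_simps)
qed auto

lemma mult_norm_divide: "N (x / y) = N x / N y"
  by (simp add: divide_inverse mult_norm_mult mult_norm_inverse)

lemma mult_norm_prod: "N (\<Prod>i\<in>A. f i) = (\<Prod>i\<in>A. N (f i))"
  by (induction A rule: infinite_finite_induct) (auto simp: mult_norm_mult)

lemma mult_norm_power_int: "N (x powi k) = N x powi k"
  by (simp add: power_int_def mult_norm_power mult_norm_inverse)

context
  assumes U: "ultrametric N"
begin

lemma ultra_add: "N (x + y) \<le> max (N x) (N y)"
  using U by (simp add: ultrametric_def)

lemma ultra_diff: "N (x - y) \<le> max (N x) (N y)"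
  using ultra_add[of x "-y"] by simp

lemma ultra_sum_le:
  assumes "\<And>i. i \<in> A \<Longrightarrow> N (f i) \<le> b" "0 \<le> b"
  shows "N (\<Sum>i\<in>A. f i) \<le> b"
  using assms
proof (induction A rule: infinite_finite_induct)
  case (insert x F)
  then have "N (f x) \<le> b" "N (sum f F) \<le> b" by auto
  then show ?case using insert.hyps ultra_add[of "f x" "sum f F"] by simp
qed auto

lemma ultra_of_nat: "N (of_nat n) \<le> 1"
  using ultra_sum_le[of "{..<n}" "\<lambda>_. 1" 1] by simp

lemma ultra_of_int: "N (of_int n) \<le> 1"
  by (cases n rule: int_cases2) (use ultra_of_nat in auto)

lemma ultra_add_eq: "N x < N y \<Longrightarrow> N (x + y) = N y"
  using ultra_add[of x y] ultra_diff[of "x + y" x] by auto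

lemma ultra_pade_form_le:
  assumes "N x \<le> b" "N y \<le> b"
  shows "N (pade_form r x y) \<le> b ^ r"
proof -
  have b0: "b \<ge> 0" using assms(1) mult_norm_nonneg[of x] by linarith
  show ?thesis
    unfolding pade_form_def
  proof (rule ultra_sum_le)
    fix k assume "k \<in> {..r}"
    then have k: "k \<le> r" by simp
    have "N x ^ k * N y ^ (r - k) \<le> b ^ k * b ^ (r - k)"
      using assms b0 by (intro mult_mono power_mono) auto
    then have "N x ^ k * N y ^ (r - k) \<le> b ^ r" using k by (simp flip: power_add)
    then have "N (of_nat ((r + k choose k) * (2 * r - k choose r))) * (N x ^ k * N y ^ (r - k)) \<le> 1 * b ^ r"
      using b0 by (intro mult_mono ultra_of_nat) auto
    then show "N (of_nat ((r + k choose k) * (2 * r - k choose r)) * x ^ k * (- y) ^ (r - k)) \<le> b ^ r"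
      by (simp only: mult_norm_mult mult_norm_power mult_norm_minus mult.assoc mult_1)
  qed (use b0 in simp)
qed

text \<open>Unlike in \<open>complex_minor_bound\<close> there is no constant term: the two larger
  coordinates have equal norm, and integer coefficients have norm at most 1. At \<open>r = 0\<close>
  this is already the gap estimate.\<close>

lemma ultra_minor_bound:
  assumes x: "x0 + x1 + x2 = 0" "x0 \<noteq> 0" "N x0 \<le> N x1" "N x0 \<le> N x2"
    and y: "y0 + y1 + y2 = 0" "y0 \<noteq> 0" "N y0 \<le> N y1" "N y0 \<le> N y2"
    and w: "minor r x0 x1 x2 y0 y1 \<noteq> 0"
  defines "p \<equiv> (ln (N x1) + ln (N x2)) / 2" and "q \<equiv> (ln (N y1) + ln (N y2)) / 2"
  shows "ln (N (minor r x0 x1 x2 y0 y1)) \<le> (3 * real r + 1) * p + q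
    - min (q - ln (N y0)) ((2 * real r + 1) * (p - ln (N x0)))"
proof -
  have eq: "N b = N c" if "a + b + c = 0" "N a \<le> N b" "N a \<le> N c" for a b c
  proof -
    have b: "b = - (a + c)" "c = - (a + b)" using that(1)
      by (simp_all add: eq_neg_iff_add_eq_0 algebra_simps)
    have "N b \<le> max (N a) (N c)" using ultra_add[of a c] b(1) mult_norm_minus by metis
    moreover have "N c \<le> max (N a) (N b)" using ultra_add[of a b] b(2) mult_norm_minus by metis
    ultimately show ?thesis using that by linarith
  qed
  have x12: "N x1 = N x2" using eq x by blast
  have y12: "N y1 = N y2" using eq y by blast
  have pos: "N x0 > 0" "N x2 > 0" "N y0 > 0" "N y2 > 0"
    using x y mult_norm_pos[of x0] mult_norm_pos[of y0] by auto
  define P where "P = N x2"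
  define Q where "Q = N y2"
  have p: "p = ln P" "q = ln Q" by (simp_all add: p_def q_def P_def Q_def x12 y12)
  define E where "E = exp (- min (q - ln (N y0)) ((2 * real r + 1) * (p - ln (N x0))))"
  have P0: "P > 0" "Q > 0" "E > 0" using pos by (simp_all add: P_def Q_def E_def)
  have y0: "N y0 \<le> Q * E"
  proof -
    have "exp (ln (N y0)) \<le> exp (q + - min (q - ln (N y0)) ((2 * real r + 1) * (p - ln (N x0))))"
      unfolding exp_le_cancel_iff by linarith
    then show ?thesis using pos P0 by (simp only: exp_add E_def p exp_ln)
  qed
  have x0r: "N x0 ^ (2 * r + 1) \<le> P ^ (2 * r + 1) * E"
  proof -
    have "exp (real (2 * r + 1) * ln (N x0)) \<le> exp (real (2 * r + 1) * p + - min (q - ln (N y0)) ((2 * real r + 1) * (p - ln (N x0))))"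
      unfolding exp_le_cancel_iff by (simp add: algebra_simps)
    then show ?thesis using pos P0 by (simp only: exp_add p E_def exp_ln exp_of_nat_mult)
  qed
  have v0: "N (pade_vec r x0 x1 x2) \<le> P ^ (2 * r + 1) * E * P ^ r"
    unfolding pade_vec_def mult_norm_mult mult_norm_power
    using x0r ultra_pade_form_le[of x1 P x2 r] P0 by (intro mult_mono) (auto simp: P_def x12)
  have v1: "N (pade_vec r x1 x2 x0) \<le> P ^ (2 * r + 1) * P ^ r"
    unfolding pade_vec_def mult_norm_mult mult_norm_power
    using ultra_pade_form_le[of x2 P x0 r] P0 x by (intro mult_mono power_mono) (auto simp: P_def x12)
  have a: "N (y0 * pade_vec r x1 x2 x0) \<le> (Q * E) * (P ^ (2 * r + 1) * P ^ r)"
    unfolding mult_norm_mult using y0 v1 P0 by (intro mult_mono) auto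
  have b: "N (y1 * pade_vec r x0 x1 x2) \<le> Q * (P ^ (2 * r + 1) * E * P ^ r)"
    unfolding mult_norm_mult y12 Q_def[symmetric] using v0 P0 by (intro mult_mono) auto
  have "N (minor r x0 x1 x2 y0 y1) \<le> Q * E * P ^ (3 * r + 1)"
  proof -
    have e: "P ^ (3 * r + 1) = P ^ (2 * r + 1) * P ^ r" by (simp flip: power_add)
    have "Q * E * P ^ (3 * r + 1) = (Q * E) * (P ^ (2 * r + 1) * P ^ r)"
      by (simp only: e)
    with a have a': "N (y0 * pade_vec r x1 x2 x0) \<le> Q * E * P ^ (3 * r + 1)" by (simp only:)
    have "Q * E * P ^ (3 * r + 1) = Q * (P ^ (2 * r + 1) * E * P ^ r)"
      by (subst e) (simp only: mult_ac)
    with b have b': "N (y1 * pade_vec r x0 x1 x2) \<le> Q * E * P ^ (3 * r + 1)" by (simp only:)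
    show ?thesis
      unfolding minor_def by (rule order_trans[OF ultra_diff max.boundedI[OF a' b']])
  qed
  then have "ln (N (minor r x0 x1 x2 y0 y1)) \<le> ln (Q * E * P ^ (3 * r + 1))"
    using w P0 mult_norm_pos[of "minor r x0 x1 x2 y0 y1"] by simp
  also have "\<dots> = q + - min (q - ln (N y0)) ((2 * real r + 1) * (p - ln (N x0))) + (3 * real r + 1) * p"
    using P0 by (simp add: ln_mult ln_realpow p E_def del: power_Suc)
  finally show ?thesis by simp
qed

end
end

section \<open>Ordinary minors at archimedean places\<close>

lemma minor_0: "minor 0 x0 x1 x2 y0 y1 = y0 * x1 - y1 * x0"
  by (simp add: minor_def pade_vec_def pade_form_def)

text \<open>
  The affine coordinate on the line \<open>x0 + x1 + x2 = 0\<close> that vanishes where \<open>x0 = 0\<close> and changes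
  sign when \<open>x1\<close> and \<open>x2\<close> are exchanged.
\<close>

definition local_coord :: "complex \<Rightarrow> complex \<Rightarrow> complex \<Rightarrow> complex" where
  "local_coord x0 x1 x2 = 2 * x0 / (x1 - x2)"

lemma local_coord:
  fixes x0 x1 x2 :: complex
  assumes x: "x0 + x1 + x2 = 0" "x0 \<noteq> 0" "cmod x0 \<le> cmod x1" "cmod x0 \<le> cmod x2"
  defines "z \<equiv> local_coord x0 x1 x2" and "w \<equiv> (x1 - x2) / 2"
  shows "w \<noteq> 0" "x0 = z * w" "x1 = w * (1 - z / 2)" "x2 = - w * (1 + z / 2)" "cmod z ^ 2 \<le> 4 / 3"
proof -
  show w0: "w \<noteq> 0"
  proof
    assume "w = 0"
    then have "x0 = - 2 * x1" using x(1) by (simp add: w_def algebra_simps eq_neg_iff_add_eq_0)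
    then have "cmod x0 = 2 * cmod x1" by (simp add: norm_mult)
    then show False using x by auto
  qed
  have ne: "x1 - x2 \<noteq> 0" using w0 by (simp add: w_def)
  have "x0 * (x1 - x2) = z * w * (x1 - x2)" using ne by (simp add: z_def local_coord_def w_def)
  then show x0: "x0 = z * w" using ne by simp
  have s: "x2 = - x0 - x1" using x(1) by (simp add: algebra_simps eq_neg_iff_add_eq_0)
  have "2 * x1 = 2 * (w - x0 / 2)" by (simp add: w_def s algebra_simps)
  then have "x1 = w - x0 / 2" by (rule iffD1[OF mult_left_cancel, rotated]) simp
  then show x1: "x1 = w * (1 - z / 2)" by (simp add: x0 algebra_simps)
  have "2 * x2 = 2 * (- w - x0 / 2)" by (simp add: w_def s algebra_simps)
  then have "x2 = - w - x0 / 2" by (rule iffD1[OF mult_left_cancel, rotated]) simp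
  then show x2: "x2 = - w * (1 + z / 2)" by (simp add: x0 algebra_simps)
  have "cmod z * cmod w \<le> cmod w * cmod (1 - z / 2)" "cmod z * cmod w \<le> cmod w * cmod (1 + z / 2)"
    using x(3,4) x0 x1 x2 by (metis norm_mult norm_minus_cancel)+
  then have "cmod z \<le> cmod (1 - z / 2)" "cmod z \<le> cmod (1 + z / 2)" using w0 by auto
  then have "cmod z ^ 2 \<le> cmod (1 - z / 2) ^ 2" "cmod z ^ 2 \<le> cmod (1 + z / 2) ^ 2"
    by (auto intro: power_mono)
  \<comment> \<open>In the sum of the two squared inequalities the mixed terms cancel, leaving
    \<open>2 * cmod z ^ 2 \<le> 2 + cmod z ^ 2 / 2\<close>.\<close>
  then show "cmod z ^ 2 \<le> 4 / 3"
    unfolding cmod_power2 by (simp add: power2_eq_square algebra_simps)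
qed

definition octant :: "complex \<Rightarrow> bool \<times> bool \<times> bool" where
  "octant z = (Re z \<ge> 0, Im z \<ge> 0, \<bar>Re z\<bar> \<ge> \<bar>Im z\<bar>)"

text \<open>Two points of one octant enclose an angle of at most 45 degrees, and 2/3 is a rational
  lower bound for the cosine \<open>1 / sqrt 2\<close>.\<close>

lemma octant_inner:
  assumes "octant z = octant z'"
  shows "2 / 3 * (cmod z * cmod z') \<le> Re z * Re z' + Im z * Im z'"
proof -
  have key: "(a\<^sup>2 + b\<^sup>2) * (c\<^sup>2 + d\<^sup>2) \<le> 2 * (a * c + b * d)\<^sup>2"
    if "0 \<le> b" "b \<le> a" "0 \<le> d" "d \<le> c" for a b c d :: real
  proof -
    have "a * d \<le> a * c" "b * c \<le> a * c" using that by (auto intro: mult_mono)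
    moreover have "a * d \<ge> 0" "b * c \<ge> 0" "b * d \<ge> 0" using that by auto
    ultimately have "(a * c + b * d + (a * d - b * c)) * (a * c + b * d - (a * d - b * c)) \<ge> 0"
      by (intro mult_nonneg_nonneg) linarith+
    then show ?thesis by (simp add: power2_eq_square algebra_simps)
  qed
  define a where "a = \<bar>Re z\<bar>"
  define b where "b = \<bar>Im z\<bar>"
  define c where "c = \<bar>Re z'\<bar>"
  define d where "d = \<bar>Im z'\<bar>"
  have s: "Re z * Re z' + Im z * Im z' = a * c + b * d"
    using assms unfolding octant_def a_def b_def c_def d_def by (auto simp: abs_if)
  have n: "0 \<le> a" "0 \<le> b" "0 \<le> c" "0 \<le> d" by (auto simp: a_def b_def c_def d_def)
  have "(a\<^sup>2 + b\<^sup>2) * (c\<^sup>2 + d\<^sup>2) \<le> 2 * (a * c + b * d)\<^sup>2"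
  proof (cases "b \<le> a")
    case True
    then have "d \<le> c" using assms by (auto simp: octant_def a_def b_def c_def d_def)
    then show ?thesis using key True n by blast
  next
    case False
    then have "c \<le> d" using assms by (auto simp: octant_def a_def b_def c_def d_def)
    then show ?thesis using key[where a=b and b=a and c=d and d=c] False n by (simp add: add.commute)
  qed
  moreover have "(cmod z * cmod z')\<^sup>2 = (a\<^sup>2 + b\<^sup>2) * (c\<^sup>2 + d\<^sup>2)"
    by (simp add: power_mult_distrib cmod_power2 a_def b_def c_def d_def)
  moreover have "(2 / 3 * (cmod z * cmod z'))\<^sup>2 = 4 / 9 * (cmod z * cmod z')\<^sup>2"
    by (simp add: power2_eq_square)
  ultimately have "(2 / 3 * (cmod z * cmod z'))\<^sup>2 \<le> (a * c + b * d)\<^sup>2"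
    using zero_le_power2[of "a * c + b * d"] by linarith
  then show ?thesis unfolding s by (rule power2_le_imp_le) (use n in auto)
qed

lemma cmod_diff_power2: "cmod (z - z') ^ 2 = cmod z ^ 2 + cmod z' ^ 2 - 2 * (Re z * Re z' + Im z * Im z')"
  unfolding cmod_power2 by (simp add: power2_eq_square algebra_simps)

text \<open>The inner product of points in one octant pushes \<open>cmod (z - z') ^ 2\<close> below
  \<open>cmod z ^ 2\<close> by at least a third of \<open>cmod z * cmod z'\<close>. This absorbs the
  factor \<open>1 - z' ^ 2 / 4\<close>, which is the product of the two larger coordinates in local
  terms.\<close>

lemma octant_bound:
  assumes oct: "octant z = octant z'" and le: "cmod z' \<le> cmod z" and b: "cmod z ^ 2 \<le> 4 / 3" and z: "z \<noteq> 0"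
  shows "cmod (z - z') ^ 2 \<le> cmod z ^ 2 * cmod (1 - z' ^ 2 / 4)"
proof -
  have "cmod (z - z') ^ 2 \<le> cmod z ^ 2 + cmod z' ^ 2 - 4 / 3 * (cmod z * cmod z')"
    unfolding cmod_diff_power2 using octant_inner[OF oct] by simp
  also have "\<dots> \<le> cmod z ^ 2 - 1 / 3 * (cmod z * cmod z')"
    using mult_right_mono[OF le, of "cmod z'"] by (simp add: power2_eq_square)
  also have "\<dots> \<le> cmod z ^ 2 * (1 - cmod z' ^ 2 / 4)"
  proof -
    have "cmod z ^ 2 * cmod z' ^ 2 = (cmod z * cmod z') * (cmod z * cmod z')"
      by (simp add: power2_eq_square)
    also have "\<dots> \<le> (cmod z * cmod z') * (cmod z ^ 2)"
      unfolding power2_eq_square using le by (intro mult_left_mono) auto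
    also have "\<dots> \<le> (cmod z * cmod z') * (4 / 3)"
      using b by (intro mult_left_mono) auto
    finally show ?thesis by (simp add: algebra_simps)
  qed
  also have "\<dots> \<le> cmod z ^ 2 * cmod (1 - z' ^ 2 / 4)"
    using norm_triangle_ineq2[of 1 "z' ^ 2 / 4"] by (intro mult_left_mono) (auto simp: norm_divide norm_power)
  finally show ?thesis .
qed

text \<open>Sharing an octant removes the constant that the triangle inequality would cost. Hence
  the gap principle \<open>global_gap_bound\<close> has no term proportional to
  \<open>m\<close>.\<close>

lemma complex_octant_minor_bound:
  fixes x0 x1 x2 y0 y1 y2 :: complex
  assumes x: "x0 + x1 + x2 = 0" "x0 \<noteq> 0" "cmod x0 \<le> cmod x1" "cmod x0 \<le> cmod x2"
    and y: "y0 + y1 + y2 = 0" "y0 \<noteq> 0" "cmod y0 \<le> cmod y1" "cmod y0 \<le> cmod y2"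
    and w: "y0 * x1 - y1 * x0 \<noteq> 0"
    and oct: "octant (local_coord x0 x1 x2) = octant (local_coord y0 y1 y2)"
  defines "p \<equiv> (ln (cmod x1) + ln (cmod x2)) / 2" and "q \<equiv> (ln (cmod y1) + ln (cmod y2)) / 2"
  shows "ln (cmod (y0 * x1 - y1 * x0)) \<le> p + q - min (q - ln (cmod y0)) (p - ln (cmod x0))"
proof -
  \<comment> \<open>Here \<open>u\<close> is the point with the larger local coordinate; the minimum
    in the statement covers both assignments.\<close>
  have main: "ln (cmod (v0 * u1 - v1 * u0)) \<le> ln (cmod u0) + (ln (cmod v1) + ln (cmod v2)) / 2"
    if u: "u0 + u1 + u2 = 0" "u0 \<noteq> 0" "cmod u0 \<le> cmod u1" "cmod u0 \<le> cmod u2"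
      and v: "v0 + v1 + v2 = 0" "v0 \<noteq> 0" "cmod v0 \<le> cmod v1" "cmod v0 \<le> cmod v2"
      and w: "v0 * u1 - v1 * u0 \<noteq> 0"
      and oct: "octant (local_coord u0 u1 u2) = octant (local_coord v0 v1 v2)"
      and le: "cmod (local_coord v0 v1 v2) \<le> cmod (local_coord u0 u1 u2)"
    for u0 u1 u2 v0 v1 v2
  proof -
    define z where "z = local_coord u0 u1 u2"
    define z' where "z' = local_coord v0 v1 v2"
    define a where "a = (u1 - u2) / 2"
    define b where "b = (v1 - v2) / 2"
    note U = local_coord[OF u, folded z_def a_def]
    note V = local_coord[OF v, folded z'_def b_def]
    have z0: "z \<noteq> 0" using U u by auto
    have "v0 * u1 - v1 * u0 = - (a * b * (z - z'))"
      unfolding U(2,3) V(2,3) by (simp add: algebra_simps)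
    then have "cmod (v0 * u1 - v1 * u0) ^ 2 = cmod a ^ 2 * cmod b ^ 2 * cmod (z - z') ^ 2"
      by (simp add: norm_mult power_mult_distrib)
    also have "\<dots> \<le> cmod a ^ 2 * cmod b ^ 2 * (cmod z ^ 2 * cmod (1 - z' ^ 2 / 4))"
      using octant_bound[of z z'] oct le U(5) z0 by (intro mult_left_mono) (auto simp: z_def z'_def)
    also have "\<dots> = cmod u0 ^ 2 * (cmod v1 * cmod v2)"
    proof -
      have "v1 * v2 = - (b ^ 2 * (1 - z' ^ 2 / 4))"
        unfolding V(3,4) by (simp add: algebra_simps power2_eq_square)
      then have "cmod v1 * cmod v2 = cmod b ^ 2 * cmod (1 - z' ^ 2 / 4)"
        by (metis norm_minus_cancel norm_mult norm_power)
      then show ?thesis unfolding U(2) by (simp add: norm_mult power_mult_distrib)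
    qed
    finally have le: "cmod (v0 * u1 - v1 * u0) ^ 2 \<le> cmod u0 ^ 2 * (cmod v1 * cmod v2)" .
    have nz: "v1 \<noteq> 0" "v2 \<noteq> 0" using v by auto
    have "ln (cmod (v0 * u1 - v1 * u0) ^ 2) \<le> ln (cmod u0 ^ 2 * (cmod v1 * cmod v2))"
      using le w u nz by (intro ln_mono) auto
    then have "2 * ln (cmod (v0 * u1 - v1 * u0)) \<le> 2 * ln (cmod u0) + (ln (cmod v1) + ln (cmod v2))"
      using w u nz by (simp add: ln_realpow ln_mult)
    moreover have "2 * a \<le> 2 * b + c \<Longrightarrow> a \<le> b + c / 2" for a b c :: real by linarith
    ultimately show ?thesis by blast
  qed
  show ?thesis
  proof (cases "cmod (local_coord y0 y1 y2) \<le> cmod (local_coord x0 x1 x2)")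
    case True
    then show ?thesis using main[OF x y w oct] by (simp add: p_def q_def)
  next
    case False
    have w': "x0 * y1 - x1 * y0 \<noteq> 0" using w by (simp add: mult.commute)
    have "cmod (x0 * y1 - x1 * y0) = cmod (y0 * x1 - y1 * x0)"
      by (metis mult.commute norm_minus_commute)
    then show ?thesis using main[OF y x w' oct[symmetric]] False by (simp add: p_def q_def)
  qed
qed

definition grid_cell :: "complex \<Rightarrow> int \<times> int" where
  "grid_cell z = (\<lfloor>5 * Re z\<rfloor>, \<lfloor>5 * Im z\<rfloor>)"

text \<open>Cells have side 1/5, so \<open>cmod (z - z') ^ 2 \<le> 2 / 25\<close>, while
  \<open>cmod z ^ 2 \<le> 4 / 3\<close> bounds each factor \<open>1 - z ^ 2 / 4\<close> from below
  by 2/3. As \<open>4 * 2 / 25 < 4 / 9\<close>, the minor is at most half of the product of the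
  geometric means.\<close>

lemma complex_grid_minor_bound:
  fixes x0 x1 x2 y0 y1 y2 :: complex
  assumes x: "x0 + x1 + x2 = 0" "x0 \<noteq> 0" "cmod x0 \<le> cmod x1" "cmod x0 \<le> cmod x2"
    and y: "y0 + y1 + y2 = 0" "y0 \<noteq> 0" "cmod y0 \<le> cmod y1" "cmod y0 \<le> cmod y2"
    and w: "y0 * x1 - y1 * x0 \<noteq> 0"
    and cell: "grid_cell (local_coord x0 x1 x2) = grid_cell (local_coord y0 y1 y2)"
  defines "p \<equiv> (ln (cmod x1) + ln (cmod x2)) / 2" and "q \<equiv> (ln (cmod y1) + ln (cmod y2)) / 2"
  shows "ln (cmod (y0 * x1 - y1 * x0)) \<le> p + q - ln 2"
proof -
  define z where "z = local_coord x0 x1 x2"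
  define z' where "z' = local_coord y0 y1 y2"
  define a where "a = (x1 - x2) / 2"
  define b where "b = (y1 - y2) / 2"
  note U = local_coord[OF x, folded z_def a_def]
  note V = local_coord[OF y, folded z'_def b_def]
  have ge: "cmod (1 - u ^ 2 / 4) \<ge> 2 / 3" if "cmod u ^ 2 \<le> 4 / 3" for u
    using norm_triangle_ineq2[of 1 "u ^ 2 / 4"] that by (simp add: norm_divide norm_power)
  have "\<bar>5 * Re z - 5 * Re z'\<bar> \<le> 1" "\<bar>5 * Im z - 5 * Im z'\<bar> \<le> 1"
    using cell unfolding z_def z'_def grid_cell_def by (simp_all add: floor_eq_iff) linarith+
  then have "\<bar>Re z - Re z'\<bar> \<le> \<bar>1 / 5\<bar>" "\<bar>Im z - Im z'\<bar> \<le> \<bar>1 / 5\<bar>"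
    by linarith+
  then have "(Re z - Re z') ^ 2 \<le> (1 / 5) ^ 2" "(Im z - Im z') ^ 2 \<le> (1 / 5) ^ 2"
    unfolding abs_le_square_iff by auto
  then have d: "cmod (z - z') ^ 2 \<le> 2 / 25" unfolding cmod_power2 by (simp add: power_divide)
  have "y0 * x1 - y1 * x0 = - (a * b * (z - z'))"
    unfolding U(2,3) V(2,3) by (simp add: algebra_simps)
  then have "4 * cmod (y0 * x1 - y1 * x0) ^ 2 = 4 * (cmod a ^ 2 * cmod b ^ 2 * cmod (z - z') ^ 2)"
    by (simp add: norm_mult power_mult_distrib)
  also have "\<dots> \<le> 4 * (cmod a ^ 2 * cmod b ^ 2 * (2 / 25))"
    using d by (intro mult_left_mono) auto
  also have "\<dots> \<le> cmod a ^ 2 * cmod b ^ 2 * (2 / 3 * (2 / 3))"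
    by simp
  also have "\<dots> \<le> cmod a ^ 2 * cmod b ^ 2 * (cmod (1 - z ^ 2 / 4) * cmod (1 - z' ^ 2 / 4))"
    using ge[OF U(5)] ge[OF V(5)] by (intro mult_left_mono mult_mono) auto
  also have "\<dots> = (cmod x1 * cmod x2) * (cmod y1 * cmod y2)"
  proof -
    have "x1 * x2 = - (a ^ 2 * (1 - z ^ 2 / 4))" "y1 * y2 = - (b ^ 2 * (1 - z' ^ 2 / 4))"
      unfolding U(3,4) V(3,4) by (simp_all add: algebra_simps power2_eq_square)
    then have "cmod x1 * cmod x2 = cmod a ^ 2 * cmod (1 - z ^ 2 / 4)"
      "cmod y1 * cmod y2 = cmod b ^ 2 * cmod (1 - z' ^ 2 / 4)"
      by (metis norm_minus_cancel norm_mult norm_power)+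
    then show ?thesis by simp
  qed
  finally have le: "4 * cmod (y0 * x1 - y1 * x0) ^ 2 \<le> (cmod x1 * cmod x2) * (cmod y1 * cmod y2)" .
  have nz: "x1 \<noteq> 0" "x2 \<noteq> 0" "y1 \<noteq> 0" "y2 \<noteq> 0" using x y by auto
  have "ln ((2 * cmod (y0 * x1 - y1 * x0)) ^ 2) \<le> ln ((cmod x1 * cmod x2) * (cmod y1 * cmod y2))"
    using le w nz by (simp add: power_mult_distrib)
  then have "2 * (ln 2 + ln (cmod (y0 * x1 - y1 * x0))) \<le> (ln (cmod x1) + ln (cmod x2)) + (ln (cmod y1) + ln (cmod y2))"
  proof -
    have "ln ((2 * cmod (y0 * x1 - y1 * x0)) ^ 2) = real 2 * ln (2 * cmod (y0 * x1 - y1 * x0))"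
      by (rule ln_realpow)
    also have "\<dots> = 2 * (ln 2 + ln (cmod (y0 * x1 - y1 * x0)))"
      using w by (simp add: ln_mult)
    finally show ?thesis
      using \<open>ln _ \<le> ln _\<close> nz by (simp add: ln_mult)
  qed
  moreover have "2 * (l + a) \<le> (b + c) + (d + e) \<Longrightarrow> a \<le> (b + c) / 2 + (d + e) / 2 - l" for a b c d e l :: real
    by (simp add: field_simps)
  ultimately show ?thesis unfolding p_def q_def by blast
qed

text \<open>As \<open>4 / 3 < (6 / 5) ^ 2\<close>, cells of side 1/5 leave 12 on each axis.\<close>

lemma grid_cell_range:
  assumes "cmod z ^ 2 \<le> 4 / 3"
  shows "grid_cell z \<in> {-6..5} \<times> {-6..5}"
proof -
  have "cmod z ^ 2 \<le> (6 / 5) ^ 2" using assms by (simp add: power2_eq_square)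
  then have "cmod z \<le> 6 / 5" by (rule power2_le_imp_le) simp
  moreover have "cmod z < 6 / 5"
  proof (rule ccontr)
    assume "\<not> cmod z < 6 / 5"
    then have "cmod z ^ 2 \<ge> (6 / 5) ^ 2" by (intro power_mono) auto
    then show False using assms by (simp add: power2_eq_square)
  qed
  ultimately have "\<bar>Re z\<bar> < 6 / 5" "\<bar>Im z\<bar> < 6 / 5"
    using abs_Re_le_cmod[of z] abs_Im_le_cmod[of z] by linarith+
  then show ?thesis by (auto simp: grid_cell_def floor_le_iff le_floor_iff)
qed

section \<open>Counting lemmas\<close>

lemma exists_le_with_sum:
  fixes f :: "'a \<Rightarrow> nat"
  assumes "finite V" "M \<le> (\<Sum>v\<in>V. f v)"
  shows "\<exists>k. (\<forall>v\<in>V. k v \<le> f v) \<and> (\<Sum>v\<in>V. k v) = M"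
  using assms
proof (induction V arbitrary: M rule: finite_induct)
  case (insert x V)
  define a where "a = min M (f x)"
  have "M - a \<le> sum f V" using insert by (auto simp: a_def min_def)
  then obtain k where k: "\<forall>v\<in>V. k v \<le> f v" "sum k V = M - a" using insert by blast
  have "sum (k(x := a)) V = sum k V" using insert.hyps by (intro sum.cong) auto
  then have "sum (k(x := a)) (insert x V) = M" using insert.hyps k by (simp add: a_def)
  moreover have "\<forall>v\<in>insert x V. (k(x := a)) v \<le> f v" using k by (auto simp: a_def)
  ultimately show ?case by blast
qed simp

definition compositions :: "'a set \<Rightarrow> nat \<Rightarrow> ('a \<Rightarrow> nat) set" where
  "compositions V M = {k \<in> extensional V. (\<Sum>v\<in>V. k v) = M}"

lemma compositions_card:
  assumes "finite V" "card V = Suc n"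
  shows "finite (compositions V M)" "card (compositions V M) \<le> (M + n) choose n"
proof -
  obtain xs where xs: "set xs = V" "distinct xs" using finite_distinct_list[OF assms(1)] by blast
  define B where "B = {l :: nat list. length l = Suc n \<and> sum_list l = M}"
  have "B \<subseteq> {l. set l \<subseteq> {..M} \<and> length l = Suc n}"
    using member_le_sum_list by (fastforce simp: B_def)
  then have fB: "finite B" using finite_lists_length_eq[of "{..M}"] finite_subset by blast
  have inj: "inj_on (\<lambda>k. map k xs) (compositions V M)"
  proof (rule inj_onI)
    fix k l assume "k \<in> compositions V M" "l \<in> compositions V M" "map k xs = map l xs"
    then show "k = l" using xs by (intro extensionalityI[of k V l]) (auto simp: compositions_def)
  qed
  have im: "(\<lambda>k. map k xs) ` compositions V M \<subseteq> B"
    using xs assms distinct_card[of xs] by (auto simp: compositions_def B_def sum_list_distinct_conv_sum_set)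
  show "finite (compositions V M)" using finite_imageD[OF finite_subset[OF im fB] inj] .
  have "card (compositions V M) \<le> card B" using card_inj_on_le[OF inj im fB] .
  also have "\<dots> = (M + Suc n - 1) choose M" unfolding B_def by (rule card_length_sum_list)
  also have "\<dots> = (M + n) choose n" using binomial_symmetric[of M "M + n"] by simp
  finally show "card (compositions V M) \<le> (M + n) choose n" .
qed

text \<open>The weight \<open>(1 / 5) ^ n\<close> moves the peak of the expansion of
  \<open>(1 / 5 + 1) ^ N\<close> close to the term wanted, so a single term is a good bound. Its
  growth rate is 6^6 / 5^5, about 14.93; the slack up to 15 pays for the extra
  \<open>n div 50\<close>, through \<open>6 / 5 \<le> 1.0046 ^ 50\<close>.\<close>

lemma binomial_growth:
  "real ((5 * n + n div 50 + 1 + n) choose n) \<le> 6 / 5 * 15 ^ n"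
proof -
  define N where "N = 5 * n + n div 50 + 1 + n"
  have n: "n \<le> N" by (simp add: N_def)
  have "real (N choose n) * (1 / 5) ^ n \<le> (\<Sum>k\<le>N. real (N choose k) * (1 / 5) ^ k * 1 ^ (N - k))"
    using member_le_sum[of n "{..N}" "\<lambda>k. real (N choose k) * (1 / 5) ^ k * 1 ^ (N - k)"] n by simp
  also have "\<dots> = (6 / 5) ^ N" using binomial_ring[of "1 / 5 :: real" 1 N] by simp
  also have "\<dots> = (6 / 5) * ((6 / 5) ^ 6) ^ n * (6 / 5) ^ (n div 50)"
  proof -
    have N: "N = Suc (6 * n + n div 50)" by (simp add: N_def)
    show ?thesis unfolding N by (simp only: power_Suc power_add power_mult mult.assoc)
  qed
  also have "\<dots> \<le> (6 / 5) * ((6 / 5) ^ 6) ^ n * (10046 / 10000) ^ n"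
  proof (rule mult_left_mono)
    have "6 / 5 \<le> (10046 / 10000 :: real) ^ 50"
      using Bernoulli_inequality[of "46 / 10000 :: real" 50] by simp
    then have "(6 / 5 :: real) ^ (n div 50) \<le> ((10046 / 10000) ^ 50) ^ (n div 50)" by (intro power_mono) auto
    also have "\<dots> = (10046 / 10000) ^ (50 * (n div 50))" by (simp only: power_mult)
    also have "\<dots> \<le> (10046 / 10000) ^ n" by (intro power_increasing) auto
    finally show "(6 / 5 :: real) ^ (n div 50) \<le> (10046 / 10000) ^ n" .
  qed simp
  also have "\<dots> = 6 / 5 * ((6 / 5) ^ 6 * (10046 / 10000)) ^ n" by (simp only: power_mult_distrib mult.assoc)
  also have "\<dots> \<le> 6 / 5 * 3 ^ n"
    by (intro mult_left_mono power_mono) (simp_all add: power_divide)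
  finally have *: "real (N choose n) * (1 / 5) ^ n \<le> 6 / 5 * 3 ^ n" .
  have "real (N choose n) = real (N choose n) * (1 / 5) ^ n * 5 ^ n" by (simp add: power_divide)
  also have "\<dots> \<le> 6 / 5 * 3 ^ n * 5 ^ n" using * by (intro mult_right_mono) auto
  also have "\<dots> = 6 / 5 * 15 ^ n" using power_mult_distrib[of "3::real" 5 n] by simp
  finally show ?thesis by (simp only: N_def)
qed

text \<open>The shifted quantity \<open>g i + 2 * D\<close> is multiplied by at least 3/2 in each
  step.\<close>

lemma gap_sequence_growth:
  fixes g :: "nat \<Rightarrow> real"
  assumes step: "\<And>i. Suc i < l \<Longrightarrow> g (Suc i) \<ge> D + 3 / 2 * g i" and "i + j < l" "D \<ge> 0"
  shows "g (i + j) \<ge> (3 / 2) ^ j * g i + 2 * ((3 / 2) ^ j - 1) * D"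
  using assms(2)
proof (induction j)
  case (Suc j)
  have "D + 3 / 2 * ((3 / 2) ^ j * g i + 2 * ((3 / 2) ^ j - 1) * D) \<le> D + 3 / 2 * g (i + j)"
    using Suc by simp
  also have "\<dots> \<le> g (i + Suc j)" using step[of "i + j"] Suc.prems by simp
  finally show ?case by (simp add: algebra_simps)
qed simp

lemma sorted_enumeration:
  fixes g :: "'a \<Rightarrow> real"
  assumes "finite F"
  obtains xs where "set xs = F" "distinct xs" "length xs = card F"
    "\<And>i j. i < j \<Longrightarrow> j < card F \<Longrightarrow> g (xs ! i) \<le> g (xs ! j)"
proof -
  obtain ys where ys: "set ys = F" "distinct ys" using finite_distinct_list[OF assms] by blast
  define xs where "xs = sort_key g ys"
  have 1: "set xs = F" "distinct xs" using ys by (auto simp: xs_def)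
  have 2: "length xs = card F" using 1 distinct_card by metis
  have "sorted (map g xs)" by (simp add: xs_def)
  then have "g (xs ! i) \<le> g (xs ! j)" if "i < j" "j < card F" for i j
    using that 2 sorted_nth_mono[of "map g xs" i j] by simp
  with 1 2 that show thesis by blast
qed

lemma card_le_fibers:
  assumes "finite F" "f ` F \<subseteq> K" "finite K" "\<And>k. card {x \<in> F. f x = k} \<le> c"
  shows "card F \<le> c * card K"
proof -
  have "F = (\<Union>k\<in>K. {x \<in> F. f x = k})" using assms(2) by auto
  then have "card F \<le> (\<Sum>k\<in>K. card {x \<in> F. f x = k})"
    using card_UN_le[OF assms(3), of "\<lambda>k. {x \<in> F. f x = k}"] by simp
  also have "\<dots> \<le> (\<Sum>k\<in>K. c)" using assms(4) by (intro sum_mono) auto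
  finally show ?thesis by (simp add: mult.commute)
qed

text \<open>Third coordinates are minus the sums of the first two, for \<open>y\<close> as for the
  Pade vector by \<open>pade_vec_sum_zero\<close>. This lets the smallest coordinate be moved to the
  front at each place separately.\<close>

lemma minor_rotate:
  fixes x0 x1 x2 y0 y1 y2 :: "'a::field_char_0"
  assumes "x0 + x1 + x2 = 0" "y0 + y1 + y2 = 0"
  shows "minor r x1 x2 x0 y1 y2 = minor r x0 x1 x2 y0 y1"
proof -
  have y: "y2 = - y0 - y1" using assms(2) by (simp add: algebra_simps eq_neg_iff_add_eq_0)
  have v: "pade_vec r x2 x0 x1 = - pade_vec r x0 x1 x2 - pade_vec r x1 x2 x0"
    using pade_vec_sum_zero[OF assms(1), of r] by (simp add: algebra_simps eq_neg_iff_add_eq_0)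
  show ?thesis unfolding minor_def y v by (simp add: algebra_simps)
qed

text \<open>Two vanishing minors make both Pade vectors proportional to \<open>y\<close>, hence
  dependent, so \<open>pade_independent\<close> applies. Its quadratic relation divides the
  differences of cubes, and equality of cubes is a form that every absolute value can read.\<close>

lemma minor_consecutive_nonzero:
  fixes x0 x1 x2 y0 y1 :: "'a::field_char_0"
  assumes x: "x0 + x1 + x2 = 0" "x0 \<noteq> 0" "x1 \<noteq> 0" "x2 \<noteq> 0" and y: "y0 \<noteq> 0"
    and "minor r x0 x1 x2 y0 y1 = 0" "minor (Suc r) x0 x1 x2 y0 y1 = 0"
  shows "x0 ^ 3 = x1 ^ 3" "x1 ^ 3 = x2 ^ 3"
proof -
  define a where "a = pade_vec r x0 x1 x2 / y0"
  define b where "b = pade_vec (Suc r) x0 x1 x2 / y0"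
  have v0: "pade_vec r x0 x1 x2 = a * y0" "pade_vec (Suc r) x0 x1 x2 = b * y0"
    using y by (simp_all add: a_def b_def)
  have "y0 * pade_vec r x1 x2 x0 = y0 * (a * y1)" "y0 * pade_vec (Suc r) x1 x2 x0 = y0 * (b * y1)"
    using assms(6,7) unfolding minor_def v0 by (simp_all add: algebra_simps)
  then have v1: "pade_vec r x1 x2 x0 = a * y1" "pade_vec (Suc r) x1 x2 x0 = b * y1"
    using y by simp_all
  obtain \<alpha> \<beta> where ab: "(\<alpha>, \<beta>) \<noteq> (0, 0)" "\<alpha> * a + \<beta> * b = 0"
    by (cases "a = 0") (auto intro: that[of 1 0] that[of b "- a"])
  have "\<alpha> * (a * y) + \<beta> * (b * y) = (\<alpha> * a + \<beta> * b) * y" for y by (simp add: algebra_simps)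
  then have "x0\<^sup>2 + x1\<^sup>2 + x2\<^sup>2 = 0"
    using pade_independent[OF x ab(1), of r] ab(2) by (simp add: v0 v1)
  moreover have x2: "x2 = - x0 - x1" using x(1) by (simp add: algebra_simps eq_neg_iff_add_eq_0)
  ultimately have "2 * (x0\<^sup>2 + x0 * x1 + x1\<^sup>2) = 0"
    by (simp add: power2_eq_square algebra_simps)
  then have s: "x0\<^sup>2 + x0 * x1 + x1\<^sup>2 = 0" by (simp only: mult_eq_0_iff) simp
  have "x0 ^ 3 - x1 ^ 3 = (x0 - x1) * (x0\<^sup>2 + x0 * x1 + x1\<^sup>2)"
    by (simp add: power2_eq_square power3_eq_cube algebra_simps)
  then show "x0 ^ 3 = x1 ^ 3" using s by simp
  have "x1 ^ 3 - x2 ^ 3 = (x1 - x2) * (x0\<^sup>2 + x0 * x1 + x1\<^sup>2)"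
    unfolding x2 by (simp add: power2_eq_square power3_eq_cube algebra_simps)
  then show "x1 ^ 3 = x2 ^ 3" using s by simp
qed

section \<open>Points with prescribed local behaviour\<close>

text \<open>
  \<open>Ainf\<close> and \<open>Fin\<close> index the places in \<open>S\<close>, and \<open>T\<close> the places outside \<open>S\<close> where \<open>lam\<close> or \<open>mu\<close> may fail to
  be a unit; there all points have the same size. \<open>R\<close> consists of the elements integral at all
  remaining places, so that \<open>integral\<close> is the product formula as an inequality.
\<close>

locale unit_points =
  fixes Ainf Fin T :: "'i set" and nrm :: "'i \<Rightarrow> 'k::field_char_0 \<Rightarrow> real"
    and emb :: "'i \<Rightarrow> 'k \<Rightarrow> complex" and wt :: "'i \<Rightarrow> nat"
    and R :: "'k set" and Sol :: "(nat \<Rightarrow> 'k) set"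
  assumes finite_places: "finite Ainf" "finite Fin" "finite T"
    and disjoint_places: "Ainf \<inter> Fin = {}" "Ainf \<inter> T = {}" "Fin \<inter> T = {}"
    and Ainf_nonempty: "Ainf \<noteq> {}"
    and emb: "\<And>v x y. v \<in> Ainf \<Longrightarrow> emb v (x + y) = emb v x + emb v y"
      "\<And>v x y. v \<in> Ainf \<Longrightarrow> emb v (x * y) = emb v x * emb v y"
      "\<And>v. v \<in> Ainf \<Longrightarrow> emb v 1 = 1"
    and arch: "\<And>v x. v \<in> Ainf \<Longrightarrow> nrm v x = cmod (emb v x) ^ wt v"
      "\<And>v. v \<in> Ainf \<Longrightarrow> wt v \<ge> 1"
      "\<And>v x. v \<in> Ainf \<Longrightarrow> Im (emb v x) \<noteq> 0 \<Longrightarrow> wt v \<ge> 2"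
    and nonarch: "\<And>v. v \<in> Fin \<union> T \<Longrightarrow> mult_norm (nrm v)" "\<And>v. v \<in> Fin \<union> T \<Longrightarrow> ultrametric (nrm v)"
    and R: "1 \<in> R" "\<And>x y. x \<in> R \<Longrightarrow> y \<in> R \<Longrightarrow> x - y \<in> R" "\<And>x y. x \<in> R \<Longrightarrow> y \<in> R \<Longrightarrow> x * y \<in> R"
    and integral: "\<And>x. x \<in> R \<Longrightarrow> x \<noteq> 0 \<Longrightarrow> 0 \<le> (\<Sum>v\<in>Ainf \<union> Fin \<union> T. ln (nrm v x))"
    and Sol: "\<And>P. P \<in> Sol \<Longrightarrow> P 0 + P 1 + P 2 = 0"
      "\<And>P i. P \<in> Sol \<Longrightarrow> i < 3 \<Longrightarrow> P i \<noteq> 0" "\<And>P i. P \<in> Sol \<Longrightarrow> i < 3 \<Longrightarrow> P i \<in> R"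
      "\<And>P i. P \<in> Sol \<Longrightarrow> i < 3 \<Longrightarrow> (\<Sum>v\<in>Ainf \<union> Fin \<union> T. ln (nrm v (P i))) = 0"
      "\<And>P Q v i. P \<in> Sol \<Longrightarrow> Q \<in> Sol \<Longrightarrow> v \<in> T \<Longrightarrow> i < 3 \<Longrightarrow> nrm v (P i) = nrm v (Q i)"
      "\<And>P Q. P \<in> Sol \<Longrightarrow> Q \<in> Sol \<Longrightarrow> P \<noteq> Q \<Longrightarrow> Q 0 * P 1 - Q 1 * P 0 \<noteq> 0"
begin

definition V where "V = Ainf \<union> Fin"

definition m where "m = (\<Sum>v\<in>Ainf. wt v)"

lemma emb_props:
  assumes "v \<in> Ainf"
  shows "emb v 0 = 0" "emb v (- x) = - emb v x" "emb v (x - y) = emb v x - emb v y"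
    "emb v (x ^ n) = emb v x ^ n" "emb v (of_nat n) = of_nat n" "emb v (\<Sum>i\<in>A. f i) = (\<Sum>i\<in>A. emb v (f i))"
    "emb v x = 0 \<longleftrightarrow> x = 0"
proof -
  show z: "emb v 0 = 0" using emb(1)[OF assms, of 0 0] by simp
  show n: "emb v (- x) = - emb v x" for x
    using emb(1)[OF assms, of x "- x"] z by (simp add: eq_neg_iff_add_eq_0 add.commute)
  show "emb v (x - y) = emb v x - emb v y" using emb(1)[OF assms, of x "- y"] n[of y] by simp
  show "emb v (x ^ n) = emb v x ^ n" by (induction n) (auto simp: emb[OF assms])
  show "emb v (of_nat n) = of_nat n" by (induction n) (auto simp: emb[OF assms] z)
  show "emb v (\<Sum>i\<in>A. f i) = (\<Sum>i\<in>A. emb v (f i))"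
    by (induction A rule: infinite_finite_induct) (auto simp: emb[OF assms] z)
  show "emb v x = 0 \<longleftrightarrow> x = 0"
  proof
    assume "emb v x = 0"
    then show "x = 0" using emb(2)[OF assms, of x "inverse x"] emb(3)[OF assms] by (cases "x = 0") auto
  qed (simp add: z)
qed

lemma emb_minor:
  assumes "v \<in> Ainf"
  shows "emb v (minor r x0 x1 x2 y0 y1) = minor r (emb v x0) (emb v x1) (emb v x2) (emb v y0) (emb v y1)"
  unfolding minor_def pade_vec_def pade_form_def
  by (simp only: emb_props[OF assms] emb[OF assms])

lemma nrm_mult_norm: "v \<in> Ainf \<union> Fin \<union> T \<Longrightarrow> mult_norm (nrm v)"
proof (cases "v \<in> Ainf")
  case True
  then have "wt v \<noteq> 0" using arch(2)[of v] by simp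
  then show ?thesis
    using True by (simp add: mult_norm_def arch(1) emb emb_props norm_mult power_mult_distrib)
qed (use nonarch in auto)

lemma R_closed:
  shows "0 \<in> R" "x \<in> R \<Longrightarrow> - x \<in> R" "x \<in> R \<Longrightarrow> y \<in> R \<Longrightarrow> x + y \<in> R" "of_nat n \<in> R"
    "x \<in> R \<Longrightarrow> x ^ n \<in> R" "(\<And>i. i \<in> A \<Longrightarrow> f i \<in> R) \<Longrightarrow> (\<Sum>i\<in>A. f i) \<in> R"
proof -
  show z: "0 \<in> R" using R(1) R(2)[of 1 1] by simp
  show n: "- x \<in> R" if "x \<in> R" for x using R(2)[OF z that] by simp
  show a: "x + y \<in> R" if "x \<in> R" "y \<in> R" for x y using R(2)[OF that(1) n[OF that(2)]] by simp
  show "of_nat n \<in> R" by (induction n) (auto simp: z R(1) a)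
  show "x ^ n \<in> R" if "x \<in> R" by (induction n) (auto simp: R(1,3) that)
  show "(\<Sum>i\<in>A. f i) \<in> R" if "\<And>i. i \<in> A \<Longrightarrow> f i \<in> R"
    using that by (induction A rule: infinite_finite_induct) (auto simp: z a)
qed

lemma minor_in_R:
  assumes "x0 \<in> R" "x1 \<in> R" "x2 \<in> R" "y0 \<in> R" "y1 \<in> R"
  shows "minor r x0 x1 x2 y0 y1 \<in> R"
  unfolding minor_def pade_vec_def pade_form_def
  by (intro R R_closed assms)

section \<open>Points seen from a single place\<close>

definition min_ix where
  "min_ix v P = (if nrm v (P 0) \<le> nrm v (P 1) \<and> nrm v (P 0) \<le> nrm v (P 2) then 0
     else if nrm v (P 1) \<le> nrm v (P 2) then 1 else 2 :: nat)"

definition ax where "ax v P = P (min_ix v P)"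
definition bx where "bx v P = P ((min_ix v P + 1) mod 3)"
definition cx where "cx v P = P ((min_ix v P + 2) mod 3)"

lemma min_ix_less: "min_ix v P < 3"
  by (simp add: min_ix_def)

lemma min_ix_cases: "min_ix v P = 0 \<or> min_ix v P = 1 \<or> min_ix v P = 2"
  by (simp add: min_ix_def)

lemma abc_cases:
  obtains "min_ix v P = 0" "ax v P = P 0" "bx v P = P 1" "cx v P = P 2"
  | "min_ix v P = 1" "ax v P = P 1" "bx v P = P 2" "cx v P = P 0"
  | "min_ix v P = 2" "ax v P = P 2" "bx v P = P 0" "cx v P = P 1"
proof -
  have m: "(0 + 1) mod 3 = (1::nat)" "(0 + 2) mod 3 = (2::nat)" "(1 + 1) mod 3 = (2::nat)" "(1 + 2) mod 3 = (0::nat)"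
    "(2 + 1) mod 3 = (0::nat)" "(2 + 2) mod 3 = (1::nat)" by simp_all
  from min_ix_cases[of v P] that show thesis
    unfolding ax_def bx_def cx_def by (elim disjE) (simp_all only: m)
qed

lemma min_ix_le: "nrm v (ax v P) \<le> nrm v (bx v P)" "nrm v (ax v P) \<le> nrm v (cx v P)"
proof -
  have min3: "(if a \<le> b \<and> a \<le> c then a else if b \<le> c then b else c) \<le> a \<and>
      (if a \<le> b \<and> a \<le> c then a else if b \<le> c then b else c) \<le> b \<and>
      (if a \<le> b \<and> a \<le> c then a else if b \<le> c then b else c) \<le> c" for a b c :: real
    by auto
  have *: "nrm v (ax v P) \<le> nrm v (P 0) \<and> nrm v (ax v P) \<le> nrm v (P 1) \<and> nrm v (ax v P) \<le> nrm v (P 2)"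
    unfolding ax_def min_ix_def by (simp only: if_distrib[of P] if_distrib[of "nrm v"] min3)
  then show "nrm v (ax v P) \<le> nrm v (bx v P)" "nrm v (ax v P) \<le> nrm v (cx v P)"
    by (cases rule: abc_cases[of v P]; simp only:)+
qed

lemma abc_Sol:
  assumes "P \<in> Sol"
  shows "ax v P + bx v P + cx v P = 0" "ax v P \<noteq> 0" "bx v P \<noteq> 0" "cx v P \<noteq> 0"
proof -
  show "ax v P + bx v P + cx v P = 0"
    using Sol(1)[OF assms] by (cases rule: abc_cases[of v P]) (simp_all add: add_ac)
qed (use Sol(2)[OF assms] in \<open>auto simp: ax_def bx_def cx_def min_ix_less\<close>)

definition W where "W r P Q = minor r (P 0) (P 1) (P 2) (Q 0) (Q 1)"

text \<open>\<open>W\<close> is one global element, as the product formula requires, yet at each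
  place it can be read with the coordinate that is smallest there in front.\<close>

lemma W_eq:
  assumes "P \<in> Sol" "Q \<in> Sol" "min_ix v P = min_ix v Q"
  shows "W r P Q = minor r (ax v P) (bx v P) (cx v P) (ax v Q) (bx v Q)"
proof -
  have p: "P 0 + P 1 + P 2 = 0" "Q 0 + Q 1 + Q 2 = 0" using Sol(1) assms by auto
  have p': "P 1 + P 2 + P 0 = 0" "Q 1 + Q 2 + Q 0 = 0" using p by (simp_all add: add_ac)
  have 1: "W r P Q = minor r (P 1) (P 2) (P 0) (Q 1) (Q 2)"
    unfolding W_def by (rule minor_rotate[symmetric, OF p])
  have 2: "W r P Q = minor r (P 2) (P 0) (P 1) (Q 2) (Q 0)"
    unfolding 1 by (rule minor_rotate[symmetric, OF p'])
  have ab: "ax v Q = Q (min_ix v P)" "bx v Q = Q ((min_ix v P + 1) mod 3)"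
    by (simp_all only: ax_def bx_def assms(3))
  have m: "(0 + 1) mod 3 = (1::nat)" "(1 + 1) mod 3 = (2::nat)" "(2 + 1) mod 3 = (0::nat)" by simp_all
  show ?thesis
  proof (cases rule: abc_cases[of v P])
    case 1
    then show ?thesis unfolding ab by (simp only: W_def m)
  next
    case a: 2
    show ?thesis unfolding 1 ab a m ..
  next
    case b: 3
    show ?thesis unfolding 2 ab b m ..
  qed
qed

text \<open>The geometric mean of the two larger coordinates, rather than the maximum, makes
  \<open>dd v P\<close> exactly \<open>3 * pp v P\<close> minus the logarithms of all three
  coordinates; \<open>height_eq\<close> rests on this.\<close>

definition pp where "pp v P = (ln (nrm v (bx v P)) + ln (nrm v (cx v P))) / 2"
definition dd where "dd v P = pp v P - ln (nrm v (ax v P))"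

lemma nrm_pos:
  assumes "v \<in> Ainf \<union> Fin \<union> T" "x \<noteq> 0"
  shows "nrm v x > 0"
  using mult_norm_pos[OF nrm_mult_norm[OF assms(1)] assms(2)] .

lemma dd_nonneg:
  assumes "v \<in> Ainf \<union> Fin \<union> T" "P \<in> Sol"
  shows "dd v P \<ge> 0"
proof -
  have "ln (nrm v (ax v P)) \<le> ln (nrm v (bx v P))" "ln (nrm v (ax v P)) \<le> ln (nrm v (cx v P))"
    using nrm_pos[OF assms(1)] abc_Sol[OF assms(2)] min_ix_le by (auto intro!: ln_mono)
  then show ?thesis by (simp add: dd_def pp_def)
qed

lemma emb_le:
  assumes "v \<in> Ainf" "nrm v x \<le> nrm v y"
  shows "cmod (emb v x) \<le> cmod (emb v y)"
proof (rule ccontr)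
  assume "\<not> ?thesis"
  then have "cmod (emb v y) ^ wt v < cmod (emb v x) ^ wt v"
    using arch(2)[OF assms(1)] by (intro power_strict_mono) auto
  then show False using assms by (simp add: arch(1))
qed

lemma arch_Sol:
  assumes "v \<in> Ainf" "P \<in> Sol"
  shows "emb v (ax v P) + emb v (bx v P) + emb v (cx v P) = 0" "emb v (ax v P) \<noteq> 0"
    "cmod (emb v (ax v P)) \<le> cmod (emb v (bx v P))" "cmod (emb v (ax v P)) \<le> cmod (emb v (cx v P))"
  using abc_Sol[OF assms(2), of v] emb_le[OF assms(1)] min_ix_le[of v P] assms(1)
  by (auto simp: emb_props(7) simp flip: emb(1))

lemma ln_nrm_arch:
  assumes "v \<in> Ainf"
  shows "ln (nrm v x) = real (wt v) * ln (cmod (emb v x))"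
  by (simp add: arch(1)[OF assms] ln_realpow)

definition wt' where "wt' v = (if v \<in> Ainf then real (wt v) else 0)"

lemma local_pade_bound:
  assumes v: "v \<in> Ainf \<union> Fin \<union> T" and PQ: "P \<in> Sol" "Q \<in> Sol" and ix: "min_ix v P = min_ix v Q"
    and r: "r \<ge> 1" and w: "W r P Q \<noteq> 0"
  shows "ln (nrm v (W r P Q)) \<le> (3 * real r + 1) * pp v P + pp v Q + wt' v * (real r * (9 * ln 2))
    - min (dd v Q) ((2 * real r + 1) * dd v P)"
proof (cases "v \<in> Ainf")
  case True
  define p where "p = (ln (cmod (emb v (bx v P))) + ln (cmod (emb v (cx v P)))) / 2"
  define q where "q = (ln (cmod (emb v (bx v Q))) + ln (cmod (emb v (cx v Q)))) / 2"
  define k where "k = real (wt v)"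
  define da where "da = p - ln (cmod (emb v (ax v P)))"
  define db where "db = q - ln (cmod (emb v (ax v Q)))"
  have k: "k > 0" using arch(2)[OF True] by (simp add: k_def)
  have nz: "minor r (emb v (ax v P)) (emb v (bx v P)) (emb v (cx v P)) (emb v (ax v Q)) (emb v (bx v Q)) \<noteq> 0"
    using w unfolding W_eq[OF PQ ix] emb_minor[OF True, symmetric] emb_props(7)[OF True] .
  have "ln (cmod (emb v (W r P Q))) \<le> (3 * real r + 1) * p + q + real r * (9 * ln 2)
    - min db ((2 * real r + 1) * da)"
    unfolding W_eq[OF PQ ix] emb_minor[OF True] p_def q_def da_def db_def
    by (rule complex_minor_bound[OF arch_Sol[OF True PQ(1)] arch_Sol[OF True PQ(2)] r nz])
  then have "k * ln (cmod (emb v (W r P Q))) \<le> k * ((3 * real r + 1) * p + q + real r * (9 * ln 2)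
    - min db ((2 * real r + 1) * da))" using k by (intro mult_left_mono) auto
  also have "\<dots> = (3 * real r + 1) * (k * p) + k * q + k * (real r * (9 * ln 2))
    - min (k * db) ((2 * real r + 1) * (k * da))"
  proof -
    have "k * min db ((2 * real r + 1) * da) = min (k * db) (k * ((2 * real r + 1) * da))"
      using k by (simp add: min_mult_distrib_left)
    then show ?thesis by (simp add: algebra_simps)
  qed
  finally show ?thesis
    using True by (simp add: ln_nrm_arch wt'_def pp_def dd_def p_def q_def k_def da_def db_def
        right_diff_distrib distrib_left)
next
  case False
  then have F: "v \<in> Fin \<union> T" using v by auto
  show ?thesis
    using ultra_minor_bound[OF nonarch[OF F] abc_Sol(1,2)[OF PQ(1), of v] min_ix_le[of v P]
      abc_Sol(1,2)[OF PQ(2), of v] min_ix_le[of v Q], of r] w False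
    unfolding W_eq[OF PQ ix] by (simp add: wt'_def pp_def dd_def)
qed

definition oct where "oct v P = octant (local_coord (emb v (ax v P)) (emb v (bx v P)) (emb v (cx v P)))"
definition grid where "grid v P = grid_cell (local_coord (emb v (ax v P)) (emb v (bx v P)) (emb v (cx v P)))"

lemma W0: "W 0 P Q = Q 0 * P 1 - Q 1 * P 0"
  by (simp add: W_def minor_0)

lemma local_gap_bound:
  assumes v: "v \<in> Ainf \<union> Fin \<union> T" and PQ: "P \<in> Sol" "Q \<in> Sol" "P \<noteq> Q" and ix: "min_ix v P = min_ix v Q"
    and oct: "v \<in> Ainf \<Longrightarrow> oct v P = oct v Q"
  shows "ln (nrm v (W 0 P Q)) \<le> pp v P + pp v Q - min (dd v Q) (dd v P)"
proof (cases "v \<in> Ainf")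
  case True
  define p where "p = (ln (cmod (emb v (bx v P))) + ln (cmod (emb v (cx v P)))) / 2"
  define q where "q = (ln (cmod (emb v (bx v Q))) + ln (cmod (emb v (cx v Q)))) / 2"
  define k where "k = real (wt v)"
  define da where "da = p - ln (cmod (emb v (ax v P)))"
  define db where "db = q - ln (cmod (emb v (ax v Q)))"
  have k: "k > 0" using arch(2)[OF True] by (simp add: k_def)
  have e: "emb v (W 0 P Q) = emb v (ax v Q) * emb v (bx v P) - emb v (bx v Q) * emb v (ax v P)"
    unfolding W_eq[OF PQ(1,2) ix] minor_0 by (simp only: emb_props(3)[OF True] emb(2)[OF True])
  have w: "emb v (ax v Q) * emb v (bx v P) - emb v (bx v Q) * emb v (ax v P) \<noteq> 0"
    using Sol(6)[OF PQ] emb_props(7)[OF True] unfolding e[symmetric] W0 by blast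
  have "ln (cmod (emb v (W 0 P Q))) \<le> p + q - min db da"
    unfolding e p_def q_def da_def db_def
    by (rule complex_octant_minor_bound[OF arch_Sol[OF True PQ(1)] arch_Sol[OF True PQ(2)] w oct[OF True, unfolded oct_def]])
  then have "k * ln (cmod (emb v (W 0 P Q))) \<le> k * (p + q - min db da)"
    using k by (intro mult_left_mono) auto
  also have "\<dots> = k * p + k * q - min (k * db) (k * da)"
    using k by (simp add: min_mult_distrib_left algebra_simps)
  finally show ?thesis
    using True by (simp add: ln_nrm_arch wt'_def pp_def dd_def p_def q_def k_def da_def db_def
        right_diff_distrib distrib_left)
next
  case False
  then have F: "v \<in> Fin \<union> T" using v by auto
  have "W 0 P Q \<noteq> 0" using Sol(6)[OF PQ] by (simp add: W0)
  then show ?thesis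
    using ultra_minor_bound[OF nonarch[OF F] abc_Sol(1,2)[OF PQ(1), of v] min_ix_le[of v P]
      abc_Sol(1,2)[OF PQ(2), of v] min_ix_le[of v Q], of 0]
    unfolding W_eq[OF PQ(1,2) ix] by (simp add: pp_def dd_def)
qed

lemma local_grid_bound:
  assumes v: "v \<in> Ainf" and PQ: "P \<in> Sol" "Q \<in> Sol" "P \<noteq> Q" and ix: "min_ix v P = min_ix v Q"
    and grid: "grid v P = grid v Q"
  shows "ln (nrm v (W 0 P Q)) \<le> pp v P + pp v Q - real (wt v) * ln 2"
proof -
  define p where "p = (ln (cmod (emb v (bx v P))) + ln (cmod (emb v (cx v P)))) / 2"
  define q where "q = (ln (cmod (emb v (bx v Q))) + ln (cmod (emb v (cx v Q)))) / 2"
  define k where "k = real (wt v)"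
  have k: "k > 0" using arch(2)[OF v] by (simp add: k_def)
  have e: "emb v (W 0 P Q) = emb v (ax v Q) * emb v (bx v P) - emb v (bx v Q) * emb v (ax v P)"
    unfolding W_eq[OF PQ(1,2) ix] minor_0 by (simp only: emb_props(3)[OF v] emb(2)[OF v])
  have w: "emb v (ax v Q) * emb v (bx v P) - emb v (bx v Q) * emb v (ax v P) \<noteq> 0"
    using Sol(6)[OF PQ] emb_props(7)[OF v] unfolding e[symmetric] W0 by blast
  have "ln (cmod (emb v (W 0 P Q))) \<le> p + q - ln 2"
    unfolding e p_def q_def
    by (rule complex_grid_minor_bound[OF arch_Sol[OF v PQ(1)] arch_Sol[OF v PQ(2)] w grid[unfolded grid_def]])
  then have "k * ln (cmod (emb v (W 0 P Q))) \<le> k * (p + q - ln 2)"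
    using k by (intro mult_left_mono) auto
  then show ?thesis
    using v by (simp add: ln_nrm_arch pp_def p_def q_def k_def right_diff_distrib distrib_left)
qed

section \<open>Global inequalities from the product formula\<close>

definition h where "h P = (\<Sum>v\<in>Ainf \<union> Fin \<union> T. pp v P)"
definition g where "g P = (\<Sum>v\<in>V. dd v P)"
definition D where "D P = (\<Sum>v\<in>T. dd v P)"

lemma finite_V: "finite V" "V \<noteq> {}"
  using finite_places Ainf_nonempty by (auto simp: V_def)

lemma sum_split:
  fixes f :: "'i \<Rightarrow> real"
  shows "(\<Sum>v\<in>Ainf \<union> Fin \<union> T. f v) = (\<Sum>v\<in>V. f v) + (\<Sum>v\<in>T. f v)"
  unfolding V_def using finite_places disjoint_places by (intro sum.union_disjoint) auto

text \<open>By the product formula the logarithms of each coordinate sum to 0, so the height is a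
  third of the total depth. The part \<open>D\<close> over \<open>T\<close> is the same for all
  points; only \<open>g\<close> varies.\<close>

lemma height_eq:
  assumes "P \<in> Sol"
  shows "3 * h P = g P + D P"
proof -
  have "dd v P = 3 * pp v P - (ln (nrm v (P 0)) + ln (nrm v (P 1)) + ln (nrm v (P 2)))" for v
    by (cases rule: abc_cases[of v P]) (simp_all add: dd_def pp_def)
  then have "(\<Sum>v\<in>Ainf \<union> Fin \<union> T. dd v P) = 3 * h P - ((\<Sum>v\<in>Ainf \<union> Fin \<union> T. ln (nrm v (P 0))) +
     (\<Sum>v\<in>Ainf \<union> Fin \<union> T. ln (nrm v (P 1))) + (\<Sum>v\<in>Ainf \<union> Fin \<union> T. ln (nrm v (P 2))))"
    by (simp add: sum_subtractf sum.distrib sum_distrib_left h_def)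
  also have "\<dots> = 3 * h P" using Sol(4)[OF assms] by simp
  finally show ?thesis by (simp add: sum_split g_def D_def)
qed

lemma T_const:
  assumes "P \<in> Sol" "Q \<in> Sol" "v \<in> T"
  shows "min_ix v P = min_ix v Q" "dd v P = dd v Q"
proof -
  have e: "nrm v (P 0) = nrm v (Q 0)" "nrm v (P 1) = nrm v (Q 1)" "nrm v (P 2) = nrm v (Q 2)"
    using Sol(5)[OF assms(1,2,3)] by auto
  show m: "min_ix v P = min_ix v Q" unfolding min_ix_def by (simp only: e)
  show "dd v P = dd v Q"
    by (cases rule: abc_cases[of v P]; cases rule: abc_cases[of v Q]) (use m e in \<open>simp_all add: dd_def pp_def\<close>)
qed

lemma D_const: "P \<in> Sol \<Longrightarrow> Q \<in> Sol \<Longrightarrow> D P = D Q"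
  unfolding D_def by (rule sum.cong[OF refl]) (rule T_const(2))

lemma D_nonneg: "P \<in> Sol \<Longrightarrow> D P \<ge> 0"
  unfolding D_def using dd_nonneg by (intro sum_nonneg) auto

lemma g_nonneg: "P \<in> Sol \<Longrightarrow> g P \<ge> 0"
  unfolding g_def V_def using dd_nonneg by (intro sum_nonneg) auto

lemma wt'_sum: "(\<Sum>v\<in>Ainf \<union> Fin \<union> T. wt' v * c) = real m * c"
proof -
  have "(\<Sum>v\<in>Ainf \<union> Fin \<union> T. wt' v) = (\<Sum>v\<in>Ainf. wt' v)"
    using finite_places by (intro sum.mono_neutral_right) (auto simp: wt'_def)
  then show ?thesis by (simp add: wt'_def m_def flip: sum_distrib_right)
qed

lemma W_in_R: "P \<in> Sol \<Longrightarrow> Q \<in> Sol \<Longrightarrow> W r P Q \<in> R"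
  unfolding W_def by (intro minor_in_R Sol(3)) auto

text \<open>The nonzero element \<open>W r P Q\<close> of \<open>R\<close> has nonnegative total
  logarithm, against which the local bounds are summed. Over \<open>T\<close> the depths of
  \<open>P\<close> and \<open>Q\<close> agree, so each minimum there is at least
  \<open>dd v P\<close>.\<close>

lemma global_pade_bound:
  assumes PQ: "P \<in> Sol" "Q \<in> Sol" and ix: "\<And>v. v \<in> V \<Longrightarrow> min_ix v P = min_ix v Q"
    and r: "r \<ge> 1" and w: "W r P Q \<noteq> 0"
  shows "D P + (\<Sum>v\<in>V. min (dd v Q) ((2 * real r + 1) * dd v P)) \<le>
    (3 * real r + 1) * h P + h Q + real m * (real r * (9 * ln 2))"
proof -
  have ix': "min_ix v P = min_ix v Q" if "v \<in> Ainf \<union> Fin \<union> T" for v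
    using that ix T_const[OF PQ] by (auto simp: V_def)
  have "0 \<le> (\<Sum>v\<in>Ainf \<union> Fin \<union> T. ln (nrm v (W r P Q)))"
    using integral[OF W_in_R[OF PQ] w] .
  also have "\<dots> \<le> (\<Sum>v\<in>Ainf \<union> Fin \<union> T. (3 * real r + 1) * pp v P + pp v Q + wt' v * (real r * (9 * ln 2))
    - min (dd v Q) ((2 * real r + 1) * dd v P))"
    by (intro sum_mono local_pade_bound PQ ix' r w)
  also have "\<dots> = (3 * real r + 1) * h P + h Q + real m * (real r * (9 * ln 2)) -
      ((\<Sum>v\<in>V. min (dd v Q) ((2 * real r + 1) * dd v P)) + (\<Sum>v\<in>T. min (dd v Q) ((2 * real r + 1) * dd v P)))"
    unfolding sum_subtractf sum.distrib sum_distrib_left[symmetric] wt'_sum h_def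
    using sum_split[of "\<lambda>v. min (dd v Q) ((2 * real r + 1) * dd v P)"] by simp
  finally have "(\<Sum>v\<in>V. min (dd v Q) ((2 * real r + 1) * dd v P)) + (\<Sum>v\<in>T. min (dd v Q) ((2 * real r + 1) * dd v P)) \<le>
    (3 * real r + 1) * h P + h Q + real m * (real r * (9 * ln 2))" by simp
  moreover have "D P \<le> (\<Sum>v\<in>T. min (dd v Q) ((2 * real r + 1) * dd v P))"
    unfolding D_def
  proof (rule sum_mono)
    fix v assume v: "v \<in> T"
    have "dd v P * 1 \<le> dd v P * (2 * real r + 1)" using dd_nonneg[of v P] v PQ by (intro mult_left_mono) auto
    then show "dd v P \<le> min (dd v Q) ((2 * real r + 1) * dd v P)"
      using T_const(2)[OF PQ v] by (simp add: mult.commute)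
  qed
  ultimately show ?thesis by linarith
qed

lemma global_gap_bound:
  assumes PQ: "P \<in> Sol" "Q \<in> Sol" "P \<noteq> Q" and ix: "\<And>v. v \<in> V \<Longrightarrow> min_ix v P = min_ix v Q"
    and oct: "\<And>v. v \<in> Ainf \<Longrightarrow> oct v P = oct v Q"
  shows "D P + (\<Sum>v\<in>V. min (dd v Q) (dd v P)) \<le> h P + h Q"
proof -
  have ix': "min_ix v P = min_ix v Q" if "v \<in> Ainf \<union> Fin \<union> T" for v
    using that ix T_const[OF PQ(1,2)] by (auto simp: V_def)
  have w: "W 0 P Q \<noteq> 0" using Sol(6)[OF PQ] by (simp add: W0)
  have "0 \<le> (\<Sum>v\<in>Ainf \<union> Fin \<union> T. ln (nrm v (W 0 P Q)))"
    using integral[OF W_in_R[OF PQ(1,2)] w] .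
  also have "\<dots> \<le> (\<Sum>v\<in>Ainf \<union> Fin \<union> T. pp v P + pp v Q - min (dd v Q) (dd v P))"
    by (intro sum_mono local_gap_bound PQ ix' oct)
  also have "\<dots> = h P + h Q - ((\<Sum>v\<in>V. min (dd v Q) (dd v P)) + (\<Sum>v\<in>T. min (dd v Q) (dd v P)))"
    unfolding sum_subtractf sum.distrib h_def
    using sum_split[of "\<lambda>v. min (dd v Q) (dd v P)"] by simp
  also have "(\<Sum>v\<in>T. min (dd v Q) (dd v P)) = D P"
    unfolding D_def using T_const(2)[OF PQ(1,2)] by (intro sum.cong) auto
  finally show ?thesis by simp
qed

lemma global_grid_bound:
  assumes PQ: "P \<in> Sol" "Q \<in> Sol" "P \<noteq> Q" and ix: "\<And>v. v \<in> V \<Longrightarrow> min_ix v P = min_ix v Q"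
    and grid: "\<And>v. v \<in> Ainf \<Longrightarrow> grid v P = grid v Q"
  shows "D P + real m * ln 2 \<le> h P + h Q"
proof -
  have w: "W 0 P Q \<noteq> 0" using Sol(6)[OF PQ] by (simp add: W0)
  have dm: "min (dd v Q) (dd v P) \<ge> 0" if "v \<in> Ainf \<union> Fin \<union> T" for v
    using dd_nonneg[OF that] PQ by auto
  have "0 \<le> (\<Sum>v\<in>Ainf \<union> Fin \<union> T. ln (nrm v (W 0 P Q)))"
    using integral[OF W_in_R[OF PQ(1,2)] w] .
  also have "\<dots> \<le> (\<Sum>v\<in>Ainf \<union> Fin \<union> T. pp v P + pp v Q - wt' v * ln 2 - (if v \<in> T then dd v P else 0))"
  proof (rule sum_mono)
    fix v assume v: "v \<in> Ainf \<union> Fin \<union> T"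
    show "ln (nrm v (W 0 P Q)) \<le> pp v P + pp v Q - wt' v * ln 2 - (if v \<in> T then dd v P else 0)"
    proof (cases "v \<in> Ainf")
      case True
      then have "v \<notin> T" using disjoint_places by auto
      then show ?thesis using local_grid_bound[OF True PQ ix grid] True by (simp add: wt'_def V_def)
    next
      case False
      have "min_ix v P = min_ix v Q" using v ix T_const[OF PQ(1,2)] by (auto simp: V_def)
      then have "ln (nrm v (W 0 P Q)) \<le> pp v P + pp v Q - min (dd v Q) (dd v P)"
        using local_gap_bound[OF v PQ] False by blast
      then show ?thesis using False dm[OF v] T_const(2)[OF PQ(1,2), of v] by (auto simp: wt'_def)
    qed
  qed
  also have "\<dots> = h P + h Q - real m * ln 2 - D P"
  proof -
    have "(\<Sum>v\<in>Ainf \<union> Fin \<union> T. if v \<in> T then dd v P else 0) = D P"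
      unfolding D_def using finite_places by (subst sum.inter_restrict[symmetric]) (auto intro!: sum.cong)
    then show ?thesis unfolding sum_subtractf sum.distrib wt'_sum h_def by simp
  qed
  finally show ?thesis by simp
qed

lemma m_pos: "m \<ge> 1"
proof -
  obtain v where v: "v \<in> Ainf" using Ainf_nonempty by blast
  have "1 \<le> wt v" using arch(2)[OF v] .
  also have "\<dots> \<le> m" unfolding m_def using finite_places v by (intro member_le_sum) auto
  finally show ?thesis .
qed

text \<open>Two points below this threshold in one grid class would have
  \<open>h P + h Q < D P + m * ln 2\<close>, against \<open>global_grid_bound\<close>. For all other
  points the threshold is the initial value of the geometric growth.\<close>

definition small where "small = {P \<in> Sol. g P < 3 / 2 * ln 2 * real m}"

lemma small_separated:
  assumes "P \<in> small" "Q \<in> small" "\<And>v. v \<in> V \<Longrightarrow> min_ix v P = min_ix v Q"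
    and "\<And>v. v \<in> Ainf \<Longrightarrow> grid v P = grid v Q"
  shows "P = Q"
proof (rule ccontr)
  assume "P \<noteq> Q"
  then have "D P + real m * ln 2 \<le> h P + h Q"
    using global_grid_bound[of P Q] assms by (simp add: small_def)
  moreover have PQ: "P \<in> Sol" "Q \<in> Sol" using assms by (auto simp: small_def)
  moreover have "D Q = D P" by (rule D_const[OF PQ(2,1)])
  moreover have "D P \<ge> 0" by (rule D_nonneg[OF PQ(1)])
  moreover note height_eq[OF PQ(1)] height_eq[OF PQ(2)]
  moreover have "g P < 3 / 2 * (real m * ln 2)" "g Q < 3 / 2 * (real m * ln 2)"
    using assms by (auto simp: small_def algebra_simps)
  ultimately show False by linarith
qed

text \<open>
  With \<open>MM\<close> about \<open>5 * nn\<close> there are at most \<open>15 ^ card V\<close> profiles, up to a constant below 1, while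
  the proportion \<open>BB\<close> of \<open>g\<close> that profiles control stays close to \<open>5 / 6\<close>.
\<close>

definition nn where "nn = card V - 1"
definition MM where "MM = 5 * nn + nn div 50 + 1"

lemma card_V: "card V = Suc nn"
  using finite_V by (simp add: nn_def card_gt_0_iff)

text \<open>For \<open>g P > 0\<close> the numbers \<open>(MM + nn) * dd v P / g P\<close> sum to
  \<open>MM + nn\<close>. Rounding them down at \<open>nn + 1\<close> places loses less than
  \<open>nn + 1\<close>, so the integers still sum to at least \<open>MM\<close> and can be lowered
  to sum to exactly \<open>MM\<close>.\<close>

lemma profile_exists:
  assumes P: "P \<in> Sol"
  shows "\<exists>k. (\<Sum>v\<in>V. k v) = MM \<and> (\<forall>v\<in>V. real (k v) * g P \<le> real (MM + nn) * dd v P)"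
proof (cases "g P = 0")
  case True
  then have z: "dd v P = 0" if "v \<in> V" for v
    using that finite_V sum_nonneg_eq_0_iff[of V "\<lambda>v. dd v P"] dd_nonneg[of _ P] P
    by (auto simp: g_def V_def)
  have "MM \<le> (\<Sum>v\<in>V. MM)" using card_V by simp
  then obtain k where "(\<Sum>v\<in>V. k v) = MM" using exists_le_with_sum[of V MM "\<lambda>_. MM"] finite_V by blast
  then show ?thesis using z True by auto
next
  case False
  then have g: "g P > 0" using g_nonneg[OF P] by simp
  define L where "L = MM + nn"
  define f where "f v = nat \<lfloor>real L * dd v P / g P\<rfloor>" for v
  have d0: "dd v P \<ge> 0" if "v \<in> V" for v using that dd_nonneg[of v P] P by (auto simp: V_def)
  have f: "real (f v) \<le> real L * dd v P / g P" "real L * dd v P / g P < real (f v) + 1" if "v \<in> V" for v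
  proof -
    have nn: "real L * dd v P / g P \<ge> 0" using d0[OF that] g by simp
    then have "real (f v) = of_int \<lfloor>real L * dd v P / g P\<rfloor>" by (simp add: f_def)
    then show "real (f v) \<le> real L * dd v P / g P" "real L * dd v P / g P < real (f v) + 1" by linarith+
  qed
  have "real L = (\<Sum>v\<in>V. real L * dd v P / g P)"
    using g by (simp add: g_def flip: sum_divide_distrib sum_distrib_left)
  also have "\<dots> < (\<Sum>v\<in>V. real (f v) + 1)" using f finite_V by (intro sum_strict_mono) auto
  also have "\<dots> = real (sum f V + Suc nn)" by (simp add: sum.distrib card_V)
  finally have "L < sum f V + Suc nn" by (simp only: of_nat_less_iff)
  then have "MM \<le> sum f V" by (simp add: L_def)
  then obtain k where k: "\<forall>v\<in>V. k v \<le> f v" "(\<Sum>v\<in>V. k v) = MM"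
    using exists_le_with_sum finite_V by metis
  have "real (k v) * g P \<le> real L * dd v P" if "v \<in> V" for v
  proof -
    have "real (k v) \<le> real L * dd v P / g P" using k(1) f(1)[OF that] that by (fastforce intro: order_trans)
    then show ?thesis using g by (simp add: field_simps)
  qed
  then show ?thesis using k(2) by (auto simp: L_def)
qed

definition profile where
  "profile P = restrict (SOME k. (\<Sum>v\<in>V. k v) = MM \<and> (\<forall>v\<in>V. real (k v) * g P \<le> real (MM + nn) * dd v P)) V"

lemma profile:
  assumes "P \<in> Sol"
  shows "profile P \<in> compositions V MM" "\<And>v. v \<in> V \<Longrightarrow> real (profile P v) * g P \<le> real (MM + nn) * dd v P"
  using someI_ex[OF profile_exists[OF assms]] by (auto simp: profile_def compositions_def)

text \<open>
  The profile approximates the vector \<open>dd v P / g P\<close> from below by integers with prescribed sum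
  \<open>MM\<close>. Thus in one class all points have \<open>dd v P\<close> bounded below by the same proportions of
  \<open>g P\<close>, which sum to \<open>BB\<close>.
\<close>

definition large_class where
  "large_class P Q \<longleftrightarrow> P \<in> Sol - small \<and> Q \<in> Sol - small \<and> (\<forall>v\<in>V. min_ix v P = min_ix v Q) \<and>
     (\<forall>v\<in>Ainf. oct v P = oct v Q) \<and> profile P = profile Q"

definition BB where "BB = real MM / real (MM + nn)"

text \<open>Since \<open>nn div 50 + 1\<close> is at least \<open>nn / 50\<close>, \<open>MM\<close>
  is at least \<open>5.02 * nn\<close>, and \<open>5.02 / 6.02 = 251 / 301\<close>, slightly more
  than 5/6.\<close>

lemma BB_ge: "BB \<ge> 251 / 301"
proof -
  have "50 * (nn div 50) + 49 \<ge> nn" by linarith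
  then have "251 * (MM + nn) \<le> 301 * MM" by (simp add: MM_def)
  then have "251 * real (MM + nn) \<le> 301 * real MM" by linarith
  then show ?thesis by (simp add: BB_def MM_def field_simps)
qed

text \<open>At each place the common profile bounds both arguments of the minimum from below by the
  same proportion of \<open>min (g Q) (t * g P)\<close>; these proportions sum to
  \<open>BB\<close>.\<close>

lemma min_sum_ge:
  assumes c: "large_class P Q" and t: "t \<ge> 0"
  shows "251 / 301 * min (g Q) (t * g P) \<le> (\<Sum>v\<in>V. min (dd v Q) (t * dd v P))"
proof -
  have PQ: "P \<in> Sol" "Q \<in> Sol" using c by (auto simp: large_class_def)
  define L where "L = real (MM + nn)"
  have L: "L > 0" by (simp add: L_def MM_def)
  define u where "u = min (g Q) (t * g P)"
  have u0: "u \<ge> 0" using g_nonneg PQ t by (simp add: u_def)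
  have "251 / 301 * u \<le> BB * u" using BB_ge u0 by (intro mult_right_mono)
  also have "\<dots> = (\<Sum>v\<in>V. real (profile P v) / L * u)"
  proof -
    have "(\<Sum>v\<in>V. profile P v) = MM" using profile(1)[OF PQ(1)] by (simp add: compositions_def)
    then have "real MM = (\<Sum>v\<in>V. real (profile P v))" by (metis of_nat_sum)
    then show ?thesis by (simp add: BB_def L_def sum_divide_distrib sum_distrib_right)
  qed
  also have "\<dots> \<le> (\<Sum>v\<in>V. min (dd v Q) (t * dd v P))"
  proof (rule sum_mono)
    fix v assume v: "v \<in> V"
    have e: "profile P = profile Q" using c by (simp add: large_class_def)
    have "real (profile P v) * u \<le> real (profile P v) * g Q" by (intro mult_left_mono) (auto simp: u_def)
    also have "\<dots> \<le> L * dd v Q" using profile(2)[OF PQ(2) v] by (simp add: e L_def)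
    finally have 1: "real (profile P v) / L * u \<le> dd v Q" using L by (simp add: field_simps)
    have "real (profile P v) * u \<le> real (profile P v) * (t * g P)" by (intro mult_left_mono) (auto simp: u_def)
    also have "\<dots> = t * (real (profile P v) * g P)" by simp
    also have "\<dots> \<le> t * (L * dd v P)" using profile(2)[OF PQ(1) v] t by (intro mult_left_mono) (auto simp: L_def)
    finally have 2: "real (profile P v) / L * u \<le> t * dd v P" using L by (simp add: field_simps)
    show "real (profile P v) / L * u \<le> min (dd v Q) (t * dd v P)" using 1 2 by simp
  qed
  finally show ?thesis by (simp only: u_def)
qed

text \<open>In terms of \<open>g\<close> the gap bound reads
  \<open>g Q \<ge> D P + (3 * c - 1) * g P\<close> with \<open>c = 251 / 301\<close>, and
  \<open>3 * c - 1 > 3 / 2\<close>.\<close>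

lemma large_gap:
  assumes c: "large_class P Q" and "P \<noteq> Q" "g P \<le> g Q"
  shows "g Q \<ge> D P + 3 / 2 * g P"
proof -
  have PQ: "P \<in> Sol" "Q \<in> Sol" using c by (auto simp: large_class_def)
  have "D P + (\<Sum>v\<in>V. min (dd v Q) (dd v P)) \<le> h P + h Q"
    using global_gap_bound[OF PQ assms(2)] c by (simp add: large_class_def)
  moreover have "251 / 301 * g P \<le> (\<Sum>v\<in>V. min (dd v Q) (dd v P))"
    using min_sum_ge[OF c, of 1] assms(3) by simp
  moreover note D_const[OF PQ(2,1)] height_eq[OF PQ(1)] height_eq[OF PQ(2)] g_nonneg[OF PQ(1)]
  ultimately show ?thesis by linarith
qed

lemma large_pade:
  assumes c: "large_class P Q" and r: "r \<ge> 1" and w: "W r P Q \<noteq> 0"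
  shows "251 / 301 * min (g Q) ((2 * real r + 1) * g P) \<le>
    (real r + 1 / 3) * g P + g Q / 3 + real r * (D P + real m * (9 * ln 2))"
proof -
  have PQ: "P \<in> Sol" "Q \<in> Sol" using c by (auto simp: large_class_def)
  have "D P + (\<Sum>v\<in>V. min (dd v Q) ((2 * real r + 1) * dd v P)) \<le>
    (3 * real r + 1) * h P + h Q + real m * (real r * (9 * ln 2))"
    using global_pade_bound[OF PQ _ r w] c by (simp add: large_class_def)
  moreover have "251 / 301 * min (g Q) ((2 * real r + 1) * g P) \<le> (\<Sum>v\<in>V. min (dd v Q) ((2 * real r + 1) * dd v P))"
    using min_sum_ge[OF c, of "2 * real r + 1"] by simp
  moreover have "h P = (g P + D P) / 3" "h Q = (g Q + D P) / 3"
    using height_eq[OF PQ(1)] height_eq[OF PQ(2)] D_const[OF PQ] by simp_all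
  moreover have "(3 * real r + 1) * ((g P + D P) / 3) + (g Q + D P) / 3 + real m * (real r * (9 * ln 2)) - D P
     = (real r + 1 / 3) * g P + g Q / 3 + real r * (D P + real m * (9 * ln 2)) - D P / 3"
    by (simp add: algebra_simps add_divide_distrib)
  moreover note D_nonneg[OF PQ(1)]
  ultimately show ?thesis by simp
qed

text \<open>Equal cubes of the coordinates give equal norms at every place, so all depths over
  \<open>V\<close> vanish and \<open>g P = 0\<close>.\<close>

lemma W_consecutive:
  assumes PQ: "P \<in> Sol" "Q \<in> Sol" and g: "g P > 0" and w: "W r P Q = 0"
  shows "W (Suc r) P Q \<noteq> 0"
proof
  assume w': "W (Suc r) P Q = 0"
  have nz: "P 0 \<noteq> 0" "P 1 \<noteq> 0" "P 2 \<noteq> 0" "Q 0 \<noteq> 0" using Sol(2) PQ by auto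
  have e: "P 0 ^ 3 = P 1 ^ 3" "P 1 ^ 3 = P 2 ^ 3"
    using minor_consecutive_nonzero[OF Sol(1)[OF PQ(1)] nz] w w' by (auto simp: W_def)
  have "dd v P = 0" if "v \<in> V" for v
  proof -
    have v: "v \<in> Ainf \<union> Fin \<union> T" using that by (auto simp: V_def)
    note N = nrm_mult_norm[OF v]
    have "nrm v (P 0) ^ 3 = nrm v (P 1) ^ 3" "nrm v (P 1) ^ 3 = nrm v (P 2) ^ 3"
      using e by (metis mult_norm_power[OF N])+
    then have "nrm v (P 0) = nrm v (P 1)" "nrm v (P 1) = nrm v (P 2)"
      using mult_norm_nonneg[OF N] power_eq_imp_eq_base by (metis zero_less_numeral)+
    then show ?thesis by (cases rule: abc_cases[of v P]) (simp_all add: dd_def pp_def)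
  qed
  then show False using g by (simp add: g_def)
qed

text \<open>With \<open>q = g Q / g P\<close> close to \<open>2 * r\<close>, the inequality compares
  \<open>502 / 301 * r\<close> with \<open>5 / 3 * r + r / 2000\<close>. The excess, about
  \<open>0.0006 * r\<close>, outweighs the bounded terms once \<open>r \<ge> 2000\<close>, and
  \<open>4003 = 2 * 2000 + 3\<close> ensures this.\<close>

lemma large_exclusion:
  assumes c: "large_class P Q" and G: "g P > 0" "g P \<ge> 2000 * (D P + real m * (9 * ln 2))"
  shows "g Q < 4003 * g P"
proof (rule ccontr)
  assume "\<not> ?thesis"
  then have big: "4003 * g P \<le> g Q" by simp
  have PQ: "P \<in> Sol" "Q \<in> Sol" using c by (auto simp: large_class_def)
  define q where "q = g Q / g P"
  have gQ: "g Q = q * g P" using G by (simp add: q_def)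
  have q: "q \<ge> 4003" using big G by (simp add: q_def field_simps)
  \<comment> \<open>\<open>r\<close> balances the two entries of the minimum; if \<open>W r P Q\<close> vanishes, \<open>r + 1\<close> serves.\<close>
  define r where "r = nat \<lfloor>(q - 1) / 2\<rfloor>"
  have rr: "real r = of_int \<lfloor>(q - 1) / 2\<rfloor>" using q by (simp add: r_def)
  have r1: "real r \<le> (q - 1) / 2" "(q - 1) / 2 < real r + 1" unfolding rr by linarith+
  then have r2: "2 * real r + 1 \<le> q" "q < 2 * real r + 3" by (simp_all add: field_simps)
  have r3: "real r \<ge> 2000" using r2 q by linarith
  then have r4: "r \<ge> 1" by linarith
  have pade: "251 / 301 * min q (2 * real k + 1) \<le> (real k + 1 / 3) + q / 3 + real k / 2000"
    if k: "k \<ge> 1" "W k P Q \<noteq> 0" for k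
  proof -
    have "real k * (D P + real m * (9 * ln 2)) \<le> real k * (g P / 2000)"
      using G(2) by (intro mult_left_mono) auto
    then have "251 / 301 * min (g Q) ((2 * real k + 1) * g P) \<le>
      (real k + 1 / 3) * g P + g Q / 3 + real k * (g P / 2000)"
      using large_pade[OF c k] by linarith
    moreover have "min (g Q) ((2 * real k + 1) * g P) = min q (2 * real k + 1) * g P"
      using G(1) by (simp add: gQ min_mult_distrib_right)
    ultimately have "(251 / 301 * min q (2 * real k + 1)) * g P \<le> ((real k + 1 / 3) + q / 3 + real k / 2000) * g P"
      by (simp add: gQ algebra_simps)
    then show ?thesis using G(1) by simp
  qed
  show False
  proof (cases "W r P Q = 0")
    case True
    then have "W (Suc r) P Q \<noteq> 0" using W_consecutive[OF PQ G(1)] by blast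
    then have "251 / 301 * min q (2 * real (Suc r) + 1) \<le> (real (Suc r) + 1 / 3) + q / 3 + real (Suc r) / 2000"
      by (intro pade) auto
    moreover have "min q (2 * real (Suc r) + 1) = q" using r2 by simp
    ultimately show False using r2 r3 of_nat_Suc[of r, where 'a = real] by argo
  next
    case False
    then have "251 / 301 * min q (2 * real r + 1) \<le> (real r + 1 / 3) + q / 3 + real r / 2000"
      by (intro pade r4)
    moreover have "min q (2 * real r + 1) = 2 * real r + 1" using r2 by simp
    ultimately show False using r2 r3 by argo
  qed
qed

text \<open>From \<open>g \<ge> 3 / 2 * m * ln 2\<close> on, 24 steps of growth reach the
  \<open>2000 * (D + 9 * m * ln 2)\<close> required by \<open>large_exclusion\<close>, since
  \<open>16800 * 3 / 2 \<ge> 18000\<close>. Another 21 steps multiply \<open>g\<close> by at least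
  4900, more than the 4003 allowed; so 46 points are impossible.\<close>

lemma large_class_card:
  assumes F: "finite F" "\<And>P Q. P \<in> F \<Longrightarrow> Q \<in> F \<Longrightarrow> large_class P Q"
  shows "card F \<le> 45"
proof (rule ccontr)
  assume "\<not> ?thesis"
  then have l: "card F \<ge> 46" by simp
  obtain xs where xs: "set xs = F" "distinct xs" "length xs = card F"
    "\<And>i j. i < j \<Longrightarrow> j < card F \<Longrightarrow> g (xs ! i) \<le> g (xs ! j)"
    using sorted_enumeration[OF F(1)] by metis
  have xF: "xs ! i \<in> F" if "i < card F" for i using that xs by (metis nth_mem)
  have F_ne: "0 < card F" using l by simp
  define d where "d = D (xs ! 0)"
  have xSol: "xs ! i \<in> Sol - small" if "i < card F" for i
    using F(2)[OF xF xF] that by (auto simp: large_class_def)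
  have d: "D (xs ! i) = d" if "i < card F" for i
    unfolding d_def by (rule D_const) (use xSol that F_ne in auto)
  have d0: "d \<ge> 0" unfolding d_def using D_nonneg xSol[OF F_ne] by blast
  have step: "g (xs ! Suc i) \<ge> d + 3 / 2 * g (xs ! i)" if "Suc i < card F" for i
  proof -
    have "xs ! i \<noteq> xs ! Suc i" using xs that nth_eq_iff_index_eq[of xs i "Suc i"] by auto
    then show ?thesis
      using large_gap[OF F(2)[OF xF xF], of i "Suc i"] that xs(4)[of i "Suc i"] d[of i] by simp
  qed
  define e where "e = real m * ln 2"
  have e: "e > 0" using m_pos by (simp add: e_def)
  have g0: "g (xs ! 0) \<ge> 3 / 2 * e"
    using xSol[OF F_ne] by (auto simp: small_def e_def algebra_simps)
  have pw: "(3 / 2 :: real) ^ 24 \<ge> 16800" "(3 / 2 :: real) ^ 21 \<ge> 4900" by (simp_all add: power_divide)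
  have "g (xs ! (0 + 24)) \<ge> (3 / 2) ^ 24 * g (xs ! 0) + 2 * ((3 / 2) ^ 24 - 1) * d"
    using l d0 by (intro gap_sequence_growth[where l = "card F" and g = "\<lambda>i. g (xs ! i)"] step) auto
  moreover have "(3 / 2) ^ 24 * g (xs ! 0) \<ge> 16800 * (3 / 2 * e)"
    using pw g0 e by (intro mult_mono) auto
  moreover have "2 * ((3 / 2) ^ 24 - 1) * d \<ge> 2000 * d"
    using pw d0 by (intro mult_right_mono) auto
  ultimately have g24: "g (xs ! 24) \<ge> 25200 * e + 2000 * d" by simp
  have "g (xs ! (24 + 21)) \<ge> (3 / 2) ^ 21 * g (xs ! 24) + 2 * ((3 / 2) ^ 21 - 1) * d"
    using l d0 by (intro gap_sequence_growth[where l = "card F" and g = "\<lambda>i. g (xs ! i)"] step) auto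
  moreover have "(3 / 2) ^ 21 * g (xs ! 24) \<ge> 4900 * g (xs ! 24)"
    using pw g24 e d0 by (intro mult_right_mono) linarith+
  moreover have "2 * ((3 / 2) ^ 21 - 1) * d \<ge> 0 * d"
    using pw d0 by (intro mult_right_mono) auto
  ultimately have "g (xs ! 45) \<ge> 4900 * g (xs ! 24)" by simp
  moreover have "g (xs ! 45) < 4003 * g (xs ! 24)"
  proof (rule large_exclusion[OF F(2)[OF xF xF]])
    show "g (xs ! 24) > 0" using g24 e d0 by linarith
    show "g (xs ! 24) \<ge> 2000 * (D (xs ! 24) + real m * (9 * ln 2))"
      using g24 e d[of 24] l by (simp add: e_def)
  qed (use l in auto)
  ultimately show False using g24 e d0 by linarith
qed

section \<open>Counting the classes\<close>

definition real_place where "real_place v \<longleftrightarrow> (\<forall>x. Im (emb v x) = 0)"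
definition wn where "wn v = (if v \<in> Ainf then wt v else 0)"

text \<open>At a real place the local coordinate is real, so only the sign of its real part remains:
  2 values instead of 8.\<close>

definition oct_range where
  "oct_range v = (if v \<notin> Ainf then {(True, True, True)} else if real_place v then UNIV \<times> {True} \<times> {True} else UNIV)"

definition grid_range :: "'i \<Rightarrow> (int \<times> int) set" where
  "grid_range v = (if v \<notin> Ainf then {(0, 0)} else if real_place v then {-6..5} \<times> {0} else {-6..5} \<times> {-6..5})"

lemma real_place_coord:
  assumes "real_place v"
  shows "Im (local_coord (emb v x) (emb v y) (emb v z)) = 0"
proof -
  have "emb v x \<in> \<real>" "emb v y \<in> \<real>" "emb v z \<in> \<real>" using assms by (auto simp: real_place_def complex_is_Real_iff)
  then have "local_coord (emb v x) (emb v y) (emb v z) \<in> \<real>" by (auto simp: local_coord_def)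
  then show ?thesis by (simp add: complex_is_Real_iff)
qed

lemma oct_in_range: "v \<in> Ainf \<Longrightarrow> oct v P \<in> oct_range v"
  using real_place_coord by (auto simp: oct_range_def oct_def octant_def)

lemma grid_in_range:
  assumes "v \<in> Ainf" "P \<in> Sol"
  shows "grid v P \<in> grid_range v"
proof -
  have "grid v P \<in> {-6..5} \<times> {-6..5}"
    unfolding grid_def by (rule grid_cell_range local_coord(5)[OF arch_Sol[OF assms]])+
  moreover have "snd (grid v P) = 0" if "real_place v"
    using real_place_coord[OF that] by (simp add: grid_def grid_cell_def)
  ultimately show ?thesis using assms(1) by (auto simp: grid_range_def)
qed

lemma weight_power:
  assumes "v \<in> Ainf"
  shows "3.2 \<le> (3.2::real) ^ wn v" "\<not> real_place v \<Longrightarrow> 10.24 \<le> (3.2::real) ^ wn v"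
proof -
  have "(3.2::real) ^ 1 \<le> 3.2 ^ wt v" using arch(2)[OF assms] by (intro power_increasing) auto
  then show "3.2 \<le> (3.2::real) ^ wn v" using assms by (simp add: wn_def)
  show "10.24 \<le> (3.2::real) ^ wn v" if "\<not> real_place v"
  proof -
    have "wt v \<ge> 2" using that arch(3)[OF assms] by (auto simp: real_place_def)
    then have "(3.2::real) ^ 2 \<le> 3.2 ^ wt v" by (intro power_increasing) auto
    then show ?thesis using assms by (simp add: wn_def power2_eq_square)
  qed
qed

lemma oct_range_card: "finite (oct_range v)" "real (card (oct_range v)) \<le> 3.2 ^ wn v"
proof -
  show "finite (oct_range v)" by (simp add: oct_range_def)
  have "card (UNIV :: (bool \<times> bool \<times> bool) set) = 8"
    by (simp add: card_cartesian_product flip: UNIV_Times_UNIV)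
  then show "real (card (oct_range v)) \<le> 3.2 ^ wn v"
    using weight_power[of v] by (auto simp: oct_range_def wn_def card_cartesian_product)
qed

text \<open>The tightest case is a complex place, \<open>3 * 144 = 432\<close> against
  \<open>45 * 10.24 = 460.8\<close>; it dictates a base near 3.2.\<close>

lemma grid_range_card: "finite (grid_range v)" "3 * real (card (grid_range v)) \<le> 45 * 3.2 ^ wn v"
  using weight_power[of v] by (auto simp: grid_range_def wn_def card_cartesian_product)

lemma prod_weights: "(\<Prod>v\<in>V. (3.2::real) ^ wn v) = 3.2 ^ m"
proof -
  have "(\<Sum>v\<in>V. wn v) = (\<Sum>v\<in>Ainf. wn v)"
    using finite_places by (intro sum.mono_neutral_right) (auto simp: V_def wn_def)
  also have "\<dots> = m" by (simp add: m_def wn_def)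
  finally show ?thesis by (simp flip: power_sum)
qed

definition large_key where
  "large_key P = (restrict (\<lambda>v. (min_ix v P, if v \<in> Ainf then oct v P else (True, True, True))) V, profile P)"

definition large_keys where
  "large_keys = (PiE V (\<lambda>v. {..<3::nat} \<times> oct_range v)) \<times> compositions V MM"

text \<open>0.08 is \<open>6 / 5\<close> divided by 15: profiles have a prescribed sum, hence one
  degree of freedom less than there are places, and
  \<open>3 ^ card V * 15 ^ nn = 45 ^ card V / 15\<close>.\<close>

lemma large_keys_card: "finite large_keys" "real (card large_keys) \<le> 0.08 * 45 ^ card V * 3.2 ^ m"
proof -
  have f: "finite (PiE V (\<lambda>v. {..<3::nat} \<times> oct_range v))"
    using finite_V oct_range_card by (intro finite_PiE) auto
  then show "finite large_keys" using compositions_card[OF _ card_V] finite_V by (simp add: large_keys_def)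
  have "real (card (PiE V (\<lambda>v. {..<3::nat} \<times> oct_range v))) = (\<Prod>v\<in>V. 3 * real (card (oct_range v)))"
    using finite_V by (simp add: card_PiE card_cartesian_product)
  also have "\<dots> \<le> (\<Prod>v\<in>V. 3 * 3.2 ^ wn v)"
    using oct_range_card by (intro prod_mono) auto
  also have "\<dots> = 3 ^ card V * 3.2 ^ m" by (simp only: prod.distrib prod_constant prod_weights)
  finally have 1: "real (card (PiE V (\<lambda>v. {..<3::nat} \<times> oct_range v))) \<le> 3 ^ card V * 3.2 ^ m" .
  have "real (card (compositions V MM)) \<le> real ((MM + nn) choose nn)"
    using compositions_card[OF finite_V(1) card_V] by (simp only: of_nat_le_iff)
  also have "\<dots> \<le> 6 / 5 * 15 ^ nn" using binomial_growth[of nn] by (simp only: MM_def)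
  finally have 2: "real (card (compositions V MM)) \<le> 6 / 5 * 15 ^ nn" .
  have "real (card large_keys) \<le> (3 ^ card V * 3.2 ^ m) * (6 / 5 * 15 ^ nn)"
    unfolding large_keys_def card_cartesian_product of_nat_mult
    by (intro mult_mono 1 2) auto
  also have "\<dots> = 0.08 * 45 ^ card V * 3.2 ^ m"
    using power_mult_distrib[of "3::real" 15 nn] by (simp add: card_V)
  finally show "real (card large_keys) \<le> 0.08 * 45 ^ card V * 3.2 ^ m" .
qed

lemma large_card:
  assumes "finite F" "F \<subseteq> Sol - small"
  shows "real (card F) \<le> 3.6 * 45 ^ card V * 3.2 ^ m"
proof -
  have "card F \<le> 45 * card large_keys"
  proof (rule card_le_fibers[OF assms(1) _ large_keys_card(1)])
    show "large_key ` F \<subseteq> large_keys"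
    proof (rule image_subsetI)
      fix P assume "P \<in> F"
      then have P: "P \<in> Sol" using assms by auto
      have "restrict (\<lambda>v. (min_ix v P, if v \<in> Ainf then oct v P else (True, True, True))) V \<in> PiE V (\<lambda>v. {..<3} \<times> oct_range v)"
        using oct_in_range by (intro restrict_PiE_iff[THEN iffD2]) (auto simp: min_ix_less oct_range_def)
      then show "large_key P \<in> large_keys" using profile(1)[OF P] by (simp add: large_key_def large_keys_def)
    qed
    fix k
    show "card {P \<in> F. large_key P = k} \<le> 45"
    proof (rule large_class_card)
      show "finite {P \<in> F. large_key P = k}" using assms(1) by simp
      fix P Q assume "P \<in> {P \<in> F. large_key P = k}" "Q \<in> {P \<in> F. large_key P = k}"
      then have PQ: "P \<in> Sol - small" "Q \<in> Sol - small" "large_key P = large_key Q" using assms(2) by auto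
      have e: "(min_ix v P, if v \<in> Ainf then oct v P else (True, True, True)) =
          (min_ix v Q, if v \<in> Ainf then oct v Q else (True, True, True))" if "v \<in> V" for v
      proof -
        have "restrict (\<lambda>v. (min_ix v P, if v \<in> Ainf then oct v P else (True, True, True))) V v =
          restrict (\<lambda>v. (min_ix v Q, if v \<in> Ainf then oct v Q else (True, True, True))) V v"
          using PQ(3) by (simp only: large_key_def prod.inject)
        then show ?thesis using that by (simp only: restrict_apply' )
      qed
      have "oct v P = oct v Q" if "v \<in> Ainf" for v
        using e[of v] that by (simp add: V_def)
      moreover have "min_ix v P = min_ix v Q" if "v \<in> V" for v
        using e[OF that] by simp
      moreover have "profile P = profile Q" using PQ(3) by (simp only: large_key_def prod.inject)
      ultimately show "large_class P Q" using PQ by (simp add: large_class_def)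
    qed
  qed
  then have "real (card F) \<le> 45 * real (card large_keys)"
    by (metis of_nat_le_iff of_nat_mult of_nat_numeral)
  then show ?thesis using large_keys_card(2) by simp
qed

definition small_key where
  "small_key P = restrict (\<lambda>v. (min_ix v P, if v \<in> Ainf then grid v P else (0, 0))) V"

lemma small_card: "finite small" "real (card small) \<le> 45 ^ card V * 3.2 ^ m"
proof -
  define K where "K = PiE V (\<lambda>v. {..<3::nat} \<times> grid_range v)"
  have fK: "finite K" unfolding K_def using finite_V grid_range_card by (intro finite_PiE) auto
  have im: "small_key ` small \<subseteq> K"
  proof (rule image_subsetI)
    fix P assume "P \<in> small"
    then have P: "P \<in> Sol" by (simp add: small_def)
    show "small_key P \<in> K"
      unfolding small_key_def K_def
      using grid_in_range[OF _ P] by (intro restrict_PiE_iff[THEN iffD2]) (auto simp: min_ix_less grid_range_def)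
  qed
  have inj: "inj_on small_key small"
  proof (rule inj_onI)
    fix P Q assume PQ: "P \<in> small" "Q \<in> small" "small_key P = small_key Q"
    have e: "(min_ix v P, if v \<in> Ainf then grid v P else (0, 0)) =
        (min_ix v Q, if v \<in> Ainf then grid v Q else (0, 0))" if "v \<in> V" for v
    proof -
      have "small_key P v = small_key Q v" using PQ(3) by simp
      then show ?thesis using that by (simp only: small_key_def restrict_apply')
    qed
    show "P = Q"
    proof (rule small_separated[OF PQ(1,2)])
      show "min_ix v P = min_ix v Q" if "v \<in> V" for v using e[OF that] by simp
      show "grid v P = grid v Q" if "v \<in> Ainf" for v using e[of v] that by (simp add: V_def)
    qed
  qed
  show "finite small" using finite_imageD[OF finite_subset[OF im fK] inj] .
  have "real (card small) \<le> real (card K)" using card_inj_on_le[OF inj im fK] by (simp only: of_nat_le_iff)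
  also have "\<dots> = (\<Prod>v\<in>V. 3 * real (card (grid_range v)))"
    using finite_V by (simp add: K_def card_PiE card_cartesian_product)
  also have "\<dots> \<le> (\<Prod>v\<in>V. 45 * 3.2 ^ wn v)"
    using grid_range_card by (intro prod_mono) auto
  also have "\<dots> = 45 ^ card V * 3.2 ^ m" by (simp only: prod.distrib prod_constant prod_weights)
  finally show "real (card small) \<le> 45 ^ card V * 3.2 ^ m" .
qed

theorem solution_count: "finite Sol" "real (card Sol) \<le> 5 * 3.2 ^ m * 45 ^ card V"
proof -
  \<comment> \<open>Finite subsets come first, because finiteness of \<open>Sol\<close> is itself a
    consequence of this uniform bound. The constant is \<open>3.6 + 1\<close>, rounded up to
    5.\<close>
  have b: "real (card F) \<le> 5 * 3.2 ^ m * 45 ^ card V" if F: "finite F" "F \<subseteq> Sol" for F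
  proof -
    have "card F = card (F \<inter> small) + card (F - small)" using F(1) by (simp add: card_Int_Diff)
    then have "real (card F) = real (card (F \<inter> small)) + real (card (F - small))" by simp
    also have "\<dots> \<le> real (card small) + 3.6 * 45 ^ card V * 3.2 ^ m"
      using large_card[of "F - small"] F card_mono[OF small_card(1), of "F \<inter> small"] by (intro add_mono) auto
    also have "\<dots> \<le> 45 ^ card V * 3.2 ^ m + 3.6 * 45 ^ card V * 3.2 ^ m" using small_card(2) by simp
    also have "\<dots> = 4.6 * (3.2 ^ m * 45 ^ card V)" by (simp add: algebra_simps)
    also have "\<dots> \<le> 5 * (3.2 ^ m * 45 ^ card V)" by (intro mult_right_mono) auto
    finally show ?thesis by (simp only: mult.assoc)
  qed
  show "finite Sol"
  proof (rule finite_if_finite_subsets_card_bdd[THEN conjunct1])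
    show "card F \<le> nat \<lceil>5 * 3.2 ^ m * 45 ^ card V :: real\<rceil>" if "F \<subseteq> Sol" "finite F" for F
      using b[OF that(2,1)] by linarith
  qed
  then show "real (card Sol) \<le> 5 * 3.2 ^ m * 45 ^ card V" using b by blast
qed

end

section \<open>Simple extensions of the rationals\<close>

interpretation of_rat_poly: map_poly_inj_idom_hom "of_rat :: rat \<Rightarrow> 'a::field_char_0" ..

interpretation to_ac_hom: inj_idom_hom "to_ac :: 'a::field \<Rightarrow> 'a alg_closure"
  by unfold_locales auto

interpretation to_ac_poly: map_poly_inj_idom_hom "to_ac :: 'a::field \<Rightarrow> 'a alg_closure" ..

definition rat_eval :: "rat poly \<Rightarrow> 'a::field_char_0 \<Rightarrow> 'a" where
  "rat_eval p x = poly (map_poly of_rat p) x"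

lemma rat_eval_simps [simp]:
  "rat_eval 0 x = 0" "rat_eval 1 x = 1" "rat_eval (p + q) x = rat_eval p x + rat_eval q x"
  "rat_eval (p - q) x = rat_eval p x - rat_eval q x" "rat_eval (- p) x = - rat_eval p x"
  "rat_eval (p * q) x = rat_eval p x * rat_eval q x" "rat_eval (p ^ n) x = rat_eval p x ^ n"
  "rat_eval (pCons a p) x = of_rat a + x * rat_eval p x" "rat_eval (Polynomial.smult a p) x = of_rat a * rat_eval p x"
  "rat_eval (Polynomial.monom a n) x = of_rat a * x ^ n"
  "rat_eval (sum f A) x = (\<Sum>i\<in>A. rat_eval (f i) x)"
  by (simp_all add: rat_eval_def hom_distribs poly_monom poly_sum)

lemma rat_eval_pcompose: "rat_eval (p \<circ>\<^sub>p q) x = rat_eval p (rat_eval q x)"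
  by (induction p) (simp_all add: pcompose_pCons)

lemma finite_dim_bound:
  assumes "number_field TYPE('k::field_char_0)" and "rat_vs.independent (S :: 'k set)"
  shows "finite S" "card S \<le> field_degree TYPE('k)"
proof -
  obtain B :: "'k set" where B: "finite B" "rat_vs.span B = UNIV"
    using assms(1) by (auto simp: number_field_def)
  obtain C :: "'k set" where C: "rat_vs.independent C" "UNIV \<subseteq> rat_vs.span C" "card C = rat_vs.dim (UNIV :: 'k set)"
    using rat_vs.basis_exists[of "UNIV :: 'k set"] by metis
  have "finite C" using rat_vs.independent_span_bound[OF B(1) C(1)] B(2) by simp
  then show "finite S" "card S \<le> field_degree TYPE('k)"
    using rat_vs.independent_span_bound[OF _ assms(2), of C] C by (auto simp: field_degree_def)
qed

text \<open>More powers of \<open>x\<close> than the degree are linearly dependent. Coinciding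
  powers are treated first: \<open>independent\<close> speaks of a set, where repetitions are
  invisible, but they give a relation of their own.\<close>

lemma algebraic_bounded_degree:
  fixes x :: "'k::field_char_0"
  assumes "number_field TYPE('k)"
  shows "\<exists>p. p \<noteq> 0 \<and> degree p \<le> field_degree TYPE('k) \<and> rat_eval p x = 0"
proof (rule ccontr)
  define m where "m = field_degree TYPE('k)"
  assume "\<not> ?thesis"
  then have no: "p = 0" if "degree p \<le> m" "rat_eval p x = 0" for p using that by (auto simp: m_def)
  have inj: "inj_on (\<lambda>i. x ^ i) {..m}"
  proof (rule inj_onI)
    fix i j assume ij: "i \<in> {..m}" "j \<in> {..m}" "x ^ i = x ^ j"
    have "degree (Polynomial.monom 1 i - Polynomial.monom 1 j :: rat poly) \<le> m"
      using ij by (intro degree_diff_le) (auto intro: order_trans[OF degree_monom_le])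
    then have "Polynomial.monom (1::rat) i - Polynomial.monom 1 j = 0"
      using ij by (intro no) auto
    then show "i = j" by (metis eq_iff_diff_eq_0 degree_monom_eq zero_neq_one)
  qed
  have "rat_vs.independent ((\<lambda>i. x ^ i) ` {..m})"
  proof (rule ccontr)
    assume "\<not> ?thesis"
    then obtain u where u: "\<exists>v\<in>(\<lambda>i. x ^ i) ` {..m}. u v \<noteq> 0" "(\<Sum>v\<in>(\<lambda>i. x ^ i) ` {..m}. rat_scale (u v) v) = 0"
      using rat_vs.dependent_finite[of "(\<lambda>i. x ^ i) ` {..m}"] by auto
    define p where "p = (\<Sum>i\<le>m. Polynomial.monom (u (x ^ i)) i)"
    have "degree p \<le> m" unfolding p_def by (intro degree_sum_le) (auto intro: order_trans[OF degree_monom_le])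
    moreover have "rat_eval p x = 0"
      using u(2) inj by (simp add: p_def sum.reindex rat_scale_def)
    ultimately have "p = 0" by (rule no)
    moreover have "coeff p i = u (x ^ i)" if "i \<le> m" for i
      using that by (simp add: p_def coeff_sum if_distrib sum.delta cong: if_cong)
    ultimately show False using u(1) by auto
  qed
  from finite_dim_bound(2)[OF assms this] inj show False by (simp add: card_image m_def)
qed

definition adjoin :: "'a::field_char_0 \<Rightarrow> 'a set" where
  "adjoin \<gamma> = range (\<lambda>p. rat_eval p \<gamma>)"

lemma adjoin_closed:
  "x \<in> adjoin \<gamma> \<Longrightarrow> y \<in> adjoin \<gamma> \<Longrightarrow> x + y \<in> adjoin \<gamma>"
  "x \<in> adjoin \<gamma> \<Longrightarrow> y \<in> adjoin \<gamma> \<Longrightarrow> x - y \<in> adjoin \<gamma>"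
  "x \<in> adjoin \<gamma> \<Longrightarrow> y \<in> adjoin \<gamma> \<Longrightarrow> x * y \<in> adjoin \<gamma>"
  "x \<in> adjoin \<gamma> \<Longrightarrow> - x \<in> adjoin \<gamma>"
  "of_rat q \<in> adjoin \<gamma>" "0 \<in> adjoin \<gamma>" "1 \<in> adjoin \<gamma>" "\<gamma> \<in> adjoin \<gamma>" "x \<in> adjoin \<gamma> \<Longrightarrow> rat_eval p x \<in> adjoin \<gamma>"
proof -
  have mem: "rat_eval p \<gamma> \<in> adjoin \<gamma>" for p by (simp add: adjoin_def)
  show "x \<in> adjoin \<gamma> \<Longrightarrow> y \<in> adjoin \<gamma> \<Longrightarrow> x + y \<in> adjoin \<gamma>"
    unfolding adjoin_def by (clarsimp) (metis rat_eval_simps(3) rangeI)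
  show "x \<in> adjoin \<gamma> \<Longrightarrow> y \<in> adjoin \<gamma> \<Longrightarrow> x - y \<in> adjoin \<gamma>"
    unfolding adjoin_def by (clarsimp) (metis rat_eval_simps(4) rangeI)
  show "x \<in> adjoin \<gamma> \<Longrightarrow> y \<in> adjoin \<gamma> \<Longrightarrow> x * y \<in> adjoin \<gamma>"
    unfolding adjoin_def by (clarsimp) (metis rat_eval_simps(6) rangeI)
  show "x \<in> adjoin \<gamma> \<Longrightarrow> - x \<in> adjoin \<gamma>"
    unfolding adjoin_def by (clarsimp) (metis rat_eval_simps(5) rangeI)
  show "of_rat q \<in> adjoin \<gamma>" using mem[of "[:q:]"] by simp
  show "0 \<in> adjoin \<gamma>" using mem[of 0] by simp
  show "1 \<in> adjoin \<gamma>" using mem[of 1] by simp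
  show "\<gamma> \<in> adjoin \<gamma>" using mem[of "[:0, 1:]"] by simp
  show "x \<in> adjoin \<gamma> \<Longrightarrow> rat_eval p x \<in> adjoin \<gamma>"
    unfolding adjoin_def by (clarsimp) (metis rat_eval_pcompose rangeI)
qed

text \<open>After removal of factors \<open>X\<close>, a relation for \<open>z\<close> has a nonzero
  constant term and can be solved for \<open>1 / z\<close>.\<close>

lemma inverse_in_adjoin:
  fixes z :: "'k::field_char_0"
  assumes nf: "number_field TYPE('k)" and z: "z \<in> adjoin \<gamma>"
  shows "inverse z \<in> adjoin \<gamma>"
proof (cases "z = 0")
  case True
  then show ?thesis using z by simp
next
  case False
  obtain p where p: "p \<noteq> 0" "rat_eval p z = 0" using algebraic_bounded_degree[OF nf] by blast
  have "\<exists>s. rat_eval s z = inverse z"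
    using p
  proof (induction p)
    case (pCons a p)
    show ?case
    proof (cases "a = 0")
      case True
      then have "rat_eval p z = 0" using pCons.prems False by simp
      then show ?thesis using pCons True by auto
    next
      case a: False
      have "z * rat_eval p z = - of_rat a" using pCons.prems by (simp add: eq_neg_iff_add_eq_0 add.commute)
      have "z * rat_eval (Polynomial.smult (- inverse a) p) z = of_rat (- inverse a) * (z * rat_eval p z)"
        by (simp only: rat_eval_simps mult.left_commute)
      also have "\<dots> = of_rat (inverse a) * of_rat a"
        unfolding \<open>z * rat_eval p z = - of_rat a\<close> by (simp add: of_rat_minus)
      also have "\<dots> = 1" using a by (simp flip: of_rat_mult)
      finally have "inverse z = rat_eval (Polynomial.smult (- inverse a) p) z" using inverse_unique by metis
      then show ?thesis by metis
    qed
  qed simp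
  then show ?thesis using adjoin_closed(9)[OF z] by metis
qed

definition polys_over :: "'a::zero set \<Rightarrow> 'a poly set" where
  "polys_over F = {p. \<forall>i. coeff p i \<in> F}"

text \<open>Division with remainder by a polynomial of least degree over the subfield generated by
  \<open>\<gamma>\<close>. It is carried out by hand because this subfield is a set and not a
  type.\<close>

lemma minimal_divisor:
  fixes \<beta> \<gamma> :: "'k::field_char_0"
  assumes nf: "number_field TYPE('k)" and alg: "q \<noteq> 0" "q \<in> polys_over (adjoin \<gamma>)" "poly q \<beta> = 0"
  obtains h where "h \<noteq> 0" "h \<in> polys_over (adjoin \<gamma>)" "poly h \<beta> = 0"
    "\<And>p. p \<in> polys_over (adjoin \<gamma>) \<Longrightarrow> poly p \<beta> = 0 \<Longrightarrow> h dvd p"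
proof -
  define I where "I = {p. p \<noteq> 0 \<and> p \<in> polys_over (adjoin \<gamma>) \<and> poly p \<beta> = 0}"
  obtain h where h: "h \<in> I" "\<And>p. p \<in> I \<Longrightarrow> degree h \<le> degree p"
    using alg arg_min_nat_lemma[of "\<lambda>p. p \<in> I" q degree] by (auto simp: I_def)
  have "h dvd p" if "p \<in> polys_over (adjoin \<gamma>)" "poly p \<beta> = 0" for p
    using that
  proof (induction "degree p" arbitrary: p rule: less_induct)
    case less
    show ?case
    proof (cases "p = 0")
      case False
      then have dh: "degree h \<le> degree p" using h(2) less.prems by (simp add: I_def)
      have h0: "h \<noteq> 0" using h(1) by (simp add: I_def)
      define k where "k = degree p - degree h"
      define c where "c = lead_coeff p * inverse (lead_coeff h)"
      define r where "r = Polynomial.smult c (Polynomial.monom 1 k * h)"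
      have c: "c \<in> adjoin \<gamma>" unfolding c_def
        using less.prems h(1) by (intro adjoin_closed(3) inverse_in_adjoin[OF nf]) (auto simp: I_def polys_over_def)
      have c0: "c \<noteq> 0" using False h0 by (simp add: c_def)
      have "r \<in> polys_over (adjoin \<gamma>)"
        using c h(1) adjoin_closed(6) by (auto simp: r_def I_def polys_over_def coeff_monom_mult intro!: adjoin_closed(3))
      then have 1: "p - r \<in> polys_over (adjoin \<gamma>)" using less.prems by (auto simp: polys_over_def intro: adjoin_closed(2))
      have 2: "poly (p - r) \<beta> = 0" using less.prems h(1) by (simp add: r_def I_def)
      have dr: "degree r = degree p" using c0 h0 dh by (simp add: r_def degree_mult_eq degree_monom_eq k_def)
      have lr: "coeff r (degree p) = lead_coeff p"
        using h0 dh by (simp add: r_def coeff_monom_mult k_def c_def)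
      have "h dvd p - r"
      proof (cases "p - r = 0")
        case nz: False
        have "degree (p - r) \<le> degree p" using dr by (intro degree_diff_le) auto
        moreover have "degree (p - r) \<noteq> degree p"
        proof
          assume "degree (p - r) = degree p"
          moreover have "coeff (p - r) (degree p) = 0" using lr by simp
          ultimately have "lead_coeff (p - r) = 0" by metis
          then show False using nz leading_coeff_0_iff by blast
        qed
        ultimately show ?thesis using less.hyps[OF _ 1 2] by linarith
      qed simp
      moreover have "h dvd r" by (simp add: r_def dvd_smult)
      ultimately have "h dvd (p - r) + r" by (rule dvd_add)
      then show ?thesis by simp
    qed simp
  qed
  then show thesis using that[of h] h(1) by (auto simp: I_def)
qed

lemma minimal_rat_poly:
  fixes \<beta> :: "'k::field_char_0"
  assumes nf: "number_field TYPE('k)"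
  obtains g where "g \<noteq> 0" "rat_eval g \<beta> = 0" "\<And>p. p \<noteq> 0 \<Longrightarrow> rat_eval p \<beta> = 0 \<Longrightarrow> degree g \<le> degree p"
proof -
  obtain p where p: "p \<noteq> 0" "rat_eval p \<beta> = 0" using algebraic_bounded_degree[OF nf] by blast
  then show thesis using that arg_min_nat_lemma[of "\<lambda>p. p \<noteq> 0 \<and> rat_eval p \<beta> = 0" p degree] by blast
qed

lemma minimal_rat_poly_separable:
  fixes \<beta> :: "'k::field_char_0"
  assumes g: "g \<noteq> 0" "rat_eval g \<beta> = 0" "\<And>p. p \<noteq> 0 \<Longrightarrow> rat_eval p \<beta> = 0 \<Longrightarrow> degree g \<le> degree p"
  shows "rat_eval (pderiv g) \<beta> \<noteq> 0"
proof
  assume 0: "rat_eval (pderiv g) \<beta> = 0"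
  have "degree g \<noteq> 0"
  proof
    assume "degree g = 0"
    then obtain c where "g = [:c:]" by (rule degree_eq_zeroE)
    then show False using g by simp
  qed
  then have "pderiv g \<noteq> 0" "degree (pderiv g) < degree g" by (auto simp: pderiv_eq_0_iff degree_pderiv)
  then show False using g(3)[OF _ 0] by simp
qed

text \<open>For \<open>\<gamma> = \<alpha> + n * \<beta>\<close>, a least polynomial
  \<open>h\<close> of \<open>\<beta>\<close> over the field generated by \<open>\<gamma>\<close>
  divides both \<open>g\<close> and the polynomial \<open>f\<close> taken at
  \<open>\<gamma> - n * X\<close>. For suitable \<open>n\<close> these share only the simple root
  \<open>\<beta>\<close>, so \<open>h\<close> is linear and its coefficients express
  \<open>\<beta>\<close>.\<close>

lemma simple_extension_of_two:
  fixes \<alpha> \<beta> :: "'k::field_char_0"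
  assumes nf: "number_field TYPE('k)"
  shows "\<exists>\<gamma>. \<alpha> \<in> adjoin \<gamma> \<and> \<beta> \<in> adjoin \<gamma>"
proof -
  obtain f where f: "f \<noteq> 0" "rat_eval f \<alpha> = 0" using algebraic_bounded_degree[OF nf] by blast
  obtain g where g: "g \<noteq> 0" "rat_eval g \<beta> = 0" "\<And>p. p \<noteq> 0 \<Longrightarrow> rat_eval p \<beta> = 0 \<Longrightarrow> degree g \<le> degree p"
    using minimal_rat_poly[OF nf] by metis
  define fK where "fK = (map_poly of_rat f :: 'k poly)"
  define gK where "gK = (map_poly of_rat g :: 'k poly)"
  define A where "A = {a. poly (map_poly to_ac fK) a = 0}"
  define B where "B = {b. poly (map_poly to_ac gK) b = 0}"
  have fin: "finite A" "finite B"
    unfolding A_def B_def fK_def gK_def using f(1) g(1) by (intro poly_roots_finite; simp)+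
  \<comment> \<open>These are the values of \<open>n\<close> for which
    \<open>\<gamma> - n * b\<close> is a root of \<open>f\<close> for another root \<open>b\<close>
    of \<open>g\<close>. For \<open>b = to_ac \<beta>\<close> division by 0 merely adds the element
    0.\<close>
  define bad where "bad = (\<lambda>(a, b). (a - to_ac \<alpha>) / (to_ac \<beta> - b)) ` (A \<times> B)"
  have "finite bad" using fin by (simp add: bad_def)
  moreover have "infinite (range (of_nat :: nat \<Rightarrow> 'k alg_closure))"
  proof
    assume "finite (range (of_nat :: nat \<Rightarrow> 'k alg_closure))"
    moreover have "inj (of_nat :: nat \<Rightarrow> 'k alg_closure)" by (rule injI) (simp only: of_nat_eq_iff)
    ultimately have "finite (UNIV :: nat set)" by (rule finite_imageD)
    then show False by simp
  qed
  ultimately have "\<not> range (of_nat :: nat \<Rightarrow> 'k alg_closure) \<subseteq> bad"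
    using finite_subset by blast
  then obtain n :: nat where n: "(of_nat n :: 'k alg_closure) \<notin> bad" by auto
  define \<gamma> where "\<gamma> = \<alpha> + of_nat n * \<beta>"
  have n_in: "of_nat n \<in> adjoin \<gamma>" using adjoin_closed(5)[of "of_nat n" \<gamma>] by simp
  have g_over: "gK \<in> polys_over (adjoin \<gamma>)" by (simp add: gK_def polys_over_def adjoin_closed)
  have comp: "p \<circ>\<^sub>p [:\<gamma>, - of_nat n:] \<in> polys_over (adjoin \<gamma>)" if "p \<in> polys_over (adjoin \<gamma>)" for p
    using that
  proof (induction p)
    case (pCons a p)
    have "coeff (pCons a p) 0 \<in> adjoin \<gamma>" "\<And>i. coeff (pCons a p) (Suc i) \<in> adjoin \<gamma>"
      using pCons.prems unfolding polys_over_def by blast+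
    then have a: "a \<in> adjoin \<gamma>" and p: "p \<in> polys_over (adjoin \<gamma>)" by (auto simp: polys_over_def)
    have q: "coeff (p \<circ>\<^sub>p [:\<gamma>, - of_nat n:]) i \<in> adjoin \<gamma>" for i using pCons.IH[OF p] by (simp add: polys_over_def)
    show ?case
      unfolding polys_over_def pcompose_pCons mem_Collect_eq
      using a q n_in by (auto simp: coeff_pCons adjoin_closed split: nat.split)
  qed (simp add: polys_over_def adjoin_closed)
  define fc where "fc = fK \<circ>\<^sub>p [:\<gamma>, - of_nat n:]"
  have fc: "fc \<in> polys_over (adjoin \<gamma>)"
    unfolding fc_def by (rule comp) (simp add: fK_def polys_over_def adjoin_closed)
  have fc0: "poly fc \<beta> = 0"
    using f(2) by (simp add: fc_def poly_pcompose \<gamma>_def fK_def rat_eval_def mult.commute)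
  have g0: "poly gK \<beta> = 0" "gK \<noteq> 0" using g by (simp_all add: gK_def rat_eval_def)
  obtain h where h: "h \<noteq> 0" "h \<in> polys_over (adjoin \<gamma>)" "poly h \<beta> = 0"
    and hd: "\<And>p. p \<in> polys_over (adjoin \<gamma>) \<Longrightarrow> poly p \<beta> = 0 \<Longrightarrow> h dvd p"
    using minimal_divisor[OF nf g0(2) g_over g0(1)] by metis
  have hg: "h dvd gK" and hf: "h dvd fc" using hd g_over g0 fc fc0 by auto
  have "degree h = 1"
  proof (rule ccontr)
    assume d: "degree h \<noteq> 1"
    define hL where "hL = map_poly to_ac h"
    obtain u where u: "hL = [:- to_ac \<beta>, 1:] * u"
    proof -
      have "poly hL (to_ac \<beta>) = 0" using h(3) by (simp add: hL_def)
      then show thesis using that poly_eq_0_iff_dvd by (metis dvdE)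
    qed
    have hL0: "hL \<noteq> 0" using h(1) by (simp add: hL_def)
    then have u0: "u \<noteq> 0" using u by auto
    have "degree hL = Suc (degree u)" unfolding u using u0 by (subst degree_mult_eq) auto
    moreover have "degree hL = degree h" by (simp add: hL_def)
    ultimately have "degree u > 0" using d by simp
    then obtain b where b: "poly u b = 0" using alg_closed_imp_poly_has_root by blast
    have hgL: "hL dvd map_poly to_ac gK" and hfL: "hL dvd map_poly to_ac fc"
      unfolding hL_def using hg hf by (auto simp: hom_distribs elim!: dvdE)
    have bg: "poly (map_poly to_ac gK) b = 0" and bf: "poly (map_poly to_ac fc) b = 0"
      using hgL hfL b unfolding u by (auto elim!: dvdE)
    show False
    \<comment> \<open>A second root of \<open>h\<close> is either \<open>\<beta>\<close> again,
      against the separability of \<open>g\<close>, or it makes \<open>n\<close> a bad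
      value.\<close>
    proof (cases "b = to_ac \<beta>")
      case True
      then obtain w where "u = [:- to_ac \<beta>, 1:] * w" using b poly_eq_0_iff_dvd by (metis dvdE)
      then obtain w' where w': "map_poly to_ac gK = [:- to_ac \<beta>, 1:] * ([:- to_ac \<beta>, 1:] * w')"
        using hgL unfolding u by (metis dvdE mult.assoc)
      have "poly (pderiv (map_poly to_ac gK)) (to_ac \<beta>) = 0"
        unfolding w' pderiv_mult[of "[:- to_ac \<beta>, 1:]"] by (simp add: pderiv_pCons)
      then have "poly (pderiv gK) \<beta> = 0" by (simp flip: to_ac_hom.map_poly_pderiv)
      then have "rat_eval (pderiv g) \<beta> = 0" by (simp add: gK_def rat_eval_def of_rat_hom.map_poly_pderiv)
      then show False using minimal_rat_poly_separable[OF g] by blast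
    next
      case False
      define a where "a = to_ac \<gamma> - of_nat n * b"
      have "poly (map_poly to_ac fK) a = 0"
        using bf by (simp add: fc_def a_def to_ac_hom.map_poly_pcompose poly_pcompose hom_distribs mult.commute)
      then have "(a - to_ac \<alpha>) / (to_ac \<beta> - b) \<in> bad"
        unfolding bad_def using bg by (intro image_eqI[of _ _ "(a, b)"]) (auto simp: A_def B_def)
      moreover have "a - to_ac \<alpha> = of_nat n * (to_ac \<beta> - b)"
        by (simp add: a_def \<gamma>_def algebra_simps)
      ultimately show False using n False by simp
    qed
  qed
  then obtain h0 h1 where h01: "h = [:h0, h1:]" "h1 \<noteq> 0"
    by (metis One_nat_def degree_eq_zeroE degree_pCons_eq_if nat.distinct(1) nat.inject pCons_cases pCons_eq_0_iff)
  have "coeff h 0 \<in> adjoin \<gamma>" "coeff h 1 \<in> adjoin \<gamma>" using h(2) unfolding polys_over_def by blast+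
  then have hh: "h0 \<in> adjoin \<gamma>" "h1 \<in> adjoin \<gamma>" by (auto simp: h01)
  have "\<beta> = - h0 * inverse h1" using h(3) h01 by (simp add: field_simps add_eq_0_iff)
  then have b: "\<beta> \<in> adjoin \<gamma>" using hh by (auto intro!: adjoin_closed inverse_in_adjoin[OF nf])
  have "\<alpha> = \<gamma> - of_nat n * \<beta>" by (simp add: \<gamma>_def)
  then have "\<alpha> \<in> adjoin \<gamma>" using adjoin_closed(2,3,8) b n_in by metis
  with b show ?thesis by blast
qed

theorem primitive_element:
  assumes nf: "number_field TYPE('k::field_char_0)"
  shows "\<exists>\<theta>::'k. adjoin \<theta> = UNIV"
proof -
  obtain B :: "'k set" where B: "finite B" "rat_vs.span B = UNIV"
    using nf by (auto simp: number_field_def)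
  have "\<exists>\<theta>. C \<subseteq> adjoin \<theta>" if "finite C" for C :: "'k set"
    using that
  proof (induction C rule: finite_induct)
    case (insert x C)
    then obtain \<theta> where \<theta>: "C \<subseteq> adjoin \<theta>" by blast
    obtain \<gamma> where \<gamma>: "x \<in> adjoin \<gamma>" "\<theta> \<in> adjoin \<gamma>" using simple_extension_of_two[OF nf] by blast
    have "adjoin \<theta> \<subseteq> adjoin \<gamma>" using adjoin_closed(9)[OF \<gamma>(2)] by (auto simp: adjoin_def)
    then show ?case using \<theta> \<gamma> by blast
  qed simp
  then obtain \<theta> where \<theta>: "B \<subseteq> adjoin \<theta>" using B by blast
  have "rat_vs.subspace (adjoin \<theta>)"
    by (auto simp: rat_vs.subspace_def rat_scale_def intro: adjoin_closed)
  then have "rat_vs.span B \<subseteq> adjoin \<theta>" using \<theta> by (rule rat_vs.span_minimal[rotated])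
  then show ?thesis using B by auto
qed

section \<open>Absolute values above a prime\<close>

definition padic :: "nat \<Rightarrow> rat \<Rightarrow> real" where
  "padic p q = (if q = 0 then 0 else
     real p powi (int (multiplicity (int p) (snd (quotient_of q))) - int (multiplicity (int p) (fst (quotient_of q)))))"

context
  fixes p :: nat
  assumes p: "prime p"
begin

lemma padic_of_fraction:
  assumes "a \<noteq> 0" "b \<noteq> 0"
  shows "padic p (of_int a / of_int b) = real p powi (int (multiplicity (int p) b) - int (multiplicity (int p) a))"
proof -
  define q :: rat where "q = of_int a / of_int b"
  obtain c d where cd: "quotient_of q = (c, d)" by fastforce
  have d: "d > 0" using quotient_of_denom_pos[OF cd] .
  have q: "q = of_int c / of_int d" using quotient_of_div[OF cd] .
  have q0: "q \<noteq> 0" using assms by (simp add: q_def)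
  then have c0: "c \<noteq> 0" using q by auto
  have "(of_int a * of_int d :: rat) = of_int c * of_int b"
    using q q_def d assms by (simp add: divide_simps)
  then have "(of_int (a * d) :: rat) = of_int (c * b)" by simp
  then have "a * d = c * b" by (simp only: of_int_eq_iff)
  then have "multiplicity (int p) (a * d) = multiplicity (int p) (c * b)" by simp
  then have "multiplicity (int p) a + multiplicity (int p) d = multiplicity (int p) c + multiplicity (int p) b"
    using p assms c0 d by (simp add: prime_elem_multiplicity_mult_distrib)
  then have "int (multiplicity (int p) d) - int (multiplicity (int p) c) = int (multiplicity (int p) b) - int (multiplicity (int p) a)"
    by linarith
  then show ?thesis using q0 cd unfolding q_def[symmetric] by (simp add: padic_def)
qed

lemma padic_mult_norm: "mult_norm (padic p)"
  unfolding mult_norm_def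
proof (intro conjI allI)
  have p0: "real p > 0" using p by (simp add: prime_gt_0_nat)
  fix x y :: rat
  show "0 \<le> padic p x" using p0 by (simp add: padic_def)
  show "padic p x = 0 \<longleftrightarrow> x = 0" using p0 by (simp add: padic_def power_int_not_zero)
  show "padic p (x * y) = padic p x * padic p y"
  proof (cases "x = 0 \<or> y = 0")
    case False
    obtain a b where ab: "x = of_int a / of_int b" "b \<noteq> 0" by (metis Fract_of_int_quotient Rat_cases less_irrefl)
    obtain c d where cd: "y = of_int c / of_int d" "d \<noteq> 0" by (metis Fract_of_int_quotient Rat_cases less_irrefl)
    have nz: "a \<noteq> 0" "c \<noteq> 0" using False ab cd by auto
    have "x * y = of_int (a * c) / of_int (b * d)" by (simp add: ab cd)
    then have "padic p (x * y) = real p powi (int (multiplicity (int p) (b * d)) - int (multiplicity (int p) (a * c)))"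
      using padic_of_fraction[of "a * c" "b * d"] nz ab cd by simp
    also have "\<dots> = real p powi ((int (multiplicity (int p) b) - int (multiplicity (int p) a)) + (int (multiplicity (int p) d) - int (multiplicity (int p) c)))"
      using p nz ab cd by (simp add: prime_elem_multiplicity_mult_distrib algebra_simps)
    also have "\<dots> = padic p x * padic p y"
      unfolding ab(1) cd(1) padic_of_fraction[OF nz(1) ab(2)] padic_of_fraction[OF nz(2) cd(2)]
      using p0 by (intro power_int_add) auto
    finally show ?thesis .
  qed (auto simp: padic_def)
qed

lemma padic_of_int:
  "a \<noteq> 0 \<Longrightarrow> padic p (of_int a) = real p powi (- int (multiplicity (int p) a))"
  using padic_of_fraction[of a 1] by simp

lemma padic_prime: "padic p (of_nat p) = 1 / real p"
  using padic_of_int[of "int p"] p prime_gt_0_nat[OF p] by (simp add: power_int_minus field_simps)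

lemma padic_of_int_le_1: "padic p (of_int a) \<le> 1"
proof (cases "a = 0")
  case False
  have "real p powi (- int (multiplicity (int p) a)) \<le> real p powi 0"
    using p prime_ge_1_nat[OF p] by (intro power_int_increasing) auto
  then show ?thesis using padic_of_int[OF False] by simp
qed (simp add: padic_def)

lemma padic_of_int_eq_1: "\<not> int p dvd a \<Longrightarrow> padic p (of_int a) = 1"
  using padic_of_int[of a] by (cases "a = 0") (auto simp: not_dvd_imp_multiplicity_0)

lemma padic_le_oneD:
  assumes "padic p q \<le> 1" "q \<noteq> 0"
  obtains a b where "q = of_int a / of_int b" "\<not> int p dvd b" "b \<noteq> 0"
proof -
  obtain a b where ab: "quotient_of q = (a, b)" by fastforce
  have cop: "coprime a b" using quotient_of_coprime[OF ab] .
  have b: "b > 0" using quotient_of_denom_pos[OF ab] .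
  have q: "q = of_int a / of_int b" using quotient_of_div[OF ab] .
  have "\<not> int p dvd b"
  proof
    assume d: "int p dvd b"
    have pi: "prime (int p)" using p by simp
    then have na: "\<not> int p dvd a" using cop d by (meson coprime_common_divisor not_prime_unit)
    have a0: "a \<noteq> 0" using assms(2) q by auto
    have "multiplicity (int p) b \<ge> 1" using d b pi by (intro multiplicity_geI) (auto simp: prime_gt_1_int)
    then have "real p powi 1 \<le> real p powi (int (multiplicity (int p) b) - int (multiplicity (int p) a))"
      using p prime_ge_1_nat[OF p] na by (intro power_int_increasing) (auto simp: not_dvd_imp_multiplicity_0)
    then have "real p \<le> padic p q" using padic_of_fraction[OF a0, of b] b q by simp
    moreover have "real p > 1" using prime_gt_1_nat[OF p] by simp
    ultimately show False using assms(1) by linarith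
  qed
  then show thesis using that q b by auto
qed

lemma padic_ultrametric: "ultrametric (padic p)"
proof -
  have one: "padic p (1 + x) \<le> 1" if x: "padic p x \<le> 1" for x
  proof (cases "x = 0")
    case True
    then show ?thesis using padic_of_int_le_1[of 1] by simp
  next
    case False
    then obtain a b where ab: "x = of_int a / of_int b" "\<not> int p dvd b" "b \<noteq> 0" using padic_le_oneD[OF x] by blast
    then have "1 + x = of_int (b + a) / of_int b" by (simp add: field_simps)
    then have "padic p (1 + x) = padic p (of_int (b + a)) / padic p (of_int b)"
      using mult_norm_divide[OF padic_mult_norm] by metis
    then show ?thesis using padic_of_int_le_1[of "b + a"] padic_of_int_eq_1[OF ab(2)] by simp
  qed
  have *: "padic p (x + y) \<le> padic p y" if "padic p x \<le> padic p y" for x y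
  proof (cases "y = 0")
    case True
    then show ?thesis using that by simp
  next
    case False
    have e: "x + y = y * (1 + x / y)" using False by (simp add: field_simps)
    have "padic p (x / y) \<le> 1"
      using that mult_norm_pos[OF padic_mult_norm False] by (simp add: mult_norm_divide[OF padic_mult_norm])
    then have "padic p y * padic p (1 + x / y) \<le> padic p y * 1"
      using one mult_norm_nonneg[OF padic_mult_norm] by (intro mult_left_mono) auto
    then show ?thesis unfolding e mult_norm_mult[OF padic_mult_norm] by simp
  qed
  show ?thesis
    unfolding ultrametric_def using *[of _ _] *[of _ _] by (metis add.commute le_max_iff_disj linear max.cobounded1 max.cobounded2 order_trans)
qed

end

lemma ultra_sum_less:
  assumes N: "mult_norm N" "ultrametric N" and "\<And>j. j \<in> B \<Longrightarrow> N (f j) < b" "0 < b"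
  shows "N (\<Sum>j\<in>B. f j) < b"
  using assms(3)
proof (induction B rule: infinite_finite_induct)
  case (insert x F)
  then have "N (f x) < b" "N (sum f F) < b" by auto
  then show ?case using insert.hyps ultra_add[OF N, of "f x" "sum f F"] by simp
qed (use assms(4) mult_norm_0[OF N(1)] in auto)

text \<open>A term of strictly largest norm could not be cancelled by the others.\<close>

lemma ultrametric_tie:
  assumes N: "mult_norm N" "ultrametric N" and A: "finite A" "\<exists>i\<in>A. f i \<noteq> 0" "(\<Sum>i\<in>A. f i) = 0"
  shows "\<exists>i\<in>A. \<exists>j\<in>A. i \<noteq> j \<and> f i \<noteq> 0 \<and> f j \<noteq> 0 \<and> N (f i) = N (f j)"
proof -
  have "Max ((\<lambda>i. N (f i)) ` A) \<in> (\<lambda>i. N (f i)) ` A" using A(1,2) by (intro Max_in) auto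
  then obtain i where i0: "i \<in> A" "N (f i) = Max ((\<lambda>i. N (f i)) ` A)" by auto
  then have i: "i \<in> A" "\<And>j. j \<in> A \<Longrightarrow> N (f j) \<le> N (f i)" using A(1) by auto
  have nz: "f i \<noteq> 0"
  proof
    assume "f i = 0"
    then have "N (f j) \<le> 0" if "j \<in> A" for j using i(2)[OF that] mult_norm_0[OF N(1)] by simp
    then have "f j = 0" if "j \<in> A" for j
      using that mult_norm_nonneg[OF N(1)] mult_norm_eq_0[OF N(1)] by (metis order_antisym)
    then show False using A(2) by blast
  qed
  show ?thesis
  proof (rule ccontr)
    assume no: "\<not> ?thesis"
    have lt: "N (f j) < N (f i)" if "j \<in> A - {i}" for j
    proof (cases "f j = 0")
      case True
      then show ?thesis using mult_norm_pos[OF N(1) nz] mult_norm_0[OF N(1)] by simp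
    next
      case False
      then have "N (f i) \<noteq> N (f j)" using no i(1) nz that by auto
      then show ?thesis using i(2)[of j] that by auto
    qed
    have "N (\<Sum>j\<in>A - {i}. f j) < N (f i)"
      using ultra_sum_less[OF N lt mult_norm_pos[OF N(1) nz]] .
    moreover have "f i = - (\<Sum>j\<in>A - {i}. f j)"
      using A(1,3) i(1) by (simp add: sum.remove eq_neg_iff_add_eq_0)
    ultimately show False using mult_norm_minus[OF N(1)] by (metis less_irrefl)
  qed
qed

text \<open>
  Chevalley's argument: a subring maximal among those in which \<open>p\<close> and \<open>y\<close> generate a proper
  ideal is a valuation ring.
\<close>

definition subring_set :: "'a::comm_ring_1 set \<Rightarrow> bool" where
  "subring_set B \<longleftrightarrow> 1 \<in> B \<and> (\<forall>x\<in>B. \<forall>y\<in>B. x - y \<in> B) \<and> (\<forall>x\<in>B. \<forall>y\<in>B. x * y \<in> B)"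

lemma subring_set_closed:
  assumes "subring_set B"
  shows "1 \<in> B" "0 \<in> B" "x \<in> B \<Longrightarrow> y \<in> B \<Longrightarrow> x - y \<in> B" "x \<in> B \<Longrightarrow> y \<in> B \<Longrightarrow> x * y \<in> B"
    "x \<in> B \<Longrightarrow> - x \<in> B" "x \<in> B \<Longrightarrow> y \<in> B \<Longrightarrow> x + y \<in> B" "x \<in> B \<Longrightarrow> x ^ n \<in> B" "of_nat n \<in> B" "of_int k \<in> B"
    "(\<And>i. i \<in> A \<Longrightarrow> f i \<in> B) \<Longrightarrow> (\<Sum>i\<in>A. f i) \<in> B"
proof -
  note s = assms[unfolded subring_set_def]
  show 1: "1 \<in> B" using s by blast
  show d: "x - y \<in> B" if "x \<in> B" "y \<in> B" for x y using s that by blast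
  show m: "x * y \<in> B" if "x \<in> B" "y \<in> B" for x y using s that by blast
  show z: "0 \<in> B" using d[OF 1 1] by simp
  show n: "- x \<in> B" if "x \<in> B" for x using d[OF z that] by simp
  show a: "x + y \<in> B" if "x \<in> B" "y \<in> B" for x y using d[OF that(1) n[OF that(2)]] by simp
  show "x ^ n \<in> B" if "x \<in> B" by (induction n) (auto simp: 1 m that)
  show o: "of_nat n \<in> B" for n by (induction n) (auto simp: z 1 a)
  show "of_int k \<in> B" by (cases k rule: int_cases2) (auto simp: o n)
  show "(\<Sum>i\<in>A. f i) \<in> B" if "\<And>i. i \<in> A \<Longrightarrow> f i \<in> B"
    using that by (induction A rule: infinite_finite_induct) (auto simp: z a)
qed

definition two_gen :: "'a::comm_ring_1 \<Rightarrow> 'a \<Rightarrow> 'a set \<Rightarrow> 'a set" where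
  "two_gen p y B = {p * b + y * c | b c. b \<in> B \<and> c \<in> B}"

lemma two_gen_ideal:
  assumes B: "subring_set B"
  shows "0 \<in> two_gen p y B" "u \<in> two_gen p y B \<Longrightarrow> v \<in> two_gen p y B \<Longrightarrow> u + v \<in> two_gen p y B"
    "u \<in> two_gen p y B \<Longrightarrow> v \<in> two_gen p y B \<Longrightarrow> u - v \<in> two_gen p y B"
    "u \<in> two_gen p y B \<Longrightarrow> b \<in> B \<Longrightarrow> b * u \<in> two_gen p y B"
    "(\<And>i. i \<in> A \<Longrightarrow> f i \<in> two_gen p y B) \<Longrightarrow> (\<Sum>i\<in>A. f i) \<in> two_gen p y B"
proof -
  have "p * 0 + y * 0 \<in> two_gen p y B" unfolding two_gen_def using subring_set_closed(2)[OF B] by blast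
  then show z: "0 \<in> two_gen p y B" by simp
  show a: "u + v \<in> two_gen p y B" if "u \<in> two_gen p y B" "v \<in> two_gen p y B" for u v
  proof -
    obtain b c b' c' where "u = p * b + y * c" "v = p * b' + y * c'" "b \<in> B" "c \<in> B" "b' \<in> B" "c' \<in> B"
      using \<open>u \<in> _\<close> \<open>v \<in> _\<close> by (auto simp: two_gen_def)
    moreover from this have "u + v = p * (b + b') + y * (c + c')" by (simp add: algebra_simps)
    ultimately show ?thesis unfolding two_gen_def using subring_set_closed(6)[OF B] by blast
  qed
  show m: "b * u \<in> two_gen p y B" if "u \<in> two_gen p y B" "b \<in> B" for u b
  proof -
    obtain c d where "u = p * c + y * d" "c \<in> B" "d \<in> B"
      using \<open>u \<in> _\<close> by (auto simp: two_gen_def)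
    moreover from this have "b * u = p * (b * c) + y * (b * d)" by (simp add: algebra_simps)
    ultimately show ?thesis unfolding two_gen_def using subring_set_closed(4)[OF B \<open>b \<in> B\<close>] by blast
  qed
  show "u - v \<in> two_gen p y B" if "u \<in> two_gen p y B" "v \<in> two_gen p y B"
    using a[OF that(1) m[OF that(2) subring_set_closed(5)[OF B subring_set_closed(1)[OF B]]]] by simp
  show "(\<Sum>i\<in>A. f i) \<in> two_gen p y B" if "\<And>i. i \<in> A \<Longrightarrow> f i \<in> two_gen p y B"
    using that by (induction A rule: infinite_finite_induct) (auto simp: z a)
qed

definition adjoin_set :: "'a::comm_ring_1 set \<Rightarrow> 'a \<Rightarrow> 'a set" where
  "adjoin_set B z = (\<lambda>f. poly f z) ` polys_over B"

lemma adjoin_set_subring: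
  assumes B: "subring_set B"
  shows "subring_set (adjoin_set B z)" "B \<subseteq> adjoin_set B z" "z \<in> adjoin_set B z"
proof -
  note c = subring_set_closed[OF B]
  have mem: "poly f z \<in> adjoin_set B z" if "f \<in> polys_over B" for f using that by (simp add: adjoin_set_def)
  show b: "B \<subseteq> adjoin_set B z"
  proof
    fix b assume "b \<in> B"
    then have "[:b:] \<in> polys_over B" using c by (auto simp: polys_over_def coeff_pCons split: nat.split)
    from mem[OF this] show "b \<in> adjoin_set B z" by simp
  qed
  have "[:0, 1:] \<in> polys_over B" using c by (auto simp: polys_over_def coeff_pCons split: nat.split)
  from mem[OF this] show "z \<in> adjoin_set B z" by simp
  show "subring_set (adjoin_set B z)"
    unfolding subring_set_def
  proof (intro conjI ballI)
    show "1 \<in> adjoin_set B z" using b c by blast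
    fix u v assume "u \<in> adjoin_set B z" "v \<in> adjoin_set B z"
    then obtain f g where fg: "f \<in> polys_over B" "g \<in> polys_over B" "u = poly f z" "v = poly g z"
      by (auto simp: adjoin_set_def)
    have "f - g \<in> polys_over B" using fg c by (auto simp: polys_over_def)
    from mem[OF this] show "u - v \<in> adjoin_set B z" using fg by simp
    have "f * g \<in> polys_over B"
      using fg(1,2) by (auto simp: polys_over_def coeff_mult intro!: subring_set_closed(10)[OF B] subring_set_closed(4)[OF B])
    from mem[OF this] show "u * v \<in> adjoin_set B z" using fg by simp
  qed
qed

lemma two_gen_adjoin:
  assumes B: "subring_set B" and u: "u \<in> two_gen p y (adjoin_set B z)"
  shows "\<exists>f \<in> polys_over (two_gen p y B). poly f z = u"
proof -
  obtain f g where fg: "f \<in> polys_over B" "g \<in> polys_over B" "u = p * poly f z + y * poly g z"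
    using u by (auto simp: two_gen_def adjoin_set_def)
  have "Polynomial.smult p f + Polynomial.smult y g \<in> polys_over (two_gen p y B)"
    using fg by (auto simp: polys_over_def two_gen_def)
  moreover have "poly (Polynomial.smult p f + Polynomial.smult y g) z = u" using fg by simp
  ultimately show ?thesis by blast
qed

text \<open>Multiplied by \<open>z ^ n\<close>, the relation for \<open>1 / z\<close> reads
  \<open>(1 - b 0) * z ^ n = poly G z\<close> with lower powers on the right. Multiplying the
  relation for \<open>z\<close> by \<open>1 - b 0\<close> and substituting this removes the leading
  term; adding \<open>b 0\<close> restores the value 1 and keeps the coefficients in the
  ideal.\<close>

lemma relation_reduction:
  fixes z :: "'a::field"
  assumes B: "subring_set B" and z: "z \<noteq> 0" and one: "1 \<notin> two_gen p y B"
    and f: "f \<in> polys_over (two_gen p y B)" "poly f z = 1"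
    and g: "g \<in> polys_over (two_gen p y B)" "poly g (inverse z) = 1"
    and le: "degree g \<le> degree f" and sub: "two_gen p y B \<subseteq> B"
  shows "\<exists>h \<in> polys_over (two_gen p y B). poly h z = 1 \<and> degree h < degree f"
proof -
  define I where "I = two_gen p y B"
  note i = two_gen_ideal[OF B, where p = p and y = y, folded I_def]
  define n where "n = degree f"
  define k where "k = degree g"
  define a where "a = coeff f n"
  define b where "b j = coeff g j" for j
  have aI: "a \<in> I" using f by (simp add: a_def I_def polys_over_def)
  have bI: "b j \<in> I" for j using g by (simp add: b_def I_def polys_over_def)
  have bB: "b j \<in> B" for j using bI sub by (auto simp: I_def)
  have n0: "n \<noteq> 0"
  proof
    assume "n = 0"
    then obtain c where "f = [:c:]" unfolding n_def by (rule degree_eq_zeroE)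
    then have "f = [:1:]" using f(2) by simp
    then have "coeff f 0 = 1" by simp
    then show False using f(1) one unfolding polys_over_def by (metis mem_Collect_eq)
  qed
  define f0 where "f0 = f - Polynomial.monom a n"
  define G where "G = (\<Sum>j=1..k. Polynomial.monom (b j) (n - j))"
  define h where "h = [:b 0:] + Polynomial.smult (1 - b 0) f0 + Polynomial.smult a G"
  have "poly g (inverse z) = (\<Sum>j\<le>k. b j * inverse z ^ j)" by (simp add: poly_altdef k_def b_def)
  then have gz: "(\<Sum>j\<le>k. b j * inverse z ^ j) = 1" using g(2) by simp
  have Gz: "poly G z = (1 - b 0) * z ^ n"
  proof -
    have "poly G z = (\<Sum>j=1..k. b j * z ^ (n - j))" by (simp add: G_def poly_sum poly_monom)
    also have "\<dots> = (\<Sum>j=1..k. (b j * inverse z ^ j) * z ^ n)"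
    proof (intro sum.cong refl)
      fix j assume "j \<in> {1..k}"
      then have "j \<le> n" using le by (simp add: n_def k_def)
      then have "z ^ n = z ^ j * z ^ (n - j)" by (simp flip: power_add)
      then show "b j * z ^ (n - j) = (b j * inverse z ^ j) * z ^ n" using z by (simp add: power_inverse)
    qed
    also have "\<dots> = (\<Sum>j=1..k. b j * inverse z ^ j) * z ^ n" by (simp add: sum_distrib_right)
    also have "(\<Sum>j=1..k. b j * inverse z ^ j) = 1 - b 0"
    proof -
      have "{..k} = insert 0 {1..k}" by auto
      then have "(\<Sum>j\<le>k. b j * inverse z ^ j) = b 0 + (\<Sum>j=1..k. b j * inverse z ^ j)" by simp
      then show ?thesis using gz by (simp add: algebra_simps)
    qed
    finally show ?thesis .
  qed
  have f0z: "poly f0 z = 1 - a * z ^ n" using f(2) by (simp add: f0_def poly_monom)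
  have hz: "poly h z = 1" unfolding h_def by (simp add: Gz f0z) (simp add: algebra_simps)
  have f0: "coeff f0 j \<in> I" for j
    using f(1) i(1) by (auto simp: f0_def a_def I_def[symmetric] polys_over_def)
  have G: "coeff G j \<in> I" for j
    unfolding G_def coeff_sum using bI i(1) by (intro i(5)) auto
  have "coeff [:b 0:] j \<in> I" for j using bI i(1) by (auto simp: coeff_pCons split: nat.split)
  moreover have "(1 - b 0) * coeff f0 j \<in> I" for j
    by (intro i(4) f0 subring_set_closed(3)[OF B] subring_set_closed(1)[OF B] bB)
  moreover have "a * coeff G j \<in> I" for j
    using aI sub by (intro i(4) G) (auto simp: I_def)
  ultimately have hI: "h \<in> polys_over I"
    unfolding h_def polys_over_def by (auto intro!: i(2))
  have "degree h < n"
  proof -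
    have "degree f0 \<le> n - 1"
    proof (rule degree_le, intro allI impI)
      fix j assume "n - 1 < j"
      then show "coeff f0 j = 0" using n0 by (cases "j = n") (auto simp: f0_def a_def n_def coeff_eq_0)
    qed
    moreover have "degree G \<le> n - 1" unfolding G_def
    proof (rule degree_sum_le)
      fix j assume "j \<in> {1..k}"
      then show "degree (Polynomial.monom (b j) (n - j)) \<le> n - 1"
        by (intro order_trans[OF degree_monom_le]) auto
    qed simp
    ultimately have "degree h \<le> n - 1" unfolding h_def
      by (intro degree_add_le) (auto intro: order_trans[OF degree_smult_le])
    then show ?thesis using n0 by simp
  qed
  then show ?thesis using hI hz by (auto simp: I_def n_def)
qed

lemma valuation_ring_exists:
  fixes y :: "'a::field"
  assumes B0: "subring_set B0" "p \<in> B0" "y \<in> B0" and no: "1 \<notin> two_gen p y B0"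
  obtains B where "subring_set B" "B0 \<subseteq> B" "1 \<notin> two_gen p y B" "\<And>z. z \<noteq> 0 \<Longrightarrow> z \<in> B \<or> inverse z \<in> B"
proof -
  define S where "S = {B. subring_set B \<and> B0 \<subseteq> B \<and> 1 \<notin> two_gen p y B}"
  have "\<exists>M\<in>S. \<forall>Z\<in>S. M \<subseteq> Z \<longrightarrow> Z = M"
  proof (rule subset_Zorn_nonempty)
    show "S \<noteq> {}" using B0 no by (auto simp: S_def)
    fix C assume C: "C \<noteq> {}" "subset.chain S C"
    have two: "\<exists>Z\<in>C. u \<in> Z \<and> v \<in> Z" if uv: "u \<in> \<Union>C" "v \<in> \<Union>C" for u v
    proof -
      obtain Z Y where XY: "Z \<in> C" "Y \<in> C" "u \<in> Z" "v \<in> Y" using uv by blast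
      then have "Z \<subseteq> Y \<or> Y \<subseteq> Z" using C(2) unfolding subset_chain_def by blast
      then show ?thesis using XY by blast
    qed
    have mem: "Z \<in> S" if "Z \<in> C" for Z using C(2) that unfolding subset_chain_def by blast
    have "subring_set (\<Union>C)"
      unfolding subring_set_def
    proof (intro conjI ballI)
      show "1 \<in> \<Union>C" using C(1) mem by (auto simp: S_def subring_set_def)
      fix u v assume "u \<in> \<Union>C" "v \<in> \<Union>C"
      then obtain Z where "Z \<in> C" "u \<in> Z" "v \<in> Z" using two by blast
      moreover from this have "u - v \<in> Z" "u * v \<in> Z" using mem[of Z] by (auto simp: S_def subring_set_def)
      ultimately show "u - v \<in> \<Union>C" "u * v \<in> \<Union>C" by blast+
    qed
    moreover have "B0 \<subseteq> \<Union>C" using C(1) mem by (auto simp: S_def)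
    moreover have "1 \<notin> two_gen p y (\<Union>C)"
    proof
      assume "1 \<in> two_gen p y (\<Union>C)"
      then obtain b c where bc: "1 = p * b + y * c" "b \<in> \<Union>C" "c \<in> \<Union>C" unfolding two_gen_def by blast
      then obtain Z where Z: "Z \<in> C" "b \<in> Z" "c \<in> Z" using two by blast
      then have "1 \<in> two_gen p y Z" unfolding two_gen_def using bc(1) by blast
      then show False using mem[OF Z(1)] by (simp add: S_def)
    qed
    ultimately show "\<Union>C \<in> S" by (simp add: S_def)
  qed
  then obtain B where B: "B \<in> S" and max: "\<And>Z. Z \<in> S \<Longrightarrow> B \<subseteq> Z \<Longrightarrow> Z = B" by blast
  have sB: "subring_set B" and B0B: "B0 \<subseteq> B" and one: "1 \<notin> two_gen p y B" using B by (auto simp: S_def)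
  define I where "I = two_gen p y B"
  have sub: "two_gen p y B \<subseteq> B"
    unfolding two_gen_def using B0(2,3) B0B by (auto intro!: subring_set_closed[OF sB])
  \<comment> \<open>A ring strictly above the maximal one violates the condition, so for
    \<open>z \<notin> B\<close> the element 1 lies in the ideal generated over
    \<open>B[z]\<close>.\<close>
  have rel: "\<exists>f\<in>polys_over I. poly f z = 1" if "z \<notin> B" for z
  proof -
    have "1 \<in> two_gen p y (adjoin_set B z)"
    proof (rule ccontr)
      assume "\<not> ?thesis"
      then have "adjoin_set B z \<in> S" using adjoin_set_subring[OF sB, of z] B0B by (auto simp: S_def)
      then have "adjoin_set B z = B" using max adjoin_set_subring(2)[OF sB] by blast
      then show False using adjoin_set_subring(3)[OF sB, of z] that by simp
    qed
    then show ?thesis using two_gen_adjoin[OF sB] by (auto simp: I_def)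
  qed
  have minrel: "\<exists>f\<in>polys_over I. poly f z = 1 \<and> (\<forall>h\<in>polys_over I. poly h z = 1 \<longrightarrow> degree f \<le> degree h)"
    if z: "z \<notin> B" for z
  proof -
    obtain f where "f \<in> polys_over I" "poly f z = 1" using rel[OF z] by blast
    then show ?thesis using arg_min_nat_lemma[of "\<lambda>f. f \<in> polys_over I \<and> poly f z = 1" f degree] by blast
  qed
  \<comment> \<open>Of relations of least degree for \<open>z\<close> and for \<open>1 / z\<close>,
    the one of larger degree could be shortened by means of the other.\<close>
  have "z \<in> B \<or> inverse z \<in> B" if z: "z \<noteq> 0" for z
  proof (rule ccontr)
    assume "\<not> ?thesis"
    then have nz: "z \<notin> B" "inverse z \<notin> B" by auto
    obtain f where f: "f \<in> polys_over I" "poly f z = 1" "\<And>h. h \<in> polys_over I \<Longrightarrow> poly h z = 1 \<Longrightarrow> degree f \<le> degree h"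
      using minrel[OF nz(1)] by blast
    obtain g where g: "g \<in> polys_over I" "poly g (inverse z) = 1"
      "\<And>h. h \<in> polys_over I \<Longrightarrow> poly h (inverse z) = 1 \<Longrightarrow> degree g \<le> degree h"
      using minrel[OF nz(2)] by blast
    show False
    proof (cases "degree g \<le> degree f")
      case True
      then show False
        using relation_reduction[OF sB z one f(1,2)[unfolded I_def] g(1,2)[unfolded I_def] True sub] f(3)
        by (force simp: I_def)
    next
      case False
      have iz: "inverse z \<noteq> 0" "poly f (inverse (inverse z)) = 1" using z f by auto
      show False
        using relation_reduction[OF sB iz(1) one g(1,2)[unfolded I_def] f(1)[unfolded I_def] iz(2) _ sub] False g(3)
        by (force simp: I_def)
    qed
  qed
  then show thesis using that sB B0B one by blast
qed

section \<open>From a valuation ring to an absolute value\<close>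

locale valuation_ring =
  fixes B :: "'k::field_char_0 set" and p :: nat
  assumes nf: "number_field TYPE('k)" and p: "prime p"
    and B: "subring_set B" and valuation: "\<And>z. z \<noteq> 0 \<Longrightarrow> z \<in> B \<or> inverse z \<in> B"
    and p_nonunit: "inverse (of_nat p) \<notin> B"
begin

definition vunit where "vunit z \<longleftrightarrow> z \<noteq> 0 \<and> z \<in> B \<and> inverse z \<in> B"

lemma vunit_props:
  "vunit 1" "vunit x \<Longrightarrow> vunit y \<Longrightarrow> vunit (x * y)" "vunit x \<Longrightarrow> vunit (inverse x)" "vunit x \<Longrightarrow> vunit (- x)"
  "vunit x \<Longrightarrow> vunit (x powi k)"
proof -
  note c = subring_set_closed[OF B]
  show 1: "vunit 1" using c by (simp add: vunit_def)
  show m: "vunit (x * y)" if "vunit x" "vunit y" for x y using that c by (auto simp: vunit_def)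
  show i: "vunit (inverse x)" if "vunit x" for x using that by (auto simp: vunit_def)
  show "vunit (- x)" if "vunit x" using that c by (auto simp: vunit_def inverse_minus_eq)
  have "vunit (x ^ n)" if "vunit x" for x n using that by (induction n) (auto intro: 1 m)
  then show "vunit (x powi k)" if "vunit x" using that i by (auto simp: power_int_def)
qed

lemma nonunit_mult: "x \<in> B \<Longrightarrow> y \<in> B \<Longrightarrow> \<not> vunit x \<Longrightarrow> \<not> vunit (x * y)"
proof
  assume a: "x \<in> B" "y \<in> B" "\<not> vunit x" "vunit (x * y)"
  then have nz: "x \<noteq> 0" "y \<noteq> 0" by (auto simp: vunit_def)
  have "inverse x = y * inverse (x * y)" using nz by simp
  moreover have "y * inverse (x * y) \<in> B" using a(2,4) unfolding vunit_def by (intro subring_set_closed(4)[OF B]) auto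
  ultimately have "inverse x \<in> B" by metis
  then show False using a nz by (simp add: vunit_def)
qed

text \<open>One of \<open>y / x\<close> and \<open>x / y\<close> lies in \<open>B\<close>, so the
  sum is a multiple of a nonunit. Thus the nonunits form the maximal ideal.\<close>

lemma nonunit_add:
  assumes "x \<in> B" "y \<in> B" "\<not> vunit x" "\<not> vunit y"
  shows "\<not> vunit (x + y)"
proof -
  note c = subring_set_closed[OF B]
  have *: "\<not> vunit (u + v)" if "u \<in> B" "v \<in> B" "\<not> vunit u" "u \<noteq> 0" "v * inverse u \<in> B" for u v
  proof -
    have "u + v = u * (1 + v * inverse u)" using that(4) by (simp add: distrib_left mult.left_commute)
    then show ?thesis using nonunit_mult[OF that(1) _ that(3)] c(6)[OF c(1) that(5)] by metis
  qed
  show ?thesis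
  proof (cases "x = 0 \<or> y = 0")
    case True
    then show ?thesis using assms by auto
  next
    case False
    then have "y * inverse x \<in> B \<or> inverse (y * inverse x) \<in> B" by (intro valuation) auto
    then have "y * inverse x \<in> B \<or> x * inverse y \<in> B" by (simp add: mult.commute)
    then show ?thesis using *[of x y] *[of y x] assms False by (auto simp: add.commute)
  qed
qed

lemma nonunit_sum:
  assumes "\<And>i. i \<in> A \<Longrightarrow> f i \<in> B" "\<And>i. i \<in> A \<Longrightarrow> \<not> vunit (f i)"
  shows "\<not> vunit (\<Sum>i\<in>A. f i)"
  using assms
proof (induction A rule: infinite_finite_induct)
  case (insert x F)
  then show ?case using subring_set_closed(10)[OF B, of F f] nonunit_add[of "f x" "sum f F"] by auto
qed (auto simp: vunit_def)

lemma p_B: "of_nat p \<in> B" "\<not> vunit (of_nat p)"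
  using subring_set_closed(8)[OF B] p_nonunit by (auto simp: vunit_def)

text \<open>Otherwise a Bezout identity would write 1 as a sum of multiples of the nonunits
  \<open>p\<close> and \<open>n\<close>.\<close>

lemma coprime_int_unit:
  assumes "\<not> int p dvd n"
  shows "vunit (of_int n)"
proof (rule ccontr)
  note c = subring_set_closed[OF B]
  assume nu: "\<not> vunit (of_int n)"
  have "coprime (int p) n" using assms p by (simp add: prime_imp_coprime)
  then obtain u v where "u * int p + v * n = 1"
    using bezout_int[of "int p" n] by (auto simp: coprime_iff_gcd_eq_1)
  then have "of_int (u * int p + v * n) = (1 :: 'k)" by simp
  then have e: "of_nat p * of_int u + of_int n * of_int v = (1 :: 'k)" by (simp add: mult.commute)
  have "\<not> vunit (of_nat p * of_int u + of_int n * of_int v)"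
    using nonunit_mult p_B nu c by (intro nonunit_add c(4)) auto
  then show False using e vunit_props(1) by simp
qed

lemma rat_decomp:
  assumes "q \<noteq> 0"
  shows "\<exists>k. vunit (of_rat q * of_nat p powi k :: 'k)"
proof -
  have pi: "prime (int p)" using p by simp
  have int: "\<exists>k. vunit (of_int n * of_nat p powi k :: 'k)" if n: "n \<noteq> 0" for n
  proof -
    obtain u where u: "n = int p ^ multiplicity (int p) n * u" "\<not> int p dvd u"
      using multiplicity_decompose'[of n "int p"] n pi by (metis not_prime_unit)
    have "of_int n * of_nat p powi (- int (multiplicity (int p) n)) = (of_int u :: 'k)"
      using prime_gt_0_nat[OF p] by (subst u(1)) (simp add: power_int_minus)
    then show ?thesis using coprime_int_unit[OF u(2)] by metis
  qed
  obtain a b where ab: "quotient_of q = (a, b)" by fastforce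
  have q: "q = of_int a / of_int b" "b \<noteq> 0" "a \<noteq> 0"
    using quotient_of_div[OF ab] quotient_of_denom_pos[OF ab] assms by auto
  obtain k l where kl: "vunit (of_int a * of_nat p powi k :: 'k)" "vunit (of_int b * of_nat p powi l :: 'k)"
    using int q by metis
  have p0: "of_nat p \<noteq> (0 :: 'k)" using prime_gt_0_nat[OF p] by simp
  have "(of_int a * of_nat p powi k) * inverse (of_int b * of_nat p powi l) = (of_rat q * of_nat p powi (k - l) :: 'k)"
    using p0 by (simp add: q(1) of_rat_divide power_int_diff field_simps)
  then show ?thesis using kl vunit_props(2,3) by metis
qed

text \<open>
  Every ramification index divides \<open>M\<close>, so \<open>z ^ M\<close> is a power of \<open>p\<close> up to a unit.
  This gives a rank one valuation without any theory of value groups.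
\<close>

definition M where "M = (fact (field_degree TYPE('k)) :: nat)"

text \<open>In an algebraic relation for \<open>z\<close> the dominating term cannot be alone, so
  two terms differ by a unit factor. Rationals being powers of \<open>p\<close> up to units, some
  \<open>z ^ n\<close> is a power of \<open>p\<close> up to a unit, with \<open>n\<close> at most
  the field degree and hence a divisor of the factorial \<open>M\<close>.\<close>

lemma value_exists:
  assumes z: "z \<noteq> 0"
  shows "\<exists>k. vunit (z ^ M * of_nat p powi k)"
proof -
  note c = subring_set_closed[OF B]
  have p0: "of_nat p \<noteq> (0 :: 'k)" using prime_gt_0_nat[OF p] by simp
  obtain P where P: "P \<noteq> 0" "degree P \<le> field_degree TYPE('k)" "rat_eval P z = 0"
    using algebraic_bounded_degree[OF nf] by blast
  define A where "A = {i. coeff P i \<noteq> 0}"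
  have finA: "finite A" unfolding A_def by (rule finite_subset[of _ "{..degree P}"]) (auto intro: le_degree)
  have "degree P \<in> A" using P(1) by (simp add: A_def)
  then have A0: "A \<noteq> {}" by blast
  define t where "t i = of_rat (coeff P i) * z ^ i" for i
  have t0: "t i \<noteq> 0" if "i \<in> A" for i using that z by (simp add: t_def A_def)
  have s: "(\<Sum>i\<in>A. t i) = 0"
  proof -
    have "rat_eval P z = (\<Sum>i\<le>degree P. t i)"
      by (simp add: rat_eval_def poly_altdef t_def)
    also have "\<dots> = (\<Sum>i\<in>A. t i)"
      by (rule sum.mono_neutral_right) (auto simp: A_def t_def le_degree)
    finally show ?thesis using P by simp
  qed
  \<comment> \<open>Divisibility in a valuation ring is total, so among finitely many terms one
    divides all the others.\<close>
  have maxi: "\<exists>i\<in>A'. \<forall>j\<in>A'. t j * inverse (t i) \<in> B" if "finite A'" "A' \<noteq> {}" "A' \<subseteq> A" for A'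
    using that
  proof (induction A' rule: finite_ne_induct)
    case (singleton x)
    then show ?case using c t0[of x] by auto
  next
    case (insert x F)
    then obtain i where i: "i \<in> F" "\<forall>j\<in>F. t j * inverse (t i) \<in> B" by auto
    have nz: "t i \<noteq> 0" "t x \<noteq> 0" using t0 i insert.prems by auto
    then have "t x * inverse (t i) \<in> B \<or> t i * inverse (t x) \<in> B"
      using valuation[of "t x * inverse (t i)"] by (auto simp: mult.commute)
    then show ?case
    proof
      assume "t x * inverse (t i) \<in> B"
      then show ?thesis using i by auto
    next
      assume a: "t i * inverse (t x) \<in> B"
      have "t j * inverse (t x) \<in> B" if "j \<in> F" for j
      proof -
        have e: "t j * inverse (t x) = (t j * inverse (t i)) * (t i * inverse (t x))" using nz by simp
        have "t j * inverse (t i) \<in> B" using i(2) that by blast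
        then show ?thesis unfolding e by (rule c(4)) (rule a)
      qed
      then show ?thesis using nz c by auto
    qed
  qed
  obtain i where i: "i \<in> A" "\<And>j. j \<in> A \<Longrightarrow> t j * inverse (t i) \<in> B"
    using maxi[OF finA A0 subset_refl] by blast
  obtain j where j: "j \<in> A" "j \<noteq> i" "vunit (t j * inverse (t i))"
  proof (rule ccontr)
    assume "\<not> thesis"
    then have "\<not> vunit (\<Sum>j\<in>A - {i}. t j * inverse (t i))"
      using that i by (intro nonunit_sum) auto
    moreover have "(\<Sum>j\<in>A - {i}. t j) = - t i" using s finA i(1) by (simp add: sum.remove eq_neg_iff_add_eq_0 add.commute)
    then have "(\<Sum>j\<in>A - {i}. t j * inverse (t i)) = -1" using t0[OF i(1)] by (simp flip: sum_distrib_right)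
    ultimately show False using vunit_props(1,4) by metis
  qed
  have key: "\<exists>n k. n \<ge> 1 \<and> n \<le> field_degree TYPE('k) \<and> vunit (z ^ n * of_nat p powi k)"
    if ij: "i \<in> A" "j \<in> A" "i < j" "vunit (t j * inverse (t i))" for i j
  proof -
    have "coeff P j / coeff P i \<noteq> 0" using ij by (auto simp: A_def)
    then obtain k where k: "vunit (of_rat (coeff P j / coeff P i) * of_nat p powi k :: 'k)" using rat_decomp by blast
    have "z ^ j = z ^ i * z ^ (j - i)" using ij by (simp flip: power_add)
    then have e1: "t j * inverse (t i) = of_rat (coeff P j / coeff P i) * z ^ (j - i)"
      using z by (simp add: t_def of_rat_divide field_simps)
    have e2: "z ^ (j - i) * of_nat p powi (- k) =
       (of_rat (coeff P j / coeff P i) * z ^ (j - i)) * inverse (of_rat (coeff P j / coeff P i) * of_nat p powi k)"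
      using ij p0 by (simp add: A_def power_int_minus field_simps)
    have "vunit (z ^ (j - i) * of_nat p powi (- k))"
      unfolding e2 by (rule vunit_props(2)[OF ij(4) vunit_props(3)[OF k], unfolded e1])
    moreover have "j - i \<ge> 1" "j - i \<le> field_degree TYPE('k)" using ij P(2) le_degree[of P j] by (auto simp: A_def)
    ultimately show ?thesis by blast
  qed
  have "\<exists>n k. n \<ge> 1 \<and> n \<le> field_degree TYPE('k) \<and> vunit (z ^ n * of_nat p powi k)"
  proof (cases "i < j")
    case True
    then show ?thesis using key i j by blast
  next
    case False
    have "vunit (t i * inverse (t j))" using vunit_props(3)[OF j(3)] by (simp add: mult.commute)
    then show ?thesis using key[of j i] i j False by auto
  qed
  then obtain n k where nk: "n \<ge> 1" "n \<le> field_degree TYPE('k)" "vunit (z ^ n * of_nat p powi k)" by blast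
  have "n dvd M" unfolding M_def using nk by (intro dvd_fact) auto
  then obtain r where r: "M = n * r" by (elim dvdE)
  have "(z ^ n * of_nat p powi k) powi int r = z ^ M * of_nat p powi (k * int r)"
    by (simp add: r power_mult power_int_mult power_mult_distrib)
  then show ?thesis using vunit_props(5)[OF nk(3), of "int r"] by metis
qed

lemma p_powi_unit: "vunit (of_nat p powi k) \<longleftrightarrow> k = 0"
proof
  have *: False if "vunit (of_nat p powi (int (Suc n)))" for n
  proof -
    have "of_nat p powi (int (Suc n)) = of_nat p * (of_nat p ^ n :: 'k)" by (simp only: power_int_of_nat power_Suc)
    then show False using nonunit_mult[OF p_B(1) _ p_B(2), of "of_nat p ^ n"] subring_set_closed(7)[OF B p_B(1)] that by simp
  qed
  assume u: "vunit (of_nat p powi k)"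
  then have u': "vunit (of_nat p powi (- k))" using vunit_props(3) by (simp add: power_int_minus)
  show "k = 0"
  proof (rule ccontr)
    assume "k \<noteq> 0"
    then have "k = int (Suc (nat k - 1)) \<or> - k = int (Suc (nat (- k) - 1))" by linarith
    then show False using * u u' by metis
  qed
qed (simp add: vunit_props)

definition vord where "vord z = (THE k. vunit (z ^ M * of_nat p powi (- k)))"

lemma vord_unique:
  assumes "vunit (z ^ M * of_nat p powi (- k))"
  shows "vord z = k"
  unfolding vord_def
proof (rule the_equality)
  have p0: "of_nat p \<noteq> (0 :: 'k)" using prime_gt_0_nat[OF p] by simp
  show "vunit (z ^ M * of_nat p powi (- k))" by fact
  fix l assume l: "vunit (z ^ M * of_nat p powi (- l))"
  have nz: "z ^ M \<noteq> 0" using assms by (auto simp: vunit_def)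
  have "(z ^ M * of_nat p powi (- l)) * inverse (z ^ M * of_nat p powi (- k)) = of_nat p powi (k - l)"
    using nz p0 by (simp add: power_int_minus power_int_diff field_simps)
  then have "vunit (of_nat p powi (k - l))" using vunit_props(2)[OF l vunit_props(3)[OF assms]] by metis
  then show "l = k" using p_powi_unit by auto
qed

lemma vord: "z \<noteq> 0 \<Longrightarrow> vunit (z ^ M * of_nat p powi (- vord z))"
proof -
  assume "z \<noteq> 0"
  then obtain k where "vunit (z ^ M * of_nat p powi k)" using value_exists by blast
  then have "vunit (z ^ M * of_nat p powi (- (- k)))" by simp
  then show ?thesis using vord_unique by metis
qed

lemma vord_mult:
  assumes "x \<noteq> 0" "y \<noteq> 0"
  shows "vord (x * y) = vord x + vord y"
proof (rule vord_unique)
  have p0: "of_nat p \<noteq> (0 :: 'k)" using prime_gt_0_nat[OF p] by simp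
  have "(x * y) ^ M * of_nat p powi (- (vord x + vord y)) =
      (x ^ M * of_nat p powi (- vord x)) * (y ^ M * of_nat p powi (- vord y))"
    using p0 by (simp add: power_mult_distrib power_int_diff power_int_minus field_simps)
  then show "vunit ((x * y) ^ M * of_nat p powi (- (vord x + vord y)))"
    using vunit_props(2) vord assms by metis
qed

lemma vord_p: "vord (of_nat p) = int M"
  by (rule vord_unique) (use prime_gt_0_nat[OF p] in \<open>simp add: power_int_minus vunit_props\<close>)

text \<open>If \<open>z\<close> has nonnegative order but only \<open>1 / z\<close> lies in
  \<open>B\<close>, then \<open>1 / z\<close> has order 0, so its power with exponent
  \<open>M\<close> is a unit; but a power of a nonunit is a nonunit.\<close>

lemma vord_nonneg:
  assumes "z \<noteq> 0"
  shows "vord z \<ge> 0 \<longleftrightarrow> z \<in> B"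
proof -
  note c = subring_set_closed[OF B]
  have p0: "of_nat p \<noteq> (0 :: 'k)" using prime_gt_0_nat[OF p] by simp
  have M1: "M \<ge> 1" by (simp add: M_def)
  have pB: "of_nat p powi k \<in> B" if "k \<ge> 0" for k using that c(7)[OF p_B(1)] by (simp add: power_int_def)
  have dir: "vord u \<ge> 0" if u: "u \<noteq> 0" "u \<in> B" for u
  proof (rule ccontr)
    assume neg: "\<not> vord u \<ge> 0"
    have "vunit (of_nat p powi (- vord u))"
    proof -
      have "inverse (u ^ M * of_nat p powi (- vord u)) * u ^ M = inverse (of_nat p powi (- vord u))"
        using u by simp
      moreover have "inverse (u ^ M * of_nat p powi (- vord u)) * u ^ M \<in> B"
        using vord[OF u(1)] c(7)[OF u(2)] c(4) by (auto simp: vunit_def)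
      ultimately have "inverse (of_nat p powi (- vord u)) \<in> B" by metis
      then show ?thesis using pB[of "- vord u"] neg p0 by (auto simp: vunit_def)
    qed
    then show False using p_powi_unit neg by auto
  qed
  show ?thesis
  proof
    assume "z \<in> B" then show "vord z \<ge> 0" using dir assms by blast
  next
    assume ge: "vord z \<ge> 0"
    show "z \<in> B"
    proof (rule ccontr)
      assume nz: "z \<notin> B"
      then have iz: "inverse z \<in> B" using valuation[OF assms] by blast
      then have "vord (inverse z) \<ge> 0" using dir assms by auto
      moreover have "vord (inverse z) + vord z = vord 1" using vord_mult[of "inverse z" z] assms by simp
      moreover have "vord 1 = 0" by (rule vord_unique) (simp add: vunit_props)
      ultimately have "vord (inverse z) = 0" using ge by linarith
      then have "vunit (inverse z ^ M)" using vord[of "inverse z"] assms by simp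
      moreover have "\<not> vunit (inverse z)" using nz by (simp add: vunit_def)
      moreover have "inverse z ^ M = inverse z * inverse z ^ (M - 1)" using M1 by (cases M) auto
      ultimately show False using nonunit_mult[OF iz _ _, of "inverse z ^ (M - 1)"] c(7)[OF iz] by metis
    qed
  qed
qed

definition vabs where "vabs z = (if z = 0 then 0 else real p powr (- real_of_int (vord z) / real M))"

lemma vabs_mult: "vabs (x * y) = vabs x * vabs y"
  by (cases "x = 0 \<or> y = 0") (auto simp: vabs_def vord_mult add_divide_distrib diff_divide_distrib simp flip: powr_add)

lemma vabs_le_1: "vabs z \<le> 1 \<longleftrightarrow> z \<in> B"
proof (cases "z = 0")
  case False
  have "real p > 1" using prime_gt_1_nat[OF p] by simp
  then have "vabs z \<le> 1 \<longleftrightarrow> - real_of_int (vord z) / real M \<le> 0"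
    using False powr_le_cancel_iff[of "real p" _ 0] by (simp add: vabs_def)
  also have "\<dots> \<longleftrightarrow> vord z \<ge> 0"
  proof -
    have "real M > 0" by (simp add: M_def)
    then show ?thesis by (simp add: zero_le_divide_iff)
  qed
  finally show ?thesis using vord_nonneg[OF False] by simp
qed (simp add: vabs_def subring_set_closed[OF B])

lemma vabs: "absolute_value vabs" "ultrametric vabs" "vabs (of_nat p) = 1 / real p"
proof -
  have pp: "real p > 1" using prime_gt_1_nat[OF p] by simp
  have mn: "mult_norm vabs"
    unfolding mult_norm_def using pp by (auto simp: vabs_mult) (auto simp: vabs_def split: if_splits)
  have le: "vabs (x + y) \<le> vabs y" if "vabs x \<le> vabs y" for x y
  proof (cases "y = 0")
    case True
    then show ?thesis using that by simp
  next
    case False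
    have e: "x + y = y * (1 + x / y)" using False by (simp add: field_simps)
    have "vabs (x / y) \<le> 1"
      using that mult_norm_pos[OF mn False] by (simp add: mult_norm_divide[OF mn])
    then have "1 + x / y \<in> B" using vabs_le_1 subring_set_closed[OF B] by metis
    then have "vabs y * vabs (1 + x / y) \<le> vabs y * 1"
      using vabs_le_1 mult_norm_nonneg[OF mn] by (intro mult_left_mono) auto
    then show ?thesis unfolding e vabs_mult by simp
  qed
  show u: "ultrametric vabs"
    unfolding ultrametric_def
  proof (intro allI)
    fix x y
    show "vabs (x + y) \<le> max (vabs x) (vabs y)"
      using le[of x y] le[of y x] by (cases "vabs x \<le> vabs y") (simp_all add: add.commute max_def)
  qed
  show "absolute_value vabs"
    unfolding absolute_value_def
  proof (intro conjI allI)
    fix x y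
    show "vabs (x + y) \<le> vabs x + vabs y"
      using ultra_add[OF mn u, of x y] mult_norm_nonneg[OF mn, of x] mult_norm_nonneg[OF mn, of y] by linarith
  qed (insert mn[unfolded mult_norm_def], blast+)
  have "(of_nat p :: 'k) \<noteq> 0" using prime_gt_0_nat[OF p] by simp
  then have "vabs (of_nat p) = real p powr (- real_of_int (vord (of_nat p)) / real M)"
    by (simp only: vabs_def if_False)
  also have "- real_of_int (vord (of_nat p)) / real M = -1"
    unfolding vord_p by (simp add: M_def)
  also have "real p powr -1 = 1 / real p"
    using pp powr_minus_divide[of "real p" 1] by simp
  finally show "vabs (of_nat p) = 1 / real p" .
qed

end

text \<open>Prescribing the value at \<open>p\<close> selects one absolute value in each place above
  \<open>p\<close>, so that places can be handled as functions.\<close>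

definition places_above :: "nat \<Rightarrow> ('k::field_char_0 \<Rightarrow> real) set" where
  "places_above p = {a. absolute_value a \<and> ultrametric a \<and> a (of_nat p) = 1 / real p}"

lemma places_above_props:
  assumes "a \<in> places_above p"
  shows "mult_norm a" "ultrametric a" "a (of_nat p) = 1 / real p" "absolute_value a"
  using assms unfolding places_above_def absolute_value_def mult_norm_def by blast+

text \<open>
  With \<open>y = 1 / x\<close>, such an equation says that \<open>1\<close> lies in the ideal generated by \<open>p\<close> and \<open>y\<close> in
  \<open>\<int>[y]\<close>. Otherwise a valuation ring in which \<open>p\<close> and \<open>y\<close> are nonunits gives an absolute value
  exceeding 1 at \<open>x\<close>.
\<close>

lemma integral_of_places:
  fixes x :: "'k::field_char_0"
  assumes nf: "number_field TYPE('k)" and p: "prime p" and le: "\<And>a. a \<in> places_above p \<Longrightarrow> a x \<le> 1"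
  shows "\<exists>e\<ge>1. \<exists>c. (\<forall>j<e. padic p (c j) \<le> 1) \<and> x ^ e = (\<Sum>j<e. of_rat (c j) * x ^ j)"
proof (cases "x = 0")
  case True
  then show ?thesis
    by (intro exI[of _ 1] conjI exI[of _ "\<lambda>_. 0"]) (auto simp: padic_def)
next
  case False
  define y where "y = inverse x"
  have y: "y \<noteq> 0" using False by (simp add: y_def)
  have Z: "subring_set (\<int> :: 'k set)" by (auto simp: subring_set_def)
  define B0 where "B0 = adjoin_set \<int> y"
  have B0: "subring_set B0" "of_nat p \<in> B0" "y \<in> B0"
    using adjoin_set_subring[OF Z, of y] by (auto simp: B0_def)
  have "1 \<in> two_gen (of_nat p) y B0"
  proof (rule ccontr)
    assume no: "1 \<notin> two_gen (of_nat p) y B0"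
    obtain B where BR: "subring_set B" "B0 \<subseteq> B" "1 \<notin> two_gen (of_nat p) y B"
      "\<And>z. z \<noteq> 0 \<Longrightarrow> z \<in> B \<or> inverse z \<in> B"
      using valuation_ring_exists[OF B0 no] by metis
    have c: "0 \<in> B" using subring_set_closed(2)[OF BR(1)] .
    have "inverse (of_nat p) \<notin> B"
    proof
      assume a: "inverse (of_nat p) \<in> B"
      have "1 = of_nat p * inverse (of_nat p) + y * 0" using prime_gt_0_nat[OF p] by simp
      then show False using BR(3) a c unfolding two_gen_def by blast
    qed
    then interpret valuation_ring B p
      using nf p BR by unfold_locales auto
    have "x \<notin> B"
    proof
      assume a: "x \<in> B"
      have "1 = of_nat p * 0 + y * x" using False by (simp add: y_def)
      then show False using BR(3) a c unfolding two_gen_def by blast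
    qed
    then have "\<not> vabs x \<le> 1" by (simp add: vabs_le_1)
    moreover have "vabs \<in> places_above p" using vabs by (simp add: places_above_def)
    ultimately show False using le by blast
  qed
  then obtain F G where FG: "F \<in> polys_over \<int>" "G \<in> polys_over \<int>" "1 = of_nat p * poly F y + y * poly G y"
    by (auto simp: two_gen_def B0_def adjoin_set_def)
  \<comment> \<open>The representation of 1 becomes a polynomial with root \<open>y\<close> whose
    constant term is 1 modulo \<open>p\<close>. Dividing by that term and reversing the coefficients
    gives a monic relation for \<open>x = 1 / y\<close> with \<open>p\<close>-integral
    coefficients.\<close>
  define E where "E = 1 - Polynomial.smult (of_nat p) F - pCons 0 G"
  define e where "e = degree E"
  have EZ: "coeff E i \<in> \<int>" for i
    using FG(1,2) by (auto simp: E_def polys_over_def coeff_pCons split: nat.split intro!: Ints_diff Ints_mult)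
  have "poly E y = 1 - (of_nat p * poly F y + y * poly G y)" by (simp add: E_def)
  then have Ey: "poly E y = 0" by (simp only: FG(3)[symmetric]) simp
  obtain k where k: "coeff F 0 = of_int k" using FG(1) by (auto simp: polys_over_def elim: Ints_cases)
  define u where "u = 1 - int p * k"
  have E0: "coeff E 0 = of_int u" by (simp add: E_def k u_def)
  have nd: "\<not> int p dvd u"
  proof
    assume "int p dvd u"
    then have "int p dvd u + int p * k" by simp
    then show False using prime_gt_1_nat[OF p] by (simp add: u_def)
  qed
  then have u0: "u \<noteq> 0" by auto
  have e1: "e \<ge> 1"
  proof (rule ccontr)
    assume "\<not> ?thesis"
    then have "degree E = 0" by (simp add: e_def)
    then obtain c where "E = [:c:]" by (rule degree_eq_zeroE)
    then show False using Ey E0 u0 by simp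
  qed
  define d where "d i = (SOME j. coeff E i = of_int j)" for i
  have d: "coeff E i = of_int (d i)" for i
    unfolding d_def using EZ[of i] by (intro someI_ex[of "\<lambda>j. coeff E i = of_int j"]) (auto elim: Ints_cases)
  define c where "c j = - of_int (d (e - j)) / (of_int u :: rat)" for j
  have "padic p (c j) \<le> 1" for j
  proof -
    have "padic p (c j) = padic p (of_int (d (e - j))) / padic p (of_int u)"
      unfolding c_def by (simp add: mult_norm_divide[OF padic_mult_norm[OF p]] mult_norm_minus[OF padic_mult_norm[OF p]])
    then show ?thesis using padic_of_int_le_1[OF p] padic_of_int_eq_1[OF p nd] by simp
  qed
  moreover have "x ^ e = (\<Sum>j<e. of_rat (c j) * x ^ j)"
  proof -
    have "0 = x ^ e * poly E y" by (simp add: Ey)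
    also have "\<dots> = (\<Sum>i\<le>e. coeff E i * x ^ (e - i))"
      unfolding poly_altdef e_def[symmetric] sum_distrib_left
    proof (intro sum.cong refl)
      fix i assume "i \<in> {..e}"
      then have "x ^ e = x ^ (e - i) * x ^ i" by (simp flip: power_add)
      then show "x ^ e * (coeff E i * y ^ i) = coeff E i * x ^ (e - i)"
        using False by (simp add: y_def power_inverse)
    qed
    also have "\<dots> = (\<Sum>j\<le>e. coeff E (e - j) * x ^ j)"
      by (rule sum.reindex_bij_witness[of _ "\<lambda>j. e - j" "\<lambda>j. e - j"]) auto
    also have "\<dots> = coeff E 0 * x ^ e + (\<Sum>j<e. coeff E (e - j) * x ^ j)"
      by (simp add: lessThan_Suc_atMost[symmetric] add.commute)
    finally have "of_int u * x ^ e = - (\<Sum>j<e. of_int (d (e - j)) * x ^ j)"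
      by (simp add: E0[symmetric] d eq_neg_iff_add_eq_0)
    then have "x ^ e = - (\<Sum>j<e. of_int (d (e - j)) * x ^ j) / of_int u"
      by (subst nonzero_eq_divide_eq) (use u0 in \<open>simp_all add: mult.commute[of "x ^ e"]\<close>)
    also have "\<dots> = (\<Sum>j<e. of_rat (c j) * x ^ j)"
      by (simp add: c_def of_rat_divide of_rat_minus sum_negf sum_divide_distrib)
    finally show ?thesis .
  qed
  ultimately show ?thesis using e1 by blast
qed

section \<open>Embeddings and the norm\<close>

locale primitive_elt =
  fixes theta :: "'k::field_char_0" and f :: "rat poly"
  assumes nf: "number_field TYPE('k)" and gen: "adjoin theta = UNIV"
    and f: "f \<noteq> 0" "rat_eval f theta = 0" "\<And>p. p \<noteq> 0 \<Longrightarrow> rat_eval p theta = 0 \<Longrightarrow> degree f \<le> degree p"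
begin

definition d where "d = degree f"

lemma min_dvd:
  assumes "rat_eval p theta = 0"
  shows "f dvd p"
proof -
  have "rat_eval (p div f * f + p mod f) theta = rat_eval (p div f) theta * rat_eval f theta + rat_eval (p mod f) theta"
    by (simp only: rat_eval_simps)
  then have "rat_eval p theta = rat_eval (p div f) theta * rat_eval f theta + rat_eval (p mod f) theta"
    by (simp only: div_mult_mod_eq)
  then have "rat_eval (p mod f) theta = 0" using assms f(2) by simp
  moreover have "p mod f = 0 \<or> degree (p mod f) < degree f" using f(1) by (rule degree_mod_less)
  ultimately have "p mod f = 0" using f(3)[of "p mod f"] leD by blast
  then show ?thesis by (simp add: mod_eq_0_iff_dvd)
qed

lemma small_zero: "degree p < d \<Longrightarrow> rat_eval p theta = 0 \<Longrightarrow> p = 0"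
  using f(3)[of p] by (auto simp: d_def)

lemma d_pos: "d > 0"
proof (rule ccontr)
  assume "\<not> ?thesis"
  then have "degree f = 0" by (simp add: d_def)
  then obtain c where "f = [:c:]" by (rule degree_eq_zeroE)
  then show False using f by simp
qed

lemma d_le: "d \<le> field_degree TYPE('k)"
proof -
  have small: "p = 0" if "degree p \<le> d - 1" "rat_eval p theta = 0" for p
    using small_zero[of p] that d_pos by simp
  have inj: "inj_on (\<lambda>i. theta ^ i) {..<d}"
  proof (rule inj_onI)
    fix i j assume ij: "i \<in> {..<d}" "j \<in> {..<d}" "theta ^ i = theta ^ j"
    have "degree (Polynomial.monom 1 i - Polynomial.monom 1 j :: rat poly) \<le> d - 1"
      using ij by (intro degree_diff_le) (auto intro: order_trans[OF degree_monom_le])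
    then have "Polynomial.monom (1::rat) i - Polynomial.monom 1 j = 0"
      using ij by (intro small) auto
    then show "i = j" by (metis eq_iff_diff_eq_0 degree_monom_eq zero_neq_one)
  qed
  have "rat_vs.independent ((\<lambda>i. theta ^ i) ` {..<d})"
  proof (rule ccontr)
    assume "\<not> ?thesis"
    then obtain u where u: "\<exists>v\<in>(\<lambda>i. theta ^ i) ` {..<d}. u v \<noteq> 0" "(\<Sum>v\<in>(\<lambda>i. theta ^ i) ` {..<d}. rat_scale (u v) v) = 0"
      using rat_vs.dependent_finite[of "(\<lambda>i. theta ^ i) ` {..<d}"] by auto
    define p where "p = (\<Sum>i<d. Polynomial.monom (u (theta ^ i)) i)"
    have "degree p \<le> d - 1" unfolding p_def by (intro degree_sum_le) (auto intro: order_trans[OF degree_monom_le])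
    moreover have "rat_eval p theta = 0"
      using u(2) inj by (simp add: p_def sum.reindex rat_scale_def)
    ultimately have "p = 0" by (rule small)
    moreover have "coeff p i = u (theta ^ i)" if "i < d" for i
      using that by (simp add: p_def coeff_sum if_distrib sum.delta cong: if_cong)
    ultimately show False using u(1) by auto
  qed
  from finite_dim_bound(2)[OF nf this] inj show ?thesis by (simp add: card_image)
qed

definition Z :: "complex set" where "Z = {z. rat_eval f z = 0}"

text \<open>\<open>theta\<close> is a root of \<open>f\<close> but not of its derivative, so it is a
  root of the cofactor of \<open>gcd f (pderiv f)\<close>. By minimality this cofactor has full
  degree, the gcd is constant, and a Bezout identity excludes a common root.\<close>

lemma no_double_root:
  assumes "rat_eval f (z::complex) = 0"
  shows "rat_eval (pderiv f) z \<noteq> 0"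
proof
  assume 0: "rat_eval (pderiv f) z = 0"
  define g where "g = gcd f (pderiv f)"
  obtain h where h: "f = g * h" using dvdE[of g f] by (auto simp: g_def)
  have g0: "g \<noteq> 0" "h \<noteq> 0" using f(1) h by auto
  have "rat_eval g theta * rat_eval h theta = 0" using f(2) by (simp add: h)
  moreover have "rat_eval g theta \<noteq> 0"
  proof
    assume g: "rat_eval g theta = 0"
    obtain k where "pderiv f = g * k" using dvdE[of g "pderiv f"] by (auto simp: g_def)
    then have "rat_eval (pderiv f) theta = 0" using g by simp
    then show False using minimal_rat_poly_separable[OF f] by blast
  qed
  ultimately have "degree f \<le> degree h" using f(3) g0 by auto
  moreover have "degree f = degree g + degree h" unfolding h using g0 by (rule degree_mult_eq)
  ultimately obtain c where c: "g = [:c:]" using degree_eq_zeroE[of g] by auto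
  have "rat_eval g z = rat_eval (fst (bezout_coefficients f (pderiv f)) * f + snd (bezout_coefficients f (pderiv f)) * pderiv f) z"
    by (simp only: bezout_coefficients_fst_snd g_def)
  also have "\<dots> = 0" using 0 assms by simp
  finally show False using c g0 by simp
qed

lemma Z_card: "finite Z" "card Z = d"
proof -
  define F where "F = (map_poly of_rat f :: complex poly)"
  have F0: "F \<noteq> 0" using f(1) by (simp add: F_def)
  obtain as where as: "Polynomial.smult (coeff F (degree F)) (\<Prod>a\<leftarrow>as. [:- a, 1:]) = F" "length as = degree F"
    using fundamental_theorem_algebra_factorized[of F] by blast
  have pz: "poly (\<Prod>a\<leftarrow>as. [:- a, 1:]) z = 0 \<longleftrightarrow> z \<in> set as" for z
    by (induction as) auto
  have "poly F z = 0 \<longleftrightarrow> z \<in> set as" for z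
    by (subst as(1)[symmetric]) (use F0 pz in simp)
  then have Zas: "Z = set as" by (auto simp: Z_def rat_eval_def F_def)
  have "distinct as"
  proof (rule ccontr)
    assume "\<not> distinct as"
    then obtain xs ys zs a where dec: "as = xs @ [a] @ ys @ [a] @ zs" using not_distinct_decomp by blast
    define G where "G = Polynomial.smult (coeff F (degree F)) ((\<Prod>a\<leftarrow>xs. [:- a, 1:]) * (\<Prod>a\<leftarrow>ys. [:- a, 1:]) * (\<Prod>a\<leftarrow>zs. [:- a, 1:]))"
    have "F = [:- a, 1:] * ([:- a, 1:] * G)"
      by (subst as(1)[symmetric]) (simp only: dec G_def map_append prod_list.append list.map prod_list.Cons prod_list.Nil mult_smult_right mult_1_right mult_1_left mult_ac)
    then have "poly F a = 0" "poly (pderiv F) a = 0"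
      using pderiv_mult[of "[:- a, 1:]" "[:- a, 1:] * G"] by (simp_all only: poly_mult poly_add) (simp_all add: pderiv_pCons)
    then show False
      using no_double_root[of a] by (simp add: F_def rat_eval_def of_rat_hom.map_poly_pderiv)
  qed
  then show "finite Z" "card Z = d"
    using as(2) by (simp_all add: Zas distinct_card d_def F_def)
qed

definition repr :: "'k \<Rightarrow> rat poly" where
  "repr x = (SOME p. rat_eval p theta = x) mod f"

lemma repr: "rat_eval (repr x) theta = x" "degree (repr x) < d"
proof -
  define p where "p = (SOME p. rat_eval p theta = x)"
  have "\<exists>p. rat_eval p theta = x" using gen unfolding adjoin_def by (metis UNIV_I imageE)
  then have p: "rat_eval p theta = x" unfolding p_def by (rule someI_ex)
  have "rat_eval (p div f * f + p mod f) theta = rat_eval (p div f) theta * rat_eval f theta + rat_eval (p mod f) theta"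
    by (simp only: rat_eval_simps)
  then have "rat_eval p theta = rat_eval (p div f) theta * rat_eval f theta + rat_eval (p mod f) theta"
    by (simp only: div_mult_mod_eq)
  then show "rat_eval (repr x) theta = x" using p f(2) by (simp add: repr_def p_def)
  have "p mod f = 0 \<or> degree (p mod f) < degree f" using f(1) by (rule degree_mod_less)
  then show "degree (repr x) < d" using d_pos unfolding repr_def p_def[symmetric] d_def by auto
qed

lemma repr_unique:
  assumes "degree p < d" "rat_eval p theta = x"
  shows "repr x = p"
proof -
  have "degree (repr x - p) < d" using assms(1) repr(2)[of x] by (rule degree_diff_less[rotated])
  moreover have "rat_eval (repr x - p) theta = 0" using assms(2) repr(1) by simp
  ultimately have "repr x - p = 0" by (rule small_zero)
  then show ?thesis by simp
qed

definition sigma :: "complex \<Rightarrow> 'k \<Rightarrow> complex" where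
  "sigma z x = rat_eval (repr x) z"

lemma sigma_eval:
  assumes "z \<in> Z"
  shows "sigma z (rat_eval p theta) = rat_eval p z"
proof -
  have "rat_eval (repr (rat_eval p theta) - p) theta = 0" using repr(1) by simp
  then obtain q where q: "repr (rat_eval p theta) - p = f * q" using min_dvd by (metis dvdE)
  have "rat_eval (repr (rat_eval p theta)) z - rat_eval p z = rat_eval (f * q) z" by (simp flip: q)
  then show ?thesis using assms by (simp add: sigma_def Z_def)
qed

lemma sigma_hom:
  assumes "z \<in> Z"
  shows "sigma z (x + y) = sigma z x + sigma z y" "sigma z (x * y) = sigma z x * sigma z y" "sigma z 1 = 1"
  using sigma_eval[OF assms, of "repr x + repr y"] sigma_eval[OF assms, of "repr x * repr y"] sigma_eval[OF assms, of 1]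
  by (simp_all add: repr(1) sigma_def)

lemma cnj_rat_eval: "rat_eval p (cnj z) = cnj (rat_eval p z)"
proof -
  have "cnj (of_rat a) = of_rat a" for a by (cases a) (simp add: of_rat_rat)
  then show ?thesis by (induction p) simp_all
qed

lemma sigma_cnj: "z \<in> Z \<Longrightarrow> cnj z \<in> Z" "sigma (cnj z) x = cnj (sigma z x)"
  by (simp_all add: Z_def sigma_def cnj_rat_eval)

definition coord where "coord x k = coeff (repr x) k"

lemma coord_sum: "coord (\<Sum>i\<in>A. of_rat (c i) * x i) k = (\<Sum>i\<in>A. c i * coord (x i) k)"
proof -
  have "degree (\<Sum>i\<in>A. Polynomial.smult (c i) (repr (x i))) < d"
  proof -
    have "degree (\<Sum>i\<in>A. Polynomial.smult (c i) (repr (x i))) \<le> d - 1"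
    proof (cases "finite A")
      case True
      then show ?thesis
      proof (rule degree_sum_le)
        fix i assume "i \<in> A"
        have "degree (Polynomial.smult (c i) (repr (x i))) \<le> degree (repr (x i))" by (rule degree_smult_le)
        then show "degree (Polynomial.smult (c i) (repr (x i))) \<le> d - 1" using repr(2)[of "x i"] by linarith
      qed
    qed simp
    then show ?thesis using d_pos by linarith
  qed
  then have "repr (\<Sum>i\<in>A. of_rat (c i) * x i) = (\<Sum>i\<in>A. Polynomial.smult (c i) (repr (x i)))"
    by (rule repr_unique) (simp add: repr(1))
  then show ?thesis by (simp add: coord_def coeff_sum)
qed

lemma sigma_coord: "sigma z x = (\<Sum>k<d. z ^ k * of_rat (coord x k))"
proof -
  have "sigma z x = (\<Sum>k\<le>degree (repr x). of_rat (coeff (repr x) k) * z ^ k)"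
    by (simp add: sigma_def rat_eval_def poly_altdef)
  also have "\<dots> = (\<Sum>k<d. of_rat (coeff (repr x) k) * z ^ k)"
    using repr(2)[of x] by (intro sum.mono_neutral_left) (auto simp: coeff_eq_0)
  finally show ?thesis by (simp add: coord_def mult.commute)
qed

text \<open>
  The norm is rational by this definition; the product over the embeddings follows by conjugating
  with the Vandermonde matrix of the roots.
\<close>

definition mult_mat :: "'k \<Rightarrow> rat mat" where
  "mult_mat x = mat d d (\<lambda>(k, j). coord (x * theta ^ j) k)"

definition field_norm :: "'k \<Rightarrow> rat" where "field_norm x = det (mult_mat x)"

lemma field_norm: "of_rat (field_norm x) = (\<Prod>z\<in>Z. sigma z x)"
proof -
  obtain zs where zs: "set zs = Z" "distinct zs" using finite_distinct_list[OF Z_card(1)] by blast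
  have len: "length zs = d" using zs Z_card distinct_card by metis
  define W where "W = mat d d (\<lambda>(i, j). (zs ! i) ^ j)"
  define Dm where "Dm = mat d d (\<lambda>(i, j). if i = j then sigma (zs ! i) x else 0)"
  define Mx where "Mx = map_mat (of_rat :: rat \<Rightarrow> complex) (mult_mat x)"
  have car: "W \<in> carrier_mat d d" "Dm \<in> carrier_mat d d" "Mx \<in> carrier_mat d d"
    by (simp_all add: W_def Dm_def Mx_def mult_mat_def)
  have zZ: "zs ! i \<in> Z" if "i < d" for i using that zs len by (metis nth_mem)
  \<comment> \<open>Row \<open>i\<close> evaluates polynomials in \<open>theta\<close> at the root
    \<open>zs ! i\<close>, which turns multiplication by \<open>x\<close> into multiplication by
    \<open>sigma (zs ! i) x\<close>.\<close>
  have "W * Mx = Dm * W"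
  proof (rule eq_matI)
    show "dim_row (W * Mx) = dim_row (Dm * W)" "dim_col (W * Mx) = dim_col (Dm * W)" using car by auto
    fix i j assume "i < dim_row (Dm * W)" "j < dim_col (Dm * W)"
    then have ij: "i < d" "j < d" using car by auto
    have "(W * Mx) $$ (i, j) = (\<Sum>k<d. zs ! i ^ k * of_rat (coord (x * theta ^ j) k))"
      using ij by (simp add: W_def Mx_def mult_mat_def scalar_prod_def atLeast0LessThan)
    also have "\<dots> = sigma (zs ! i) (x * theta ^ j)" by (simp add: sigma_coord)
    also have "\<dots> = sigma (zs ! i) x * zs ! i ^ j"
      using sigma_eval[OF zZ[OF ij(1)], of "Polynomial.monom 1 j"] sigma_hom(2)[OF zZ[OF ij(1)]] by simp
    also have "\<dots> = (\<Sum>k<d. (if i = k then sigma (zs ! i) x else 0) * zs ! k ^ j)"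
      using ij by (simp add: if_distrib[of "\<lambda>u. u * _"] sum.delta cong: if_cong)
    also have "\<dots> = (Dm * W) $$ (i, j)"
      using ij by (simp add: W_def Dm_def scalar_prod_def atLeast0LessThan)
    finally show "(W * Mx) $$ (i, j) = (Dm * W) $$ (i, j)" .
  qed
  then have "det W * det Mx = det (Dm * W)"
    by (simp only: det_mult[OF car(1,3), symmetric])
  also have "\<dots> = det W * det Dm"
    by (simp only: det_mult[OF car(2,1)] mult.commute)
  finally have WM: "det W * det Mx = det W * det Dm" .
  \<comment> \<open>A kernel vector would consist of the coefficients of a nonzero polynomial of
    degree below \<open>d\<close> with \<open>d\<close> roots.\<close>
  have W0: "det W \<noteq> 0"
  proof
    assume "det W = 0"
    then obtain v where v: "v \<in> carrier_vec d" "v \<noteq> 0\<^sub>v d" "W *\<^sub>v v = 0\<^sub>v d"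
      using det_0_iff_vec_prod_zero[OF car(1)] by blast
    define P where "P = (\<Sum>j<d. Polynomial.monom (v $ j) j)"
    have rP: "poly P (zs ! i) = 0" if "i < d" for i
    proof -
      have "poly P (zs ! i) = (W *\<^sub>v v) $ i"
        using that v(1) by (simp add: P_def poly_sum poly_monom W_def scalar_prod_def atLeast0LessThan mult.commute)
      then show ?thesis using v(3) that by simp
    qed
    have roots: "Z \<subseteq> {z. poly P z = 0}"
    proof
      fix z assume "z \<in> Z"
      then obtain i where "i < d" "zs ! i = z" using zs(1) len by (metis in_set_conv_nth)
      then show "z \<in> {z. poly P z = 0}" using rP by auto
    qed
    have cP: "coeff P j = v $ j" if "j < d" for j
      using that by (simp add: P_def coeff_sum if_distrib sum.delta cong: if_cong)
    have dP: "degree P \<le> d - 1" unfolding P_def by (intro degree_sum_le) (auto intro: order_trans[OF degree_monom_le])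
    have "P = 0"
    proof (rule ccontr)
      assume P: "P \<noteq> 0"
      have "card Z \<le> card {z. poly P z = 0}" using roots poly_roots_finite[OF P] by (intro card_mono) auto
      also have "\<dots> \<le> degree P" by (rule card_poly_roots_bound[OF P])
      finally show False using dP d_pos Z_card by linarith
    qed
    then have "v $ j = 0" if "j < d" for j using cP[OF that] by simp
    then have "v = 0\<^sub>v d" using v(1) by (intro eq_vecI) auto
    then show False using v(2) by blast
  qed
  have "det Mx = det Dm" using WM W0 by simp
  also have "det Dm = prod_list (diag_mat Dm)"
    by (rule det_lower_triangular[OF _ car(2)]) (simp add: Dm_def)
  also have "\<dots> = (\<Prod>i<d. sigma (zs ! i) x)"
    by (simp add: diag_mat_def Dm_def prod.list_conv_set_nth atLeast0LessThan)
  also have "\<dots> = (\<Prod>z\<in>Z. sigma z x)"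
    using bij_betw_nth[OF zs(2), of "{..<d}" Z] len zs(1) by (intro prod.reindex_bij_betw) auto
  finally show ?thesis by (simp add: field_norm_def Mx_def)
qed

lemma sigma_nonzero: "z \<in> Z \<Longrightarrow> x \<noteq> 0 \<Longrightarrow> sigma z x \<noteq> 0"
  using sigma_hom(2)[of z x "inverse x"] sigma_hom(3)[of z] by auto

lemma field_norm_mult: "field_norm (x * y) = field_norm x * field_norm y"
proof -
  have "(of_rat (field_norm (x * y)) :: complex) = of_rat (field_norm x * field_norm y)"
    by (simp add: field_norm of_rat_mult sigma_hom(2) prod.distrib)
  then show ?thesis by (simp only: of_rat_eq_iff)
qed

lemma field_norm_1: "field_norm 1 = 1"
proof -
  have "(of_rat (field_norm 1) :: complex) = of_rat 1"
    by (simp add: field_norm sigma_hom(3))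
  then show ?thesis by (simp only: of_rat_eq_iff)
qed

lemma field_norm_nonzero: "x \<noteq> 0 \<Longrightarrow> field_norm x \<noteq> 0"
  using field_norm_mult[of x "inverse x"] field_norm_1 by auto

lemma field_norm_power: "field_norm (x ^ n) = field_norm x ^ n"
  by (induction n) (simp_all add: field_norm_mult field_norm_1)

text \<open>All powers of \<open>x\<close> are combinations of those below \<open>e\<close> with
  \<open>p\<close>-integral coefficients, so the matrices of all \<open>x ^ n\<close> have
  \<open>p\<close>-adically bounded entries. Hence the powers of the norm are bounded, which forces
  its \<open>p\<close>-adic value to be at most 1.\<close>

lemma field_norm_integral:
  assumes p: "prime p" and e: "e \<ge> 1" and c: "\<And>j. j < e \<Longrightarrow> padic p (c j) \<le> 1"
    and x: "x ^ e = (\<Sum>j<e. of_rat (c j) * x ^ j)"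
  shows "padic p (field_norm x) \<le> 1"
proof (rule ccontr)
  note N = padic_mult_norm[OF p] padic_ultrametric[OF p]
  assume "\<not> ?thesis"
  then have big: "padic p (field_norm x) > 1" by simp
  have comb: "\<exists>b. (\<forall>j<e. padic p (b j) \<le> 1) \<and> x ^ n = (\<Sum>j<e. of_rat (b j) * x ^ j)" for n
  proof (induction n)
    case 0
    have "(\<Sum>j<e. of_rat (if j = 0 then 1 else 0) * x ^ j) = (\<Sum>j<e. if j = 0 then 1 else 0)"
      by (intro sum.cong) auto
    also have "\<dots> = 1" using e by simp
    finally have "x ^ 0 = (\<Sum>j<e. of_rat (if j = 0 then 1 else 0) * x ^ j)" by simp
    then show ?case
      using mult_norm_1[OF N(1)] mult_norm_0[OF N(1)]
      by (intro exI[of _ "\<lambda>j. if j = 0 then 1 else 0"]) auto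
  next
    case (Suc n)
    then obtain b where b: "\<And>j. j < e \<Longrightarrow> padic p (b j) \<le> 1" "x ^ n = (\<Sum>j<e. of_rat (b j) * x ^ j)" by blast
    obtain e' where e': "e = Suc e'" using e by (cases e) auto
    define b' where "b' j = (if j = 0 then 0 else b (j - 1)) + b e' * c j" for j
    have "x ^ Suc n = (\<Sum>j<Suc e'. of_rat (b j) * x ^ Suc j)"
      by (simp only: power_Suc b(2) sum_distrib_left e' mult.left_commute)
    also have "\<dots> = (\<Sum>j<e'. of_rat (b j) * x ^ Suc j) + of_rat (b e') * x ^ e"
      by (simp only: sum.lessThan_Suc e')
    also have "(\<Sum>j<e'. of_rat (b j) * x ^ Suc j) = (\<Sum>j<e. of_rat (if j = 0 then 0 else b (j - 1)) * x ^ j)"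
      unfolding e' sum.lessThan_Suc_shift by simp
    also have "of_rat (b e') * x ^ e = (\<Sum>j<e. of_rat (b e' * c j) * x ^ j)"
      by (simp add: x sum_distrib_left of_rat_mult mult.assoc)
    finally have "x ^ Suc n = (\<Sum>j<e. of_rat (b' j) * x ^ j)"
      by (simp add: b'_def of_rat_add distrib_right sum.distrib)
    moreover have "padic p (b' j) \<le> 1" if "j < e" for j
    proof -
      have "padic p (b e' * c j) \<le> 1 * 1"
        unfolding mult_norm_mult[OF N(1)] using b(1)[of e'] c[OF that] e' mult_norm_nonneg[OF N(1)]
        by (intro mult_mono) auto
      moreover have "padic p (if j = 0 then 0 else b (j - 1)) \<le> 1"
        using b(1)[of "j - 1"] that mult_norm_0[OF N(1)] by auto
      ultimately show ?thesis unfolding b'_def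
        using ultra_add[OF N, of "if j = 0 then 0 else b (j - 1)" "b e' * c j"] by linarith
    qed
    ultimately show ?case by blast
  qed
  define S where "S = insert 1 ((\<lambda>(i, j, k). padic p (coord (x ^ i * theta ^ j) k)) ` ({..<e} \<times> {..<d} \<times> {..<d}))"
  define C where "C = Max S"
  have finS: "finite S" by (simp add: S_def)
  have C1: "C \<ge> 1" unfolding C_def using finS by (intro Max_ge) (auto simp: S_def)
  have C: "padic p (coord (x ^ i * theta ^ j) k) \<le> C" if "i < e" "j < d" "k < d" for i j k
  proof -
    have "(\<lambda>(i, j, k). padic p (coord (x ^ i * theta ^ j) k)) (i, j, k) \<in> S"
      unfolding S_def using that by (intro insertI2 imageI) auto
    then show ?thesis unfolding C_def using finS by (intro Max_ge) simp_all
  qed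
  have entry: "padic p (coord (x ^ n * theta ^ j) k) \<le> C" if jk: "j < d" "k < d" for n j k
  proof -
    obtain b where b: "\<And>j. j < e \<Longrightarrow> padic p (b j) \<le> 1" "x ^ n = (\<Sum>j<e. of_rat (b j) * x ^ j)" using comb by blast
    have "x ^ n * theta ^ j = (\<Sum>i<e. of_rat (b i) * (x ^ i * theta ^ j))"
      by (simp add: b(2) sum_distrib_right mult.assoc)
    then have "coord (x ^ n * theta ^ j) k = (\<Sum>i<e. b i * coord (x ^ i * theta ^ j) k)" by (simp add: coord_sum)
    also have "padic p \<dots> \<le> C"
    proof (rule ultra_sum_le[OF N])
      fix i assume "i \<in> {..<e}"
      then have "padic p (b i) * padic p (coord (x ^ i * theta ^ j) k) \<le> 1 * C"
        using b(1) C jk C1 mult_norm_nonneg[OF N(1)] by (intro mult_mono) auto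
      then show "padic p (b i * coord (x ^ i * theta ^ j) k) \<le> C" by (simp add: mult_norm_mult[OF N(1)])
    qed (use C1 in simp)
    finally show ?thesis .
  qed
  have bound: "padic p (field_norm x) ^ n \<le> C ^ d" for n
  proof -
    have car: "mult_mat (x ^ n) \<in> carrier_mat d d" by (simp add: mult_mat_def)
    have "padic p (det (mult_mat (x ^ n))) \<le> C ^ d"
      unfolding det_def'[OF car]
    proof (rule ultra_sum_le[OF N])
      fix \<pi> assume "\<pi> \<in> {\<pi>. \<pi> permutes {0..<d}}"
      then have pi: "\<pi> i < d" if "i < d" for i using that permutes_in_image[of \<pi> "{0..<d}" i] by auto
      have "padic p (\<Prod>i = 0..<d. mult_mat (x ^ n) $$ (i, \<pi> i)) \<le> (\<Prod>i = 0..<d. C)"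
        unfolding mult_norm_prod[OF N(1)]
        using entry pi mult_norm_nonneg[OF N(1)] by (intro prod_mono) (auto simp: mult_mat_def)
      moreover have "padic p (signof \<pi>) = 1"
        using mult_norm_1[OF N(1)] mult_norm_minus[OF N(1), of 1] by (simp add: sign_def)
      ultimately show "padic p (signof \<pi> * (\<Prod>i = 0..<d. mult_mat (x ^ n) $$ (i, \<pi> i))) \<le> C ^ d"
        by (simp add: mult_norm_mult[OF N(1)])
    qed (use C1 in simp)
    then show ?thesis using field_norm_power[of x n] mult_norm_power[OF N(1)] by (simp add: field_norm_def)
  qed
  obtain n where "C ^ d < padic p (field_norm x) ^ n" using real_arch_pow[OF big] by blast
  then show False using bound[of n] by linarith
qed

lemma field_norm_padic_le:
  assumes "prime p" "\<And>a. a \<in> places_above p \<Longrightarrow> a x \<le> 1"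
  shows "padic p (field_norm x) \<le> 1"
proof -
  obtain e c where "e \<ge> 1" "\<And>j. j < e \<Longrightarrow> padic p (c j) \<le> 1" "x ^ e = (\<Sum>j<e. of_rat (c j) * x ^ j)"
    using integral_of_places[OF nf assms(1), of x] assms(2) by blast
  then show ?thesis by (rule field_norm_integral[OF assms(1)])
qed

end

section \<open>Weak approximation\<close>

lemma place_of_int_unit:
  assumes a: "a \<in> places_above p" and p: "prime p" and n: "\<not> int p dvd n"
  shows "a (of_int n) = 1"
proof (rule antisym)
  note N = places_above_props(1,2)[OF a]
  show "a (of_int n) \<le> 1" by (rule ultra_of_int[OF N])
  show "1 \<le> a (of_int n)"
  proof (rule ccontr)
    assume "\<not> ?thesis"
    then have lt: "a (of_int n) < 1" by simp
    have "coprime (int p) n" using n p by (simp add: prime_imp_coprime)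
    then obtain u v where "u * int p + v * n = 1"
      using bezout_int[of "int p" n] by (auto simp: coprime_iff_gcd_eq_1)
    then have "of_int (u * int p + v * n) = (1 :: 'a)" by simp
    then have e: "of_int u * of_nat p + of_int v * of_int n = (1 :: 'a)" by simp
    have "a (of_int u * of_nat p) < 1"
    proof -
      have "a (of_int u) * a (of_nat p) \<le> 1 * a (of_nat p)"
        using ultra_of_int[OF N] mult_norm_nonneg[OF N(1)] by (intro mult_right_mono) auto
      also have "\<dots> < 1" using prime_gt_1_nat[OF p] by (simp add: places_above_props(3)[OF a])
      finally show ?thesis by (simp add: mult_norm_mult[OF N(1)])
    qed
    moreover have "a (of_int v * of_int n) < 1"
    proof -
      have "a (of_int v) * a (of_int n) \<le> 1 * a (of_int n)"
        using ultra_of_int[OF N] mult_norm_nonneg[OF N(1)] by (intro mult_right_mono) auto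
      also have "\<dots> < 1" using lt by simp
      finally show ?thesis by (simp add: mult_norm_mult[OF N(1)])
    qed
    ultimately have "a (of_int u * of_nat p + of_int v * of_int n) < 1"
      using ultra_add[OF N, of "of_int u * of_nat p" "of_int v * of_int n"] by linarith
    then show False unfolding e using mult_norm_1[OF N(1)] by simp
  qed
qed

lemma place_of_rat:
  assumes a: "a \<in> places_above p" and p: "prime p"
  shows "a (of_rat q) = padic p q"
proof (cases "q = 0")
  case True
  then show ?thesis using mult_norm_0[OF places_above_props(1)[OF a]] by (simp add: padic_def)
next
  case False
  note N = places_above_props(1,2)[OF a]
  have pi: "prime (int p)" using p by simp
  have int: "a (of_int n) = real p powi (- int (multiplicity (int p) n))" if n: "n \<noteq> 0" for n
  proof -
    obtain u where u: "n = int p ^ multiplicity (int p) n * u" "\<not> int p dvd u"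
      using multiplicity_decompose'[of n "int p"] n pi by (metis not_prime_unit)
    have "(of_int n :: 'a) = of_nat p ^ multiplicity (int p) n * of_int u" by (subst u(1)) simp
    then have "a (of_int n) = a (of_nat p) ^ multiplicity (int p) n * a (of_int u)"
      by (simp only: mult_norm_mult[OF N(1)] mult_norm_power[OF N(1)])
    then show ?thesis
      using place_of_int_unit[OF a p u(2)] places_above_props(3)[OF a]
      by (simp add: power_int_minus power_one_over inverse_eq_divide)
  qed
  obtain c b where cb: "quotient_of q = (c, b)" by fastforce
  have q: "q = of_int c / of_int b" "b \<noteq> 0" "c \<noteq> 0"
    using quotient_of_div[OF cb] quotient_of_denom_pos[OF cb] False by auto
  have p0: "real p \<noteq> 0" using prime_gt_0_nat[OF p] by simp
  have "a (of_rat q) = a (of_int c) / a (of_int b)"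
    by (simp add: q(1) of_rat_divide mult_norm_divide[OF N(1)])
  also have "\<dots> = real p powi (int (multiplicity (int p) b) - int (multiplicity (int p) c))"
    unfolding int[OF q(2)] int[OF q(3)] using p0 by (simp add: power_int_diff power_int_minus divide_simps)
  also have "\<dots> = padic p q" unfolding q(1) by (rule padic_of_fraction[OF p q(3,2), symmetric])
  finally show ?thesis .
qed

text \<open>A tie between two terms of an algebraic relation, as in \<open>value_exists\<close>, now
  for an arbitrary ultrametric norm.\<close>

lemma ultrametric_power_relation:
  fixes x :: "'k::field_char_0"
  assumes nf: "number_field TYPE('k)" and N: "mult_norm N" "ultrametric N" and x: "x \<noteq> 0"
  shows "\<exists>n q. n \<ge> 1 \<and> n \<le> field_degree TYPE('k) \<and> q \<noteq> 0 \<and> N x ^ n = N (of_rat q)"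
proof -
  obtain P where P: "P \<noteq> 0" "degree P \<le> field_degree TYPE('k)" "rat_eval P x = 0"
    using algebraic_bounded_degree[OF nf] by blast
  define t where "t i = of_rat (coeff P i) * x ^ i" for i
  have "\<exists>i\<in>{..degree P}. \<exists>j\<in>{..degree P}. i \<noteq> j \<and> t i \<noteq> 0 \<and> t j \<noteq> 0 \<and> N (t i) = N (t j)"
  proof (rule ultrametric_tie[OF N])
    show "\<exists>i\<in>{..degree P}. t i \<noteq> 0" using P(1) x by (intro bexI[of _ "degree P"]) (auto simp: t_def)
    show "(\<Sum>i\<in>{..degree P}. t i) = 0" using P(3) by (simp add: rat_eval_def poly_altdef t_def)
  qed simp
  then obtain i j where ij: "i \<le> degree P" "j \<le> degree P" "i < j" "t i \<noteq> 0" "t j \<noteq> 0" "N (t i) = N (t j)"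
    by (metis atMost_iff linorder_neqE_nat)
  have c0: "coeff P i \<noteq> 0" "coeff P j \<noteq> 0" using ij by (auto simp: t_def)
  have "x ^ j = x ^ i * x ^ (j - i)" using ij by (simp flip: power_add)
  then have "N (of_rat (coeff P i)) * N x ^ i = N (of_rat (coeff P j)) * (N x ^ i * N x ^ (j - i))"
    using ij(6) by (simp add: t_def mult_norm_mult[OF N(1)] mult_norm_power[OF N(1)])
  then have "N (of_rat (coeff P i)) * N x ^ i = (N x ^ (j - i) * N (of_rat (coeff P j))) * N x ^ i"
    by (simp only: mult_ac)
  moreover have "N x ^ i \<noteq> 0" "N (of_rat (coeff P j)) \<noteq> 0" using mult_norm_eq_0[OF N(1)] x c0 by auto
  ultimately have "N x ^ (j - i) * N (of_rat (coeff P j)) = N (of_rat (coeff P i))"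
    using mult_right_cancel[of "N x ^ i"] by metis
  then have "N x ^ (j - i) = N (of_rat (coeff P i)) / N (of_rat (coeff P j))"
    by (rule iffD2[OF nonzero_eq_divide_eq, rotated]) fact
  also have "\<dots> = N (of_rat (coeff P i / coeff P j))" by (simp add: of_rat_divide mult_norm_divide[OF N(1)])
  finally show ?thesis using ij P(2) c0 by (intro exI[of _ "j - i"] exI[of _ "coeff P i / coeff P j"]) auto
qed

text \<open>The exponent from the relation varies with \<open>x\<close> but divides the factorial,
  so the logarithms of all values to base \<open>p\<close> have one common denominator.\<close>

lemma place_discrete:
  fixes x :: "'k::field_char_0"
  assumes nf: "number_field TYPE('k)" and a: "a \<in> places_above p" and p: "prime p" and x: "x \<noteq> 0"
  shows "\<exists>k::int. a x ^ fact (field_degree TYPE('k)) = real p powi k"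
proof -
  obtain n q where nq: "n \<ge> 1" "n \<le> field_degree TYPE('k)" "q \<noteq> 0" "a x ^ n = a (of_rat q)"
    using ultrametric_power_relation[OF nf places_above_props(1,2)[OF a] x] by blast
  obtain k where k: "padic p q = real p powi k" using nq(3) by (simp add: padic_def)
  have "n dvd fact (field_degree TYPE('k))" using nq by (intro dvd_fact) auto
  then obtain r where r: "fact (field_degree TYPE('k)) = n * r" by (elim dvdE)
  have "a x ^ (n * r) = (real p powi k) ^ r" using nq(4) by (simp add: power_mult place_of_rat[OF a p] k)
  then show ?thesis unfolding r by (metis power_int_mult power_int_of_nat)
qed

lemma places_separated:
  fixes a b :: "'k::field_char_0 \<Rightarrow> real"
  assumes nf: "number_field TYPE('k)" and p: "prime p" and ab: "a \<in> places_above p" "b \<in> places_above p" "a \<noteq> b"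
  shows "\<exists>y. y \<noteq> 0 \<and> a y < 1 \<and> 1 < b y"
proof -
  define M where "M = (fact (field_degree TYPE('k)) :: nat)"
  have M: "M \<ge> 1" by (simp add: M_def)
  note A = places_above_props[OF ab(1)] and B = places_above_props[OF ab(2)]
  have p1: "real p > 1" using prime_gt_1_nat[OF p] by simp
  then have p0: "real p \<noteq> 0" by simp
  have pw: "N ((of_nat p :: 'k) powi k) = real p powi (- k)" if "N \<in> places_above p" for N k
    using places_above_props[OF that] by (simp add: mult_norm_power_int power_int_minus power_int_inverse divide_inverse)
  have key: "\<exists>y. y \<noteq> 0 \<and> a y < 1 \<and> 1 < b y" if x: "x \<noteq> 0" "a x < b x" for x
  proof -
    obtain i where i: "a x ^ M = real p powi i" using place_discrete[OF nf ab(1) p x(1)] unfolding M_def by blast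
    obtain j where j: "b x ^ M = real p powi j" using place_discrete[OF nf ab(2) p x(1)] unfolding M_def by blast
    have "a x ^ M < b x ^ M" using x(2) M mult_norm_nonneg[OF A(1)] by (intro power_strict_mono) auto
    then have "i < j" unfolding i j using p1 power_int_increasing[of j i "real p"] by (meson linorder_not_less less_imp_le order_less_le_trans)
    \<comment> \<open>In the power \<open>M\<close> the two values are powers of \<open>p\<close>
      with exponents \<open>i < j\<close>. As \<open>p\<close> has the same value at both places,
      the factor \<open>p ^ (i + j)\<close> shifts the exponents \<open>2 * i\<close> and
      \<open>2 * j\<close> to \<open>i - j\<close> and \<open>j - i\<close>, on either side of
      0.\<close>
    define y where "y = x ^ (2 * M) * of_nat p powi (i + j)"
    have "y \<noteq> 0" using x p1 by (simp add: y_def power_int_not_zero)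
    have m2: "N x ^ (2 * M) = (N x ^ M) * (N x ^ M)" for N :: "'k \<Rightarrow> real" by (simp add: mult_2 power_add)
    have "a y = real p powi (i - j)"
    proof -
      have "a y = (real p powi i * real p powi i) * real p powi (- (i + j))"
        unfolding y_def mult_norm_mult[OF A(1)] mult_norm_power[OF A(1)] pw[OF ab(1)] m2 i ..
      also have "\<dots> = real p powi (i + i + - (i + j))" by (simp only: power_int_add[OF disjI1[OF p0]])
      finally show ?thesis by simp
    qed
    moreover have "b y = real p powi (j - i)"
    proof -
      have "b y = (real p powi j * real p powi j) * real p powi (- (i + j))"
        unfolding y_def mult_norm_mult[OF B(1)] mult_norm_power[OF B(1)] pw[OF ab(2)] m2 j ..
      also have "\<dots> = real p powi (j + j + - (i + j))" by (simp only: power_int_add[OF disjI1[OF p0]])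
      finally show ?thesis by simp
    qed
    moreover have "real p powi (i - j) < real p powi 0" using p1 \<open>i < j\<close> by (intro power_int_strict_increasing) auto
    moreover have "real p powi 0 < real p powi (j - i)" using p1 \<open>i < j\<close> by (intro power_int_strict_increasing) auto
    ultimately show ?thesis using \<open>y \<noteq> 0\<close> by auto
  qed
  obtain x where x: "a x \<noteq> b x" using ab(3) by auto
  have x0: "x \<noteq> 0"
  proof
    assume "x = 0"
    then show False using x mult_norm_0[OF A(1)] mult_norm_0[OF B(1)] by simp
  qed
  show ?thesis
  proof (cases "a x < b x")
    case True
    then show ?thesis using key x0 by blast
  next
    case False
    then have "b x < a x" using x by simp
    then have "inverse (a x) < inverse (b x)" using mult_norm_pos[OF B(1) x0] by simp
    then have "a (inverse x) < b (inverse x)" by (simp only: mult_norm_inverse[OF A(1)] mult_norm_inverse[OF B(1)])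
    then show ?thesis using key[of "inverse x"] x0 by simp
  qed
qed

text \<open>To include \<open>b\<close>, an element \<open>y\<close> separating \<open>a\<close>
  from \<open>b\<close> is multiplied by \<open>x ^ k\<close>, large at \<open>a\<close> and small
  on \<open>W\<close>. If \<open>x\<close> is large at \<open>b\<close> too, the factor
  \<open>x ^ k / (1 + x ^ k)\<close> is used: it has value 1 where \<open>x\<close> is large and
  still tends to 0 on \<open>W\<close>.\<close>

lemma weak_approximation:
  fixes W :: "('k::field_char_0 \<Rightarrow> real) set"
  assumes nf: "number_field TYPE('k)" and p: "prime p" and "finite W" "W \<subseteq> places_above p"
    and a: "a \<in> places_above p" "a \<notin> W"
  shows "\<exists>x. 1 < a x \<and> (\<forall>b\<in>W. b x < 1)"
  using assms(3,4) a(2)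
proof (induction W rule: finite_induct)
  case empty
  have "1 < a (inverse (of_nat p))"
    using prime_gt_1_nat[OF p] by (simp add: mult_norm_inverse[OF places_above_props(1)[OF a(1)]] places_above_props(3)[OF a(1)])
  then show ?case by blast
next
  case (insert b W)
  note A = places_above_props[OF a(1)]
  have bp: "b \<in> places_above p" "b \<noteq> a" using insert.prems by auto
  note Bn = places_above_props[OF bp(1)]
  obtain x where x: "1 < a x" "\<And>c. c \<in> W \<Longrightarrow> c x < 1" using insert by auto
  obtain y where y: "b y < 1" "1 < a y" using places_separated[OF nf p bp(1) a(1) bp(2)] by blast
  have C: "mult_norm c" "ultrametric c" if "c \<in> W" for c using that insert.prems places_above_props by blast+
  have ev: "eventually (\<lambda>k. c x ^ k * c y < 1) sequentially" if c: "c \<in> W" for c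
  proof -
    have "(\<lambda>k. c x ^ k * c y) \<longlonglongrightarrow> 0 * c y"
      using x(2)[OF c] mult_norm_nonneg[OF C(1)[OF c]] by (intro tendsto_mult_right LIMSEQ_realpow_zero) auto
    then have "(\<lambda>k. c x ^ k * c y) \<longlonglongrightarrow> 0" by simp
    from order_tendstoD(2)[OF this, of 1] show ?thesis by simp
  qed
  have "eventually (\<lambda>k. \<forall>c\<in>W. c x ^ k * c y < 1) sequentially"
    using insert.hyps(1) ev by (intro eventually_ball_finite) auto
  then obtain K where K: "\<And>k c. k \<ge> K \<Longrightarrow> c \<in> W \<Longrightarrow> c x ^ k * c y < 1" unfolding eventually_sequentially by blast
  define k where "k = Suc K"
  have kW: "c x ^ k * c y < 1" if "c \<in> W" for c using K[of k c] that by (simp add: k_def)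
  have axk: "a x ^ k > 1" unfolding k_def by (rule one_less_power[OF x(1)]) simp
  show ?case
  proof (cases "b x \<le> 1")
    case True
    define w where "w = x ^ k * y"
    have "1 * 1 < a x ^ k * a y" using axk y(2) by (intro mult_strict_mono) auto
    then have 1: "1 < a w" by (simp add: w_def mult_norm_mult[OF A(1)] mult_norm_power[OF A(1)])
    have "b x ^ k * b y \<le> 1 * b y" using True mult_norm_nonneg[OF Bn(1)] by (intro mult_right_mono power_le_one) auto
    then have 2: "b w < 1" using y(1) by (simp add: w_def mult_norm_mult[OF Bn(1)] mult_norm_power[OF Bn(1)])
    have "c w < 1" if "c \<in> W" for c
      using kW[OF that] by (simp add: w_def mult_norm_mult[OF C(1)[OF that]] mult_norm_power[OF C(1)[OF that]])
    then show ?thesis using 1 2 by blast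
  next
    case False
    define w where "w = x ^ k / (1 + x ^ k) * y"
    have big: "N (x ^ k / (1 + x ^ k)) = 1" if "mult_norm N" "ultrametric N" "N x > 1" for N
    proof -
      have "N x ^ k > 1" unfolding k_def by (rule one_less_power[OF that(3)]) simp
      then have "N 1 < N (x ^ k)" by (simp add: mult_norm_1[OF that(1)] mult_norm_power[OF that(1)])
      then have "N (1 + x ^ k) = N (x ^ k)" by (rule ultra_add_eq[OF that(1,2)])
      moreover have "N (x ^ k) > 0" using \<open>N 1 < N (x ^ k)\<close> mult_norm_nonneg[OF that(1), of 1] by linarith
      ultimately show ?thesis by (simp add: mult_norm_divide[OF that(1)])
    qed
    have 1: "1 < a w" unfolding w_def mult_norm_mult[OF A(1)] using big[OF A(1,2) x(1)] y(2) by simp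
    have 2: "b w < 1" unfolding w_def mult_norm_mult[OF Bn(1)] using big[OF Bn(1,2)] False y(1) by simp
    have "c w < 1" if c: "c \<in> W" for c
    proof -
      have "c x ^ k \<le> c x ^ 1"
        using x(2)[OF c] mult_norm_nonneg[OF C(1)[OF c]] by (intro power_decreasing) (auto simp: k_def)
      then have "c x ^ k < 1" using x(2)[OF c] by simp
      then have "c (x ^ k) < c 1" by (simp add: mult_norm_1[OF C(1)[OF c]] mult_norm_power[OF C(1)[OF c]])
      then have "c (x ^ k + 1) = c 1" by (rule ultra_add_eq[OF C[OF c]])
      then have "c (1 + x ^ k) = 1" by (simp add: mult_norm_1[OF C(1)[OF c]] add.commute)
      then show ?thesis using kW[OF c]
        unfolding w_def mult_norm_mult[OF C(1)[OF c]] mult_norm_divide[OF C(1)[OF c]] mult_norm_power[OF C(1)[OF c]] by simp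
    qed
    then show ?thesis using 1 2 by blast
  qed
qed

text \<open>Elements \<open>e a\<close> of value 1 at \<open>a\<close> and below 1 at the other
  places of \<open>W\<close> are independent over the rationals: in a relation, the coefficient of
  largest \<open>p\<close>-adic value would dominate at its place. So there are at most as many
  places as the field degree.\<close>

lemma places_above_finite:
  assumes nf: "number_field TYPE('k::field_char_0)" and p: "prime p"
  shows "finite (places_above p :: ('k \<Rightarrow> real) set)"
proof -
  have bd: "card W \<le> field_degree TYPE('k)" if W: "finite W" "W \<subseteq> places_above p" for W :: "('k \<Rightarrow> real) set"
  proof -
    have "\<exists>e. a e = 1 \<and> (\<forall>b\<in>W - {a}. b e < 1)" if a: "a \<in> W" for a
    proof -
      have ap: "a \<in> places_above p" using a W by blast
      note A = places_above_props[OF ap]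
      obtain x where x: "1 < a x" "\<And>b. b \<in> W - {a} \<Longrightarrow> b x < 1"
        using weak_approximation[OF nf p _ _ ap, of "W - {a}"] W by auto
      have "a 1 < a x" using x(1) mult_norm_1[OF A(1)] by simp
      then have "a (1 + x) = a x" by (rule ultra_add_eq[OF A(1,2)])
      then have 1: "a (x / (1 + x)) = 1" using x(1) by (simp add: mult_norm_divide[OF A(1)])
      have "b (x / (1 + x)) < 1" if b: "b \<in> W - {a}" for b
      proof -
        have "b \<in> places_above p" using b W by blast
        note Bn = places_above_props[OF this]
        have "b x < b 1" using x(2)[OF b] mult_norm_1[OF Bn(1)] by simp
        then have "b (x + 1) = b 1" by (rule ultra_add_eq[OF Bn(1,2)])
        then show ?thesis using x(2)[OF b] mult_norm_1[OF Bn(1)] by (simp add: mult_norm_divide[OF Bn(1)] add.commute)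
      qed
      then show ?thesis using 1 by blast
    qed
    then obtain e where e: "\<And>a. a \<in> W \<Longrightarrow> a (e a) = 1" "\<And>a b. a \<in> W \<Longrightarrow> b \<in> W \<Longrightarrow> b \<noteq> a \<Longrightarrow> b (e a) < 1"
      by (metis DiffI singletonD)
    have inj: "inj_on e W"
    proof (rule inj_onI)
      fix a b assume ab: "a \<in> W" "b \<in> W" "e a = e b"
      show "a = b" using e(1)[OF ab(2)] e(2)[OF ab(1,2)] ab(3) by auto
    qed
    have "rat_vs.independent (e ` W)"
    proof (rule ccontr)
      assume "\<not> ?thesis"
      then obtain u where u: "\<exists>v\<in>e ` W. u v \<noteq> 0" "(\<Sum>v\<in>e ` W. rat_scale (u v) v) = 0"
        using rat_vs.dependent_finite[of "e ` W"] W(1) by auto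
      define c where "c a = u (e a)" for a
      have c0: "\<exists>a\<in>W. c a \<noteq> 0" using u(1) by (auto simp: c_def)
      have sum: "(\<Sum>a\<in>W. of_rat (c a) * e a) = 0" using u(2) inj by (simp add: sum.reindex rat_scale_def c_def)
      have "Max ((\<lambda>a. padic p (c a)) ` W) \<in> (\<lambda>a. padic p (c a)) ` W" using W(1) c0 by (intro Max_in) auto
      then obtain a where a0: "a \<in> W" "padic p (c a) = Max ((\<lambda>a. padic p (c a)) ` W)" by auto
      then have a: "a \<in> W" "\<And>b. b \<in> W \<Longrightarrow> padic p (c b) \<le> padic p (c a)" using W(1) by auto
      have ap: "a \<in> places_above p" using a W by blast
      note A = places_above_props[OF ap]
      note P = padic_mult_norm[OF p]
      have pos: "padic p (c a) > 0"
      proof -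
        obtain b where b: "b \<in> W" "c b \<noteq> 0" using c0 by blast
        then show ?thesis using mult_norm_pos[OF P b(2)] a(2)[OF b(1)] by linarith
      qed
      have "a (\<Sum>b\<in>W - {a}. of_rat (c b) * e b) < padic p (c a)"
      proof (rule ultra_sum_less[OF A(1,2) _ pos])
        fix b assume b: "b \<in> W - {a}"
        have lt: "a (e b) < 1" using e(2)[of b a] b a(1) by auto
        have "a (of_rat (c b) * e b) = padic p (c b) * a (e b)"
          by (simp add: mult_norm_mult[OF A(1)] place_of_rat[OF ap p])
        also have "\<dots> \<le> padic p (c a) * a (e b)" using a(2) b mult_norm_nonneg[OF A(1)] by (intro mult_right_mono) auto
        also have "\<dots> < padic p (c a)" using lt pos by simp
        finally show "a (of_rat (c b) * e b) < padic p (c a)" .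
      qed
      moreover have "(\<Sum>b\<in>W - {a}. of_rat (c b) * e b) = - (of_rat (c a) * e a)"
        using sum a(1) W(1) by (simp add: sum.remove eq_neg_iff_add_eq_0 add.commute)
      moreover have "a (- (of_rat (c a) * e a)) = padic p (c a)"
        using e(1)[OF a(1)] by (simp only: mult_norm_minus[OF A(1)] mult_norm_mult[OF A(1)] place_of_rat[OF ap p] mult_1_right)
      ultimately show False by simp
    qed
    from finite_dim_bound(2)[OF nf this] inj show ?thesis by (simp add: card_image)
  qed
  show ?thesis
    by (rule finite_if_finite_subsets_card_bdd[THEN conjunct1]) (use bd in blast)
qed

section \<open>The product formula\<close>

context primitive_elt begin

lemma padic_norm_ge:
  assumes p: "prime p" and x: "x \<noteq> 0" "\<And>a. a \<in> places_above p \<Longrightarrow> 1 \<le> a x"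
  shows "1 \<le> padic p (field_norm x)"
proof -
  note P = padic_mult_norm[OF p]
  have "padic p (field_norm (inverse x)) \<le> 1"
  proof (rule field_norm_padic_le[OF p])
    fix a :: "'k \<Rightarrow> real" assume a: "a \<in> places_above p"
    note A = places_above_props(1)[OF a]
    show "a (inverse x) \<le> 1" using x(2)[OF a] by (simp add: mult_norm_inverse[OF A] inverse_le_1_iff)
  qed
  moreover have "padic p (field_norm x) * padic p (field_norm (inverse x)) = 1"
    using x(1) field_norm_mult[of x "inverse x"] field_norm_1 mult_norm_1[OF P] by (simp flip: mult_norm_mult[OF P])
  moreover have "padic p (field_norm x) \<ge> 0" by (rule mult_norm_nonneg[OF P])
  ultimately show ?thesis using mult_left_le[of "padic p (field_norm (inverse x))" "padic p (field_norm x)"] by linarith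
qed

lemma padic_norm_eq_1:
  assumes p: "prime p" and x: "x \<noteq> 0" "\<And>a. a \<in> places_above p \<Longrightarrow> a x = 1"
  shows "padic p (field_norm x) = 1"
  using padic_norm_ge[OF p x(1)] field_norm_padic_le[OF p, of x] x(2) by force

text \<open>Adding 1 to the element from weak approximation turns values below 1 into 1 and leaves
  the value above 1 unchanged.\<close>

lemma local_units_exist:
  assumes p: "prime p"
  shows "\<exists>\<pi>. \<forall>a\<in>(places_above p :: ('k \<Rightarrow> real) set). 1 < a (\<pi> a) \<and> (\<forall>b\<in>places_above p. b \<noteq> a \<longrightarrow> b (\<pi> a) = 1)"
proof -
  have "\<exists>y. 1 < a y \<and> (\<forall>b\<in>places_above p. b \<noteq> a \<longrightarrow> b y = 1)" if a: "a \<in> places_above p" for a :: "'k \<Rightarrow> real"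
  proof -
    note A = places_above_props[OF a]
    obtain x where x: "1 < a x" "\<And>b. b \<in> places_above p - {a} \<Longrightarrow> b x < 1"
      using weak_approximation[OF nf p _ _ a, of "places_above p - {a}"] places_above_finite[OF nf p] by auto
    have "a 1 < a x" using x(1) mult_norm_1[OF A(1)] by simp
    then have "a (1 + x) = a x" by (rule ultra_add_eq[OF A(1,2)])
    moreover have "b (1 + x) = 1" if b: "b \<in> places_above p - {a}" for b
    proof -
      have "b \<in> places_above p" using b by blast
      note Bn = places_above_props[OF this]
      have "b x < b 1" using x(2)[OF b] mult_norm_1[OF Bn(1)] by simp
      then have "b (x + 1) = b 1" by (rule ultra_add_eq[OF Bn(1,2)])
      then show ?thesis using mult_norm_1[OF Bn(1)] by (simp add: add.commute)
    qed
    ultimately show ?thesis using x(1) by (intro exI[of _ "1 + x"]) auto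
  qed
  then have "\<forall>a\<in>(places_above p :: ('k \<Rightarrow> real) set). \<exists>y. 1 < a y \<and> (\<forall>b\<in>places_above p. b \<noteq> a \<longrightarrow> b y = 1)" by blast
  then show ?thesis by (rule bchoice)
qed

text \<open>The \<open>\<pi> a\<close> diagonalise the vectors of values. As the values are powers
  of \<open>p\<close> with a common denominator in the exponents, a power of \<open>x\<close> times
  powers of the \<open>\<pi> a\<close> has value 1 at every place above \<open>p\<close>, hence a
  norm of \<open>p\<close>-adic value 1. Logarithms then express the norm of \<open>x\<close>
  through those of the \<open>\<pi> a\<close>, which supply the weights.\<close>

lemma norm_factorization:
  assumes p: "prime p"
  shows "\<exists>w. (\<forall>a\<in>places_above p. 0 \<le> w a) \<and>
    (\<forall>x. x \<noteq> 0 \<longrightarrow> ln (padic p (field_norm x)) = (\<Sum>a\<in>places_above p. w a * ln (a x)))"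
proof -
  define A where "A = (places_above p :: ('k \<Rightarrow> real) set)"
  have finA: "finite A" unfolding A_def by (rule places_above_finite[OF nf p])
  note P = padic_mult_norm[OF p]
  define M where "M = (fact (field_degree TYPE('k)) :: nat)"
  have M: "real M > 0" by (simp add: M_def)
  have p1: "real p > 1" using prime_gt_1_nat[OF p] by simp
  have N: "mult_norm a" if "a \<in> A" for a using that places_above_props(1) by (auto simp: A_def)
  obtain \<pi> where \<pi>: "\<And>a. a \<in> A \<Longrightarrow> 1 < a (\<pi> a)" "\<And>a b. a \<in> A \<Longrightarrow> b \<in> A \<Longrightarrow> b \<noteq> a \<Longrightarrow> b (\<pi> a) = 1"
    using local_units_exist[OF p] unfolding A_def by blast
  have \<pi>0: "\<pi> a \<noteq> 0" if "a \<in> A" for a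
  proof
    assume "\<pi> a = 0"
    then show False using \<pi>(1)[OF that] mult_norm_0[OF N[OF that]] by simp
  qed
  define w where "w a = ln (padic p (field_norm (\<pi> a))) / ln (a (\<pi> a))" for a
  have "\<exists>k::int. a x ^ M = real p powi k" if "a \<in> A" "x \<noteq> 0" for a x
    using place_discrete[OF nf _ p that(2)] that(1) unfolding A_def M_def by blast
  then obtain v :: "('k \<Rightarrow> real) \<Rightarrow> 'k \<Rightarrow> int" where v: "\<And>a x. a \<in> A \<Longrightarrow> x \<noteq> 0 \<Longrightarrow> a x ^ M = real p powi v a x"
    by metis
  have lnv: "real M * ln (a x) = real_of_int (v a x) * ln (real p)" if "a \<in> A" "x \<noteq> 0" for a x
  proof -
    have "ln (a x ^ M) = ln (real p powi v a x)" using v[OF that] by simp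
    then show ?thesis using p1 by (simp add: ln_realpow powr_real_of_int'[symmetric] ln_powr)
  qed
  define c where "c a = v a (\<pi> a)" for a
  have c_pos: "c a > 0" if a: "a \<in> A" for a
  proof -
    have "0 < real M * ln (a (\<pi> a))" using \<pi>(1)[OF a] M by simp
    then have "0 < real_of_int (c a) * ln (real p)" using lnv[OF a \<pi>0[OF a]] by (simp add: c_def)
    then show ?thesis using p1 by (simp add: zero_less_mult_iff)
  qed
  have w0: "0 \<le> w a" if a: "a \<in> A" for a
  proof -
    have "1 \<le> padic p (field_norm (\<pi> a))"
    proof (rule padic_norm_ge[OF p \<pi>0[OF a]])
      fix b :: "'k \<Rightarrow> real" assume "b \<in> places_above p"
      then show "1 \<le> b (\<pi> a)" using \<pi>(1)[OF a] \<pi>(2)[OF a, of b] by (cases "b = a") (auto simp: A_def)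
    qed
    then show ?thesis using \<pi>(1)[OF a] by (simp add: w_def)
  qed
  have "ln (padic p (field_norm x)) = (\<Sum>a\<in>A. w a * ln (a x))" if x: "x \<noteq> 0" for x
  proof -
    \<comment> \<open>A common multiple of the exponents \<open>c a\<close>, so that the equations
      \<open>c a * e a = v a x * C\<close> have integer solutions \<open>e a\<close>.\<close>
    define C where "C = (\<Prod>a\<in>A. c a)"
    have C: "C > 0" unfolding C_def using c_pos by (intro prod_pos) auto
    define e where "e a = v a x * (\<Prod>b\<in>A - {a}. c b)" for a
    have ce: "c a * e a = v a x * C" if "a \<in> A" for a
      using that finA by (simp add: e_def C_def prod.remove mult_ac)
    define y where "y = x powi C * (\<Prod>a\<in>A. \<pi> a powi (- e a))"
    have y0: "y \<noteq> 0" using x \<pi>0 finA by (auto simp: y_def power_int_not_zero)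
    have "a y = 1" if a: "a \<in> A" for a
    proof -
      note Na = N[OF a]
      have "a (\<Prod>b\<in>A. \<pi> b powi (- e b)) = (\<Prod>b\<in>A. a (\<pi> b) powi (- e b))"
        by (simp only: mult_norm_prod[OF Na] mult_norm_power_int[OF Na])
      also have "\<dots> = a (\<pi> a) powi (- e a) * (\<Prod>b\<in>A - {a}. a (\<pi> b) powi (- e b))"
        using a finA by (rule prod.remove[rotated])
      also have "(\<Prod>b\<in>A - {a}. a (\<pi> b) powi (- e b)) = 1"
      proof (intro prod.neutral ballI)
        fix b assume "b \<in> A - {a}"
        then show "a (\<pi> b) powi (- e b) = 1" using \<pi>(2)[of b a] a by auto
      qed
      finally have "a y = a x powi C * a (\<pi> a) powi (- e a)"
        by (simp add: y_def mult_norm_mult[OF Na] mult_norm_power_int[OF Na])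
      moreover have pos: "a x > 0" "a (\<pi> a) > 0" using mult_norm_pos[OF Na] x \<pi>0[OF a] by auto
      ultimately have "ln (a y) = real_of_int C * ln (a x) - real_of_int (e a) * ln (a (\<pi> a))"
        by (simp add: ln_mult ln_powr powr_real_of_int'[symmetric])
      then have "real M * ln (a y) = real_of_int C * (real M * ln (a x)) - real_of_int (e a) * (real M * ln (a (\<pi> a)))"
        by (simp only: right_diff_distrib mult.left_commute)
      also have "\<dots> = (real_of_int (v a x * C) - real_of_int (c a * e a)) * ln (real p)"
        unfolding lnv[OF a x] lnv[OF a \<pi>0[OF a]] c_def by (simp add: algebra_simps)
      also have "\<dots> = 0" by (simp add: ce[OF a])
      finally have "ln (a y) = 0" using M by simp
      then show ?thesis using mult_norm_pos[OF Na y0] by simp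
    qed
    then have ny: "padic p (field_norm y) = 1" using padic_norm_eq_1[OF p y0] by (simp add: A_def)
    define L where "L z = ln (padic p (field_norm z))" for z
    have Lm: "L (u * z) = L u + L z" if "u \<noteq> 0" "z \<noteq> 0" for u z
      using mult_norm_pos[OF P field_norm_nonzero[OF that(1)]] mult_norm_pos[OF P field_norm_nonzero[OF that(2)]]
      by (simp add: L_def field_norm_mult mult_norm_mult[OF P] ln_mult)
    have L1: "L 1 = 0" by (simp add: L_def field_norm_1 mult_norm_1[OF P])
    have Lpow: "L (u ^ n) = real n * L u" if "u \<noteq> 0" for u n
      using that by (induction n) (simp_all add: L1 Lm algebra_simps)
    have Linv: "L (inverse u) = - L u" if "u \<noteq> 0" for u
      using Lm[of u "inverse u"] that L1 by simp
    have Lpowi: "L (u powi k) = real_of_int k * L u" if "u \<noteq> 0" for u k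
      using that Lpow[of u] Lpow[of "inverse u"] Linv[of u] by (simp add: power_int_def)
    have Lprod: "L (\<Prod>a\<in>A'. f a) = (\<Sum>a\<in>A'. L (f a))" if "\<And>a. a \<in> A' \<Longrightarrow> f a \<noteq> 0" "finite A'" for A' and f :: "('k \<Rightarrow> real) \<Rightarrow> 'k"
      using that(2,1) by (induction A' rule: finite_induct) (simp_all add: L1 Lm)
    have "0 = L y" using ny by (simp add: L_def)
    also have "\<dots> = L (x powi C) + L (\<Prod>a\<in>A. \<pi> a powi (- e a))"
      unfolding y_def using x \<pi>0 finA by (intro Lm) (auto simp: power_int_not_zero)
    also have "L (\<Prod>a\<in>A. \<pi> a powi (- e a)) = (\<Sum>a\<in>A. L (\<pi> a powi (- e a)))"
      using \<pi>0 finA by (intro Lprod) (auto simp: power_int_not_zero)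
    also have "\<dots> = (\<Sum>a\<in>A. - (real_of_int (e a) * L (\<pi> a)))"
      using \<pi>0 by (intro sum.cong) (auto simp: Lpowi simp del: power_int_minus)
    finally have "real_of_int C * L x = (\<Sum>a\<in>A. real_of_int (e a) * L (\<pi> a))"
      using x by (simp add: Lpowi sum_negf)
    also have "\<dots> = (\<Sum>a\<in>A. real_of_int C * (w a * ln (a x)))"
    proof (intro sum.cong refl)
      fix a assume a: "a \<in> A"
      have lp: "ln (a (\<pi> a)) > 0" using \<pi>(1)[OF a] by simp
      have "real_of_int (c a) * (real M * ln (a x)) = real_of_int (v a x) * (real M * ln (a (\<pi> a)))"
        unfolding lnv[OF a x] lnv[OF a \<pi>0[OF a]] c_def by simp
      then have 1: "real_of_int (c a) * ln (a x) = real_of_int (v a x) * ln (a (\<pi> a))" using M by simp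
      have "real_of_int (c a) * (real_of_int C * ln (a x)) = real_of_int (c a) * (real_of_int (e a) * ln (a (\<pi> a)))"
      proof -
        have "real_of_int (c a) * (real_of_int C * ln (a x)) = real_of_int C * (real_of_int (v a x) * ln (a (\<pi> a)))"
          by (simp only: mult.left_commute 1)
        also have "\<dots> = real_of_int (v a x * C) * ln (a (\<pi> a))" by simp
        also have "\<dots> = real_of_int (c a) * (real_of_int (e a) * ln (a (\<pi> a)))" by (simp flip: ce[OF a])
        finally show ?thesis .
      qed
      then have 2: "real_of_int C * ln (a x) = real_of_int (e a) * ln (a (\<pi> a))" using c_pos[OF a] by simp
      have "real_of_int C * (w a * ln (a x)) = w a * (real_of_int C * ln (a x))" by simp
      also have "\<dots> = real_of_int (e a) * (w a * ln (a (\<pi> a)))" unfolding 2 by simp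
      also have "w a * ln (a (\<pi> a)) = L (\<pi> a)" using lp by (simp add: w_def L_def)
      finally show "real_of_int (e a) * L (\<pi> a) = real_of_int C * (w a * ln (a x))" by simp
    qed
    also have "\<dots> = real_of_int C * (\<Sum>a\<in>A. w a * ln (a x))" by (simp add: sum_distrib_left)
    finally show ?thesis using C by (simp add: L_def)
  qed
  then show ?thesis using w0 unfolding A_def by blast
qed

end

lemma of_rat_powi: "of_rat (x powi k) = (of_rat x powi k :: 'a::field_char_0)"
  by (simp add: power_int_def of_rat_power of_rat_inverse)

text \<open>Removing the primes of \<open>Q\<close> from \<open>q\<close> leaves a rational
  \<open>u\<close> that is integral at all primes, that is, a nonzero integer; its absolute value is
  the product in question.\<close>

lemma rat_product_ge_1:
  assumes fin: "finite Q" and Q: "\<And>p. p \<in> Q \<Longrightarrow> prime p" and q: "q \<noteq> 0"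
    and le: "\<And>p. prime p \<Longrightarrow> p \<notin> Q \<Longrightarrow> padic p q \<le> 1"
  shows "1 \<le> \<bar>real_of_rat q\<bar> * (\<Prod>p\<in>Q. padic p q)"
proof -
  define v where "v p = (int (multiplicity (int p) (snd (quotient_of q))) - int (multiplicity (int p) (fst (quotient_of q))))" for p
  have pv: "padic p q = real p powi v p" for p using q by (simp add: padic_def v_def)
  define u where "u = q * (\<Prod>p\<in>Q. of_nat p powi v p)"
  have pu: "padic l u = padic l q * (\<Prod>p\<in>Q. padic l (of_nat p) powi v p)" if l: "prime l" for l
    unfolding u_def by (simp only: mult_norm_mult[OF padic_mult_norm[OF l]] mult_norm_prod[OF padic_mult_norm[OF l]] mult_norm_power_int[OF padic_mult_norm[OF l]])
  have pp: "padic l (of_nat p) = 1" if "prime l" "prime p" "l \<noteq> p" for l p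
  proof -
    have "\<not> int l dvd int p" using that primes_dvd_imp_eq by (metis int_dvd_int_iff)
    then show ?thesis using padic_of_int_eq_1[OF that(1), of "int p"] by simp
  qed
  have "padic l u \<le> 1" if l: "prime l" for l
  proof (cases "l \<in> Q")
    case False
    have "(\<Prod>p\<in>Q. padic l (of_nat p) powi v p) = 1"
    proof (intro prod.neutral ballI)
      fix p assume "p \<in> Q"
      then show "padic l (of_nat p) powi v p = 1" using False Q pp[OF l, of p] by fastforce
    qed
    then show ?thesis using le[OF l False] by (simp add: pu[OF l])
  next
    case True
    have "(\<Prod>p\<in>Q. padic l (of_nat p) powi v p) = padic l (of_nat l) powi v l * (\<Prod>p\<in>Q - {l}. padic l (of_nat p) powi v p)"
      using fin True by (rule prod.remove)
    also have "(\<Prod>p\<in>Q - {l}. padic l (of_nat p) powi v p) = 1"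
    proof (intro prod.neutral ballI)
      fix p assume "p \<in> Q - {l}"
      then show "padic l (of_nat p) powi v p = 1" using Q pp[OF l, of p] by fastforce
    qed
    also have "padic l (of_nat l) = inverse (real l)" using padic_prime[OF l] by (simp add: inverse_eq_divide)
    finally have "padic l u = padic l q * inverse (real l) powi v l" by (simp add: pu[OF l])
    then show ?thesis using prime_gt_0_nat[OF l] by (simp add: pv power_int_inverse)
  qed
  note integral = this
  have u0: "u \<noteq> 0" using q Q fin prime_gt_0_nat by (auto simp: u_def power_int_not_zero)
  obtain a b where ab: "quotient_of u = (a, b)" by fastforce
  have cop: "coprime a b" and b: "b > 0" and uab: "u = of_int a / of_int b"
    using quotient_of_coprime[OF ab] quotient_of_denom_pos[OF ab] quotient_of_div[OF ab] by auto
  have a0: "a \<noteq> 0" using u0 uab by auto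
  have "b = 1"
  proof (rule ccontr)
    assume "b \<noteq> 1"
    then have "nat b \<noteq> 1" "nat b > 0" using b by auto
    then obtain l where l: "prime l" "l dvd nat b" using prime_factor_nat by blast
    then have ld: "int l dvd b" using b by (metis int_dvd_int_iff int_nat_eq less_imp_le)
    then have na: "\<not> int l dvd a" using cop l(1) by (meson coprime_common_divisor not_prime_unit prime_int_nat_transfer prime_nat_int_transfer)
    have "multiplicity (int l) b \<ge> 1" using ld b l by (intro multiplicity_geI) (auto simp: prime_gt_1_int)
    moreover have "multiplicity (int l) a = 0" using na by (rule not_dvd_imp_multiplicity_0)
    ultimately have "real l powi 1 \<le> padic l u"
      unfolding uab padic_of_fraction[OF l(1) a0 less_imp_neq[OF b, symmetric]]
      using prime_ge_1_nat[OF l(1)] by (intro power_int_increasing) auto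
    then show False using integral[OF l(1)] prime_gt_1_nat[OF l(1)] by simp
  qed
  then have "real_of_rat u = real_of_int a" by (simp add: uab)
  then have "1 \<le> \<bar>real_of_rat u\<bar>" using a0 by simp
  also have "real_of_rat u = real_of_rat q * (\<Prod>p\<in>Q. real p powi v p)"
    by (simp add: u_def of_rat_mult of_rat_prod of_rat_powi)
  also have "\<bar>\<dots>\<bar> = \<bar>real_of_rat q\<bar> * (\<Prod>p\<in>Q. padic p q)"
    by (simp add: abs_mult pv abs_prod)
  finally show ?thesis .
qed

lemma rat_product_eq_1:
  assumes fin: "finite Q" and Q: "\<And>p. p \<in> Q \<Longrightarrow> prime p" and q: "q \<noteq> 0"
    and le: "\<And>p. prime p \<Longrightarrow> p \<notin> Q \<Longrightarrow> padic p q = 1"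
  shows "\<bar>real_of_rat q\<bar> * (\<Prod>p\<in>Q. padic p q) = 1"
proof -
  have i: "padic p (inverse q) = inverse (padic p q)" if "prime p" for p
    by (rule mult_norm_inverse[OF padic_mult_norm[OF that]])
  define x where "x = \<bar>real_of_rat q\<bar> * (\<Prod>p\<in>Q. padic p q)"
  have "1 \<le> x" unfolding x_def using rat_product_ge_1[OF fin Q q] le by force
  moreover have "1 \<le> \<bar>real_of_rat (inverse q)\<bar> * (\<Prod>p\<in>Q. padic p (inverse q))"
    using q le i by (intro rat_product_ge_1[OF fin Q]) auto
  then have "1 \<le> inverse x"
    using i Q by (simp add: x_def of_rat_inverse abs_inverse prod_inversef[symmetric] cong: prod.cong)
  ultimately show ?thesis unfolding x_def[symmetric] by (simp add: one_le_inverse_iff)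
qed

lemma finite_nonunit_primes_rat:
  assumes "q \<noteq> (0::rat)"
  shows "finite {p. prime p \<and> padic p q \<noteq> 1}"
proof -
  obtain a b where ab: "quotient_of q = (a, b)" by fastforce
  have q: "q = of_int a / of_int b" "b \<noteq> 0" "a \<noteq> 0"
    using quotient_of_div[OF ab] quotient_of_denom_pos[OF ab] assms by auto
  have "{p. prime p \<and> padic p q \<noteq> 1} \<subseteq> {p. p dvd nat \<bar>a * b\<bar>}"
  proof
    fix p assume "p \<in> {p. prime p \<and> padic p q \<noteq> 1}"
    then have p: "prime p" "padic p q \<noteq> 1" by auto
    have "int p dvd a \<or> int p dvd b"
    proof (rule ccontr)
      assume "\<not> ?thesis"
      then have "padic p q = 1" unfolding q(1) mult_norm_divide[OF padic_mult_norm[OF p(1)]]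
        using padic_of_int_eq_1[OF p(1)] by simp
      then show False using p by blast
    qed
    then have "int p dvd a * b" by auto
    then show "p \<in> {p. p dvd nat \<bar>a * b\<bar>}" by (simp add: nat_dvd_iff flip: int_dvd_int_iff)
  qed
  moreover have "finite {p. p dvd nat \<bar>a * b\<bar>}" using q by (intro finite_divisors_nat) auto
  ultimately show ?thesis by (rule finite_subset)
qed

text \<open>At a prime where all nonzero coefficients of an algebraic relation for \<open>x\<close>
  are units, a tie between two terms reads \<open>a x ^ (j - i) = 1\<close>.\<close>

lemma finite_nonunit_primes:
  fixes x :: "'k::field_char_0"
  assumes nf: "number_field TYPE('k)" and x: "x \<noteq> 0"
  shows "finite {p. prime p \<and> (\<exists>a\<in>places_above p. a x \<noteq> 1)}"
proof -
  obtain P where P: "P \<noteq> 0" "degree P \<le> field_degree TYPE('k)" "rat_eval P x = 0"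
    using algebraic_bounded_degree[OF nf] by blast
  define I where "I = {i. i \<le> degree P \<and> coeff P i \<noteq> 0}"
  have finI: "finite I" by (simp add: I_def)
  have "{p. prime p \<and> (\<exists>a\<in>places_above p. a x \<noteq> 1)} \<subseteq> (\<Union>i\<in>I. {p. prime p \<and> padic p (coeff P i) \<noteq> 1})"
  proof
    fix p assume "p \<in> {p. prime p \<and> (\<exists>a\<in>places_above p. a x \<noteq> 1)}"
    then obtain a :: "'k \<Rightarrow> real" where p: "prime p" and a: "a \<in> places_above p" "a x \<noteq> 1" by auto
    note N = places_above_props[OF a(1)]
    define t where "t i = of_rat (coeff P i) * x ^ i" for i
    have "\<exists>i\<in>{..degree P}. \<exists>j\<in>{..degree P}. i \<noteq> j \<and> t i \<noteq> 0 \<and> t j \<noteq> 0 \<and> a (t i) = a (t j)"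
    proof (rule ultrametric_tie[OF N(1,2)])
      show "\<exists>i\<in>{..degree P}. t i \<noteq> 0" using P(1) x by (intro bexI[of _ "degree P"]) (auto simp: t_def)
      show "(\<Sum>i\<in>{..degree P}. t i) = 0" using P(3) by (simp add: rat_eval_def poly_altdef t_def)
    qed simp
    then obtain i j where ij: "i \<le> degree P" "j \<le> degree P" "i < j" "t i \<noteq> 0" "t j \<noteq> 0" "a (t i) = a (t j)"
      by (metis atMost_iff linorder_neqE_nat)
    have c0: "i \<in> I" "j \<in> I" using ij by (auto simp: t_def I_def)
    show "p \<in> (\<Union>i\<in>I. {p. prime p \<and> padic p (coeff P i) \<noteq> 1})"
    proof (rule ccontr)
      assume "\<not> ?thesis"
      then have "padic p (coeff P i) = 1" "padic p (coeff P j) = 1" using p c0 by auto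
      then have "a x ^ i = a x ^ j"
        using ij(6) by (simp add: t_def mult_norm_mult[OF N(1)] mult_norm_power[OF N(1)] place_of_rat[OF a(1) p])
      moreover have "a x ^ j = a x ^ i * a x ^ (j - i)" using ij by (simp flip: power_add)
      moreover have ax: "a x > 0" using mult_norm_pos[OF N(1) x] .
      ultimately have "a x ^ (j - i) = 1" by simp
      then have "a x = 1" using ax ij(3) power_eq_1_iff[of "a x" "j - i"] by auto
      then show False using a(2) by blast
    qed
  qed
  moreover have "finite (\<Union>i\<in>I. {p. prime p \<and> padic p (coeff P i) \<noteq> 1})"
    using finI finite_nonunit_primes_rat by (intro finite_UN_I) (auto simp: I_def)
  ultimately show ?thesis by (rule finite_subset)
qed

section \<open>The unit equation\<close>

abbreviation place_of :: "('k::field \<Rightarrow> real) \<Rightarrow> ('k \<Rightarrow> real) set" where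
  "place_of a \<equiv> absolute_value_rel `` {a}"

lemma place_of_in_places: "a \<in> nontrivial_absolute_values \<Longrightarrow> place_of a \<in> places"
  unfolding places_def by (rule quotientI)

lemma mem_place_of: "a \<in> nontrivial_absolute_values \<Longrightarrow> a \<in> place_of a"
  using equiv_absolute_value_rel by (rule equiv_class_self)

lemma place_of_eqD:
  assumes "place_of a = place_of b" "b \<in> nontrivial_absolute_values"
  shows "\<exists>c>0. \<forall>x. b x = a x powr c"
  using eq_equiv_class[OF assms(1) equiv_absolute_value_rel assms(2)]
  unfolding absolute_value_rel_def by blast

text \<open>The exponents will be weights known only to be nonnegative; exponent 0 is harmless
  because \<open>0 powr 0 = 0\<close>.\<close>

lemma mult_norm_powr:
  assumes N: "mult_norm a" "ultrametric a" and c: "0 \<le> c"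
  shows "mult_norm (\<lambda>x. a x powr c)" "ultrametric (\<lambda>x. a x powr c)"
proof -
  show "mult_norm (\<lambda>x. a x powr c)"
    unfolding mult_norm_def
    by (simp add: mult_norm_mult[OF N(1)] powr_mult mult_norm_nonneg[OF N(1)] mult_norm_eq_0[OF N(1)])
  have "a (x + y) powr c \<le> max (a x powr c) (a y powr c)" for x y
  proof -
    have "a (x + y) powr c \<le> (max (a x) (a y)) powr c"
      using ultra_add[OF N] mult_norm_nonneg[OF N(1)] c by (intro powr_mono2) auto
    then show ?thesis by (simp add: max_def split: if_splits)
  qed
  then show "ultrametric (\<lambda>x. a x powr c)" by (simp add: ultrametric_def)
qed

lemma places_above_nontrivial:
  assumes "prime p" and a: "a \<in> places_above p"
  shows "(a :: 'k::field_char_0 \<Rightarrow> real) \<in> nontrivial_absolute_values"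
proof -
  have "a (of_nat p) \<noteq> 1" "(of_nat p :: 'k) \<noteq> 0"
    using places_above_props(3)[OF a] prime_gt_1_nat[OF assms(1)] by auto
  then show ?thesis using places_above_props(4)[OF a] unfolding nontrivial_absolute_values_def by blast
qed

lemma places_above_other_prime:
  assumes "prime p" "prime q" "p \<noteq> q" "a \<in> places_above p"
  shows "a (of_nat q) = 1"
proof -
  have "\<not> int p dvd int q" using assms(1-3) primes_dvd_imp_eq by (metis int_dvd_int_iff)
  then show ?thesis using place_of_int_unit[OF assms(4,1), of "int q"] by simp
qed

lemma places_above_unique_prime:
  assumes "prime p" "prime q" "a \<in> places_above p" "a \<in> places_above q"
  shows "p = q"
proof (rule ccontr)
  assume "p \<noteq> q"
  then have "a (of_nat q) = 1" using assms by (intro places_above_other_prime)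
  then show False using places_above_props(3)[OF assms(4)] prime_gt_1_nat[OF assms(2)] by simp
qed

text \<open>Equivalent absolute values are powers of each other. The value at \<open>q\<close> shows
  that the two primes agree, and the normalisation there then forces the exponent 1.\<close>

lemma place_of_inj_nonarch:
  fixes a b :: "'k::field_char_0 \<Rightarrow> real"
  assumes p: "prime p" "prime q" and ab: "a \<in> places_above p" "b \<in> places_above q" and eq: "place_of a = place_of b"
  shows "a = b"
proof -
  note A = places_above_props[OF ab(1)] and B' = places_above_props[OF ab(2)]
  have q1: "real q > 1" using prime_gt_1_nat[OF p(2)] by simp
  obtain c where c: "c > 0" "\<And>x. b x = a x powr c"
    using place_of_eqD[OF eq places_above_nontrivial[OF p(2) ab(2)]] by blast
  have pq: "p = q"
  proof (rule ccontr)
    assume "p \<noteq> q"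
    then have "a (of_nat q) = 1" using p ab by (intro places_above_other_prime)
    then have "b (of_nat q) = 1" using c(2) by simp
    then show False using B'(3) q1 by simp
  qed
  have a_q: "a (of_nat q) = 1 / real q" using A(3) pq by simp
  have "(1 / real q) powr c = (1 / real q) powr 1"
    using c(2)[of "of_nat q"] q1 unfolding a_q B'(3) by simp
  then have "c = 1" using q1 powr_inj[of "1 / real q" c 1] by simp
  then show ?thesis using c(2) mult_norm_nonneg[OF A(1)] by (intro ext) simp
qed

context primitive_elt begin

section \<open>Archimedean absolute values from the embeddings\<close>

definition arch_av :: "complex \<Rightarrow> 'k \<Rightarrow> real" where "arch_av z x = cmod (sigma z x)"

lemma arch_av_two: "z \<in> Z \<Longrightarrow> arch_av z 2 = 2"
  using sigma_hom(1)[of z 1 1] by (simp add: arch_av_def sigma_hom(3))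

lemma arch_av_nontrivial:
  assumes z: "z \<in> Z"
  shows "arch_av z \<in> nontrivial_absolute_values"
proof -
  have 0: "sigma z 0 = 0" using sigma_hom(1)[OF z, of 0 0] by simp
  have "absolute_value (arch_av z)"
    unfolding absolute_value_def
  proof (intro conjI allI)
    fix x y
    show "arch_av z x = 0 \<longleftrightarrow> x = 0" using sigma_nonzero[OF z, of x] 0 by (auto simp: arch_av_def)
    show "arch_av z (x * y) = arch_av z x * arch_av z y" by (simp add: arch_av_def sigma_hom(2)[OF z] norm_mult)
    show "arch_av z (x + y) \<le> arch_av z x + arch_av z y" by (simp add: arch_av_def sigma_hom(1)[OF z] norm_triangle_ineq)
  qed (simp add: arch_av_def)
  moreover have "(2::'k) \<noteq> 0 \<and> arch_av z 2 \<noteq> 1" using arch_av_two[OF z] by simp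
  ultimately show ?thesis unfolding nontrivial_absolute_values_def by blast
qed

lemma arch_av_archimedean:
  assumes z: "z \<in> Z"
  shows "place_of (arch_av z) \<in> archimedean_places"
proof -
  have "\<not> arch_av z (1 + 1) \<le> max (arch_av z 1) (arch_av z 1)"
    using arch_av_two[OF z] by (simp add: arch_av_def sigma_hom(3)[OF z])
  then show ?thesis
    using place_of_in_places[OF arch_av_nontrivial[OF z]] mem_place_of[OF arch_av_nontrivial[OF z]]
    unfolding archimedean_places_def by blast
qed

lemma place_of_inj_arch:
  assumes z: "z \<in> Z" "y \<in> Z" and eq: "place_of (arch_av z) = place_of (arch_av y)"
  shows "arch_av z = arch_av y"
proof -
  obtain c where c: "c > 0" "\<And>x. arch_av y x = arch_av z x powr c"
    using place_of_eqD[OF eq arch_av_nontrivial[OF z(2)]] by blast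
  have "(2::real) powr c = 2 powr 1" using c(2)[of 2] z by (simp add: arch_av_two)
  then have "c = 1" using powr_inj[of 2 c 1] by simp
  then show ?thesis using c(2) by (intro ext) (simp add: arch_av_def)
qed

lemma place_of_arch_neq_nonarch:
  assumes z: "z \<in> Z" and a: "prime p" "a \<in> places_above p"
  shows "place_of (arch_av z) \<noteq> place_of a"
proof
  assume "place_of (arch_av z) = place_of a"
  then obtain c where c: "c > 0" "\<And>x. a x = arch_av z x powr c"
    using place_of_eqD[OF _ places_above_nontrivial[OF a]] by blast
  have "a (of_nat 2) \<le> 1" by (rule ultra_of_nat[OF places_above_props(1,2)[OF a(2)]])
  moreover have "1 < (2::real) powr c" using c(1) by simp
  ultimately show False using c(2)[of 2] arch_av_two[OF z] by simp
qed

text \<open>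
  Conjugate embeddings give the same absolute value, which then has weight 2.
\<close>

definition arch_weight :: "('k \<Rightarrow> real) \<Rightarrow> nat" where
  "arch_weight v = card {z \<in> Z. arch_av z = v}"

definition arch_emb :: "('k \<Rightarrow> real) \<Rightarrow> 'k \<Rightarrow> complex" where
  "arch_emb v = sigma (SOME z. z \<in> Z \<and> arch_av z = v)"

lemma arch_emb:
  assumes "v \<in> arch_av ` Z"
  obtains z where "z \<in> Z" "arch_av z = v" "arch_emb v = sigma z"
proof -
  have "\<exists>z. z \<in> Z \<and> arch_av z = v" using assms by blast
  from someI_ex[OF this] show thesis using that unfolding arch_emb_def by blast
qed

lemma arch_weight_pos:
  assumes "v \<in> arch_av ` Z"
  shows "1 \<le> arch_weight v"
proof -
  have "{z \<in> Z. arch_av z = v} \<noteq> {}" "finite {z \<in> Z. arch_av z = v}" using assms Z_card(1) by auto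
  then show ?thesis unfolding arch_weight_def by (metis One_nat_def Suc_leI card_gt_0_iff)
qed

lemma arch_weight_complex:
  assumes v: "v \<in> arch_av ` Z" and im: "Im (arch_emb v x) \<noteq> 0"
  shows "2 \<le> arch_weight v"
proof -
  obtain z where z: "z \<in> Z" "arch_av z = v" "arch_emb v = sigma z" using v by (rule arch_emb)
  have "cnj z \<noteq> z"
  proof
    assume "cnj z = z"
    then have "cnj (sigma z x) = sigma z x" using sigma_cnj(2)[of z x] by simp
    then show False using im z(3) by (simp add: complex_eq_iff)
  qed
  then have "card {z, cnj z} = 2" by auto
  moreover have "arch_av (cnj z) = v" using z(1,2) sigma_cnj(2) by (auto simp: arch_av_def)
  then have "{z, cnj z} \<subseteq> {z \<in> Z. arch_av z = v}" using z sigma_cnj(1) by auto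
  then have "card {z, cnj z} \<le> arch_weight v" unfolding arch_weight_def using Z_card(1) by (intro card_mono) auto
  ultimately show ?thesis by simp
qed

lemma sum_arch_weight: "(\<Sum>v\<in>arch_av ` Z. arch_weight v) = d"
  using sum.image_gen[OF Z_card(1), of "\<lambda>_. 1::nat" arch_av] Z_card by (simp add: arch_weight_def)

lemma sum_ln_arch:
  assumes x: "x \<noteq> 0"
  shows "(\<Sum>v\<in>arch_av ` Z. ln (v x ^ arch_weight v)) = ln \<bar>real_of_rat (field_norm x)\<bar>"
proof -
  have pos: "z \<in> Z \<Longrightarrow> cmod (sigma z x) > 0" for z using sigma_nonzero[OF _ x] by simp
  have "ln \<bar>real_of_rat (field_norm x)\<bar> = ln (cmod (of_rat (field_norm x)))"
  proof -
    have "(of_rat q :: complex) = of_real (real_of_rat q)" for q by (cases q) (simp add: of_rat_rat)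
    then show ?thesis by (simp add: norm_of_real)
  qed
  also have "\<dots> = ln (\<Prod>z\<in>Z. cmod (sigma z x))" by (simp add: field_norm prod_norm)
  also have "\<dots> = (\<Sum>z\<in>Z. ln (cmod (sigma z x)))"
    using pos by (intro ln_prod[OF Z_card(1)]) force
  also have "\<dots> = (\<Sum>v\<in>arch_av ` Z. \<Sum>z\<in>{z \<in> Z. arch_av z = v}. ln (cmod (sigma z x)))"
    by (rule sum.image_gen[OF Z_card(1)])
  also have "\<dots> = (\<Sum>v\<in>arch_av ` Z. ln (v x ^ arch_weight v))"
  proof (intro sum.cong refl)
    fix v assume v: "v \<in> arch_av ` Z"
    have "(\<Sum>z\<in>{z \<in> Z. arch_av z = v}. ln (cmod (sigma z x))) = (\<Sum>z\<in>{z \<in> Z. arch_av z = v}. ln (v x))"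
      by (intro sum.cong) (auto simp: arch_av_def)
    also have "\<dots> = ln (v x ^ arch_weight v)"
      using v pos by (auto simp: arch_weight_def arch_av_def ln_realpow)
    finally show "(\<Sum>z\<in>{z \<in> Z. arch_av z = v}. ln (cmod (sigma z x))) = ln (v x ^ arch_weight v)" .
  qed
  finally show ?thesis by simp
qed

theorem unit_equation_bound:
  fixes S :: "('k \<Rightarrow> real) set set" and lam mu :: 'k
  assumes S: "S \<subseteq> places" "finite S" "archimedean_places \<subseteq> S" and lm: "lam \<noteq> 0" "mu \<noteq> 0"
  defines "Sols \<equiv> {(x, y). x \<in> S_units S \<and> y \<in> S_units S \<and> lam * x + mu * y = 1}"
  shows "finite Sols" "real (card Sols) \<le> 5 * 3.2 ^ d * 45 ^ card S"
proof -
  define Ainf where "Ainf = arch_av ` Z"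
  define Fin where "Fin = {a :: 'k \<Rightarrow> real. (\<exists>p. prime p \<and> a \<in> places_above p) \<and> place_of a \<in> S}"
  have inj: "inj_on place_of (Ainf \<union> Fin)"
  proof (rule inj_onI)
    fix a b assume ab: "a \<in> Ainf \<union> Fin" "b \<in> Ainf \<union> Fin" and eq: "place_of a = place_of b"
    consider (1) z y where "z \<in> Z" "y \<in> Z" "a = arch_av z" "b = arch_av y"
      | (2) z p where "z \<in> Z" "prime p" "a = arch_av z" "b \<in> places_above p"
      | (3) z p where "z \<in> Z" "prime p" "b = arch_av z" "a \<in> places_above p"
      | (4) p q where "prime p" "prime q" "a \<in> places_above p" "b \<in> places_above q"
      using ab unfolding Ainf_def Fin_def by blast
    then show "a = b"
    proof cases
      case 1
      then show ?thesis using place_of_inj_arch[OF 1(1,2)] eq by simp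
    next
      case 2
      then show ?thesis using place_of_arch_neq_nonarch[OF 2(1,2,4)] eq by simp
    next
      case 3
      then show ?thesis using place_of_arch_neq_nonarch[OF 3(1,2,4)] eq by simp
    next
      case 4
      then show ?thesis using place_of_inj_nonarch[OF 4 eq] by simp
    qed
  qed
  have sub: "place_of ` (Ainf \<union> Fin) \<subseteq> S"
    using arch_av_archimedean S(3) unfolding Ainf_def Fin_def by blast
  have cardV: "card (Ainf \<union> Fin) \<le> card S" by (rule card_inj_on_le[OF inj sub S(2)])
  have "finite (Ainf \<union> Fin)" by (rule inj_on_finite[OF inj sub S(2)])
  then have finF: "finite Fin" "finite Ainf" by auto
  define pr where "pr a = (THE p. prime p \<and> a \<in> places_above p)" for a :: "'k \<Rightarrow> real"
  have pr: "pr a = p" if "prime p" "a \<in> places_above p" for a p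
    unfolding pr_def using that places_above_unique_prime by (intro the_equality) blast+
  \<comment> \<open>Besides the primes below \<open>Fin\<close>, those at which \<open>lam\<close>
    or \<open>mu\<close> fails to be a unit. The places above \<open>PP\<close> outside
    \<open>Fin\<close> form \<open>T\<close>, so all coordinates are units at the remaining places
    above primes.\<close>
  define PP where "PP = {p. prime p \<and> (\<exists>a\<in>Fin. a \<in> places_above p)} \<union>
    ({p. prime p \<and> (\<exists>a\<in>places_above p. a lam \<noteq> 1)} \<union> {p. prime p \<and> (\<exists>a\<in>places_above p. a mu \<noteq> 1)})"
  have "{p. prime p \<and> (\<exists>a\<in>Fin. a \<in> places_above p)} \<subseteq> pr ` Fin" using pr by blast
  then have finP: "finite PP"
    unfolding PP_def using finF finite_nonunit_primes[OF nf lm(1)] finite_nonunit_primes[OF nf lm(2)]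
    by (intro finite_UnI) (auto intro: finite_subset[of _ "pr ` Fin"])
  have primeP: "prime p" if "p \<in> PP" for p using that by (auto simp: PP_def)
  define F where "F = (\<Union>p\<in>PP. places_above p :: ('k \<Rightarrow> real) set)"
  define T where "T = F - Fin"
  have FinF: "Fin \<subseteq> F" unfolding Fin_def F_def PP_def by blast
  then have FT: "Fin \<union> T = F" by (auto simp: T_def)
  have finFF: "finite F" unfolding F_def using finP primeP places_above_finite[OF nf] by blast
  have FA: "Ainf \<inter> F = {}"
  proof (rule ccontr)
    assume "Ainf \<inter> F \<noteq> {}"
    then obtain z p where "z \<in> Z" "prime p" "arch_av z \<in> places_above p"
      using primeP unfolding Ainf_def F_def by blast
    then show False using place_of_arch_neq_nonarch by blast
  qed
  have "\<forall>p\<in>PP. \<exists>w. (\<forall>a\<in>places_above p. 0 \<le> w a) \<and>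
    (\<forall>x. x \<noteq> 0 \<longrightarrow> ln (padic p (field_norm x)) = (\<Sum>a\<in>places_above p. w a * ln (a x)))"
    using norm_factorization primeP by blast
  from bchoice[OF this] obtain w where w: "\<And>p a. p \<in> PP \<Longrightarrow> a \<in> places_above p \<Longrightarrow> 0 \<le> w p a"
    "\<And>p x. p \<in> PP \<Longrightarrow> x \<noteq> 0 \<Longrightarrow> ln (padic p (field_norm x)) = (\<Sum>a\<in>places_above p. w p a * ln (a x))"
    by blast
  \<comment> \<open>The normalisation in which the logarithms add up as those of the norm: the
    number of embeddings at infinity, the weight from \<open>norm_factorization\<close> above a
    prime.\<close>
  define nrm where "nrm a x = (if a \<in> Ainf then a x ^ arch_weight a else a x powr w (pr a) a)" for a x
  have nonarch: "mult_norm (nrm a) \<and> ultrametric (nrm a)" if a: "a \<in> F" for a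
  proof -
    obtain p where p: "p \<in> PP" "a \<in> places_above p" using a unfolding F_def by blast
    have "nrm a = (\<lambda>x. a x powr w p a)"
      using a FA pr[OF primeP[OF p(1)] p(2)] by (intro ext) (auto simp: nrm_def)
    then show ?thesis using mult_norm_powr[OF places_above_props(1,2)[OF p(2)] w(1)[OF p]] by simp
  qed
  have total: "(\<Sum>v\<in>Ainf \<union> Fin \<union> T. ln (nrm v x)) =
      ln (\<bar>real_of_rat (field_norm x)\<bar> * (\<Prod>p\<in>PP. padic p (field_norm x)))" if x: "x \<noteq> 0" for x
  proof -
    have pos: "padic p (field_norm x) > 0" if "p \<in> PP" for p
      using mult_norm_pos[OF padic_mult_norm[OF primeP[OF that]] field_norm_nonzero[OF x]] .
    have "(\<Sum>v\<in>Ainf. ln (nrm v x)) = ln \<bar>real_of_rat (field_norm x)\<bar>"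
      unfolding Ainf_def sum_ln_arch[OF x, symmetric] by (intro sum.cong) (auto simp: nrm_def Ainf_def)
    moreover have "(\<Sum>v\<in>F. ln (nrm v x)) = (\<Sum>p\<in>PP. \<Sum>v\<in>places_above p. ln (nrm v x))"
      unfolding F_def using finP primeP places_above_finite[OF nf] places_above_unique_prime
      by (intro sum.UNION_disjoint) blast+
    moreover have "(\<Sum>p\<in>PP. \<Sum>v\<in>places_above p. ln (nrm v x)) = (\<Sum>p\<in>PP. ln (padic p (field_norm x)))"
    proof (intro sum.cong refl)
      fix p assume p: "p \<in> PP"
      have "ln (nrm a x) = w p a * ln (a x)" if a: "a \<in> places_above p" for a
      proof -
        have "a \<notin> Ainf" using FA a p unfolding F_def by blast
        moreover have "a x > 0" using mult_norm_pos[OF places_above_props(1)[OF a] x] .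
        ultimately show ?thesis by (simp add: nrm_def pr[OF primeP[OF p] a] ln_powr)
      qed
      then show "(\<Sum>v\<in>places_above p. ln (nrm v x)) = ln (padic p (field_norm x))"
        using w(2)[OF p x] by simp
    qed
    moreover have "(\<Sum>p\<in>PP. ln (padic p (field_norm x))) = ln (\<Prod>p\<in>PP. padic p (field_norm x))"
      using pos by (intro ln_prod[symmetric] finP) force
    moreover have "(\<Prod>p\<in>PP. padic p (field_norm x)) > 0" using pos by (intro prod_pos) auto
    moreover have "(\<Sum>v\<in>Ainf \<union> F. ln (nrm v x)) = (\<Sum>v\<in>Ainf. ln (nrm v x)) + (\<Sum>v\<in>F. ln (nrm v x))"
      using finF finFF FA by (intro sum.union_disjoint)
    ultimately show ?thesis using field_norm_nonzero[OF x] by (simp add: Un_assoc FT ln_mult)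
  qed
  define R where "R = {x :: 'k. \<forall>p. prime p \<longrightarrow> p \<notin> PP \<longrightarrow> (\<forall>a\<in>places_above p. a x \<le> (1::real))}"
  define U where "U = {x :: 'k. x \<noteq> 0 \<and> (\<forall>p. prime p \<longrightarrow> p \<notin> PP \<longrightarrow> (\<forall>a\<in>places_above p. a x = (1::real)))}"
  have UR: "U \<subseteq> R" unfolding U_def R_def using order_eq_refl[of "_::real" 1] by blast
  have unit_T: "a x = 1" if "x \<in> S_units S" "prime p" "a \<in> places_above p" "a \<notin> Fin" for a x p
  proof -
    note n = places_above_nontrivial[OF that(2,3)]
    have "place_of a \<notin> S" using that unfolding Fin_def by blast
    then show ?thesis using place_of_in_places[OF n] mem_place_of[OF n] that(1) unfolding S_units_def by blast
  qed
  have unit_U: "c * x \<in> U" if x: "x \<in> S_units S" and c: "c = lam \<or> c = mu" for c x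
  proof -
    have "a (c * x) = 1" if p: "prime p" "p \<notin> PP" "a \<in> places_above p" for p a
    proof -
      have "a \<notin> Fin" using p unfolding PP_def by blast
      then have "a x = 1" using unit_T[OF x] p by blast
      moreover have "a c = 1" using p c unfolding PP_def by blast
      ultimately show ?thesis by (simp add: mult_norm_mult[OF places_above_props(1)[OF p(3)]])
    qed
    moreover have "c * x \<noteq> 0" using x c lm by (auto simp: S_units_def)
    ultimately show ?thesis unfolding U_def by blast
  qed
  have minus1: "a (-1) = 1" if "a \<in> places_above p" for a :: "'k \<Rightarrow> real" and p
    using mult_norm_minus[OF places_above_props(1)[OF that]] mult_norm_1[OF places_above_props(1)[OF that]] by simp
  then have m1U: "-1 \<in> U" by (simp add: U_def)
  define pt where "pt s i = (if i = 0 then lam * fst s else if i = 1 then mu * snd s else - 1)" for s and i :: nat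
  have pt_U: "pt s i \<in> U" if "s \<in> Sols" for s i
    using that unit_U m1U by (auto simp: Sols_def pt_def)
  have pt_sum: "pt s 0 + pt s 1 + pt s 2 = 0" if "s \<in> Sols" for s
    using that by (auto simp: Sols_def pt_def)
  have pt_inj: "s = t" if "lam * fst s = lam * fst t" "mu * snd s = mu * snd t" for s t
    using that lm by (simp add: prod_eq_iff)
  interpret unit_points Ainf Fin T nrm arch_emb arch_weight R "pt ` Sols"
  proof
    show "finite Ainf" "finite Fin" "finite T" using finF finFF by (auto simp: T_def)
    show "Ainf \<inter> Fin = {}" "Ainf \<inter> T = {}" "Fin \<inter> T = {}" using FA FinF by (auto simp: T_def)
    show "Ainf \<noteq> {}" using Z_card d_pos by (auto simp: Ainf_def)
  next
    fix v x y assume v: "v \<in> Ainf"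
    then obtain z where z: "z \<in> Z" "arch_av z = v" "arch_emb v = sigma z"
      unfolding Ainf_def by (rule arch_emb)
    show "arch_emb v (x + y) = arch_emb v x + arch_emb v y" "arch_emb v (x * y) = arch_emb v x * arch_emb v y"
      "arch_emb v 1 = 1"
      unfolding z(3) using sigma_hom[OF z(1)] by auto
    have "v x = cmod (sigma z x)" unfolding z(2)[symmetric] arch_av_def ..
    then show "nrm v x = cmod (arch_emb v x) ^ arch_weight v" using v z(3) by (simp add: nrm_def)
    show "1 \<le> arch_weight v" using arch_weight_pos v by (simp add: Ainf_def)
    show "2 \<le> arch_weight v" if "Im (arch_emb v x) \<noteq> 0"
      using arch_weight_complex that v by (simp add: Ainf_def)
  next
    fix v assume "v \<in> Fin \<union> T"
    then show "mult_norm (nrm v)" "ultrametric (nrm v)" using nonarch FT by auto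
  next
    have "a 1 \<le> 1" if "a \<in> places_above p" for a :: "'k \<Rightarrow> real" and p
      using mult_norm_1[OF places_above_props(1)[OF that]] by simp
    then show "1 \<in> R" unfolding R_def by blast
    fix x y assume xy: "x \<in> R" "y \<in> R"
    have "a (x - y) \<le> 1 \<and> a (x * y) \<le> 1" if p: "prime p" "p \<notin> PP" "a \<in> places_above p" for p a
    proof -
      note A = places_above_props[OF p(3)]
      have 1: "a x \<le> 1" "a y \<le> 1" using xy p unfolding R_def by blast+
      have "a (x - y) \<le> 1" using ultra_diff[OF A(1,2), of x y] 1 by simp
      moreover have "a (x * y) \<le> 1" using 1 by (simp add: mult_norm_mult[OF A(1)] mult_le_one mult_norm_nonneg[OF A(1)])
      ultimately show ?thesis ..
    qed
    then show "x - y \<in> R" "x * y \<in> R" unfolding R_def by blast+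
  next
    fix x assume x: "x \<in> R" "x \<noteq> 0"
    have "1 \<le> \<bar>real_of_rat (field_norm x)\<bar> * (\<Prod>p\<in>PP. padic p (field_norm x))"
    proof (rule rat_product_ge_1[OF finP primeP field_norm_nonzero[OF x(2)]])
      fix p assume "prime p" "p \<notin> PP"
      then show "padic p (field_norm x) \<le> 1" using x(1) unfolding R_def by (intro field_norm_padic_le) auto
    qed
    then show "0 \<le> (\<Sum>v\<in>Ainf \<union> Fin \<union> T. ln (nrm v x))" by (simp add: total[OF x(2)])
  next
    fix P assume "P \<in> pt ` Sols"
    then obtain s where s: "s \<in> Sols" "P = pt s" by blast
    show "P 0 + P 1 + P 2 = 0" using pt_sum[OF s(1)] s(2) by simp
    fix i :: nat
    have PU: "P i \<in> U" using pt_U[OF s(1)] s(2) by simp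
    then show P0: "P i \<noteq> 0" by (simp add: U_def)
    show "P i \<in> R" using PU UR by blast
    have "\<bar>real_of_rat (field_norm (P i))\<bar> * (\<Prod>p\<in>PP. padic p (field_norm (P i))) = 1"
    proof (rule rat_product_eq_1[OF finP primeP field_norm_nonzero[OF P0]])
      fix p assume "prime p" "p \<notin> PP"
      then show "padic p (field_norm (P i)) = 1" using PU P0 unfolding U_def by (intro padic_norm_eq_1) auto
    qed
    then show "(\<Sum>v\<in>Ainf \<union> Fin \<union> T. ln (nrm v (P i))) = 0" by (simp add: total[OF P0])
  next
    fix P Q assume "P \<in> pt ` Sols" "Q \<in> pt ` Sols"
    then obtain s t where st: "s \<in> Sols" "t \<in> Sols" "P = pt s" "Q = pt t" by blast
    have eq: "lam * fst s + mu * snd s = 1" "lam * fst t + mu * snd t = 1"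
      using st(1,2) by (auto simp: Sols_def)
    show "nrm v (P i) = nrm v (Q i)" if v: "v \<in> T" for v and i :: nat
    proof -
      obtain p where p: "p \<in> PP" "v \<in> places_above p" using v unfolding T_def F_def by blast
      note A = places_above_props[OF p(2)]
      \<comment> \<open>A place of \<open>T\<close> lies outside \<open>S\<close>, so both unknowns
        are units there and the coordinates have the values of \<open>lam\<close>, \<open>mu\<close>
        and -1.\<close>
      have u: "v (fst r) = 1" "v (snd r) = 1" if r: "r \<in> Sols" for r
        using unit_T[OF _ primeP[OF p(1)] p(2)] r v by (auto simp: Sols_def T_def)
      have "v (P i) = v (Q i)"
        using u[OF st(1)] u[OF st(2)] unfolding st(3,4) pt_def by (simp add: mult_norm_mult[OF A(1)])
      then show ?thesis by (simp add: nrm_def)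
    qed
    assume PQ: "P \<noteq> Q"
    \<comment> \<open>The first two coordinates of each point sum to 1, so their proportionality
      already forces equality.\<close>
    show "Q 0 * P 1 - Q 1 * P 0 \<noteq> 0"
    proof
      assume "Q 0 * P 1 - Q 1 * P 0 = 0"
      then have 0: "(lam * fst t) * (mu * snd s) = (mu * snd t) * (lam * fst s)" by (simp add: st(3,4) pt_def)
      have m: "mu * snd s = 1 - lam * fst s" "mu * snd t = 1 - lam * fst t" using eq by (simp_all add: eq_diff_eq add.commute)
      have "lam * fst t = lam * fst s" using 0 unfolding m by (simp add: right_diff_distrib left_diff_distrib mult.commute)
      then have "t = s" using m by (intro pt_inj) simp_all
      then show False using PQ st by blast
    qed
  qed
  have "inj_on pt Sols"
  proof (rule inj_onI)
    fix s t assume "pt s = pt t"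
    then have "pt s 0 = pt t 0" "pt s 1 = pt t 1" by simp_all
    then show "s = t" by (intro pt_inj) (simp_all add: pt_def)
  qed
  then have c: "finite Sols" "card (pt ` Sols) = card Sols"
    using solution_count(1) by (simp_all add: finite_image_iff card_image)
  show "finite Sols" by (rule c)
  have "real (card Sols) \<le> 5 * 3.2 ^ d * 45 ^ card (Ainf \<union> Fin)"
    using solution_count(2) sum_arch_weight unfolding c(2) V_def m_def by (simp add: Ainf_def)
  also have "\<dots> \<le> 5 * 3.2 ^ d * 45 ^ card S"
    using cardV by (intro mult_left_mono power_increasing) auto
  finally show "real (card Sols) \<le> 5 * 3.2 ^ d * 45 ^ card S" .
qed

end

theorem mainTheorem2:
  fixes S :: "('k::field_char_0 \<Rightarrow> real) set set"
    and lam mu :: 'k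
    and m s :: nat
  assumes "number_field TYPE('k)"
    and "m = field_degree TYPE('k)"
    and "S \<subseteq> places"
    and "finite S"
    and "archimedean_places \<subseteq> S"
    and "s = card S"
    and "lam \<noteq> 0"
    and "mu \<noteq> 0"
  shows "finite {(x, y). x \<in> S_units S \<and> y \<in> S_units S \<and> lam * x + mu * y = 1} \<and>
    real (card {(x, y). x \<in> S_units S \<and> y \<in> S_units S \<and> lam * x + mu * y = 1}) \<le>
      min (2.81864 * 46.8312 ^ s + 5 * 3.22803 ^ m * 47 ^ s)
          (3.06759 * 44.9866 ^ s + 5 * 3.36406 ^ m * 45 ^ s)"
proof -
  obtain theta :: 'k where theta: "adjoin theta = UNIV" using primitive_element[OF assms(1)] by blast
  obtain f where f: "f \<noteq> 0" "rat_eval f theta = 0"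
    "\<And>p. p \<noteq> 0 \<Longrightarrow> rat_eval p theta = 0 \<Longrightarrow> degree f \<le> degree p"
    using minimal_rat_poly[OF assms(1)] by blast
  interpret primitive_elt theta f by unfold_locales (fact assms(1) theta f)+
  \<comment> \<open>Both terms of the minimum have this shape, with \<open>C\<close> equal to
    3.22803 or 3.36406 and \<open>D\<close> equal to 47 or 45. Since \<open>d \<le> m\<close>, the
    bound \<open>5 * 3.2 ^ d * 45 ^ s\<close> lies below the second summand.\<close>
  have le: "5 * 3.2 ^ d * 45 ^ s \<le> A * B ^ s + 5 * C ^ m * D ^ s"
    if "0 \<le> A" "0 \<le> B" "3.2 \<le> C" "45 \<le> D" for A B C D :: real
  proof -
    have "(3.2::real) ^ d \<le> 3.2 ^ m" using d_le assms(2) by (intro power_increasing) auto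
    also have "\<dots> \<le> C ^ m" using that by (intro power_mono) auto
    finally have "5 * (3.2::real) ^ d * 45 ^ s \<le> 5 * C ^ m * D ^ s"
      using that by (intro mult_mono power_mono) auto
    moreover have "0 \<le> A * B ^ s" using that by simp
    ultimately show ?thesis by linarith
  qed
  note bound = unit_equation_bound[OF assms(3-5,7,8), folded assms(6)]
  show ?thesis
    by (intro conjI bound(1) min.boundedI order.trans[OF bound(2)] le) simp_all
qed

end
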